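(* Let $H = GL_3(\mathbb{F}_2) \times GL_3(\mathbb{F}_2) \times GL_3(\mathbb{F}_2)$ and $G = H \rtimes S_3$ act on the set of $3 \times 3 \times 3$ tensors over $\mathbb{F}_2$. Then: (i) Every $3 \times 3 \times 3$ tensor over $\mathbb{F}_2$ has rank at most $6$. There are exactly $115$ nonzero $H$-orbits and exactly $55$ nonzero $G$-orbits, and the numbers of $H$-orbits, of $G$-orbits and of tensors of each rank are as follows. $$ \begin{array}{lrrrrrrr} \text{rank} & 0 & 1 & 2 & 3 & 4 & 5 & 6 \\ \#\ H\text{-orbits} & 1 & 1 & 4 & 18 & 44 & 45 & 3 \\ \#\ G\text{-orbits} & 1 & 1 & 2 & 8 & 18 & 23 & 3 \\ \#\ \text{tensors} & 1 & 343 & 43218 & 2372286 & 47506872 & 83670048 & 624960 \end{array} $$ (ii) The following is the complete list of the canonical forms of the $55$ nonzero $G$-orbits. Each entry has the form "number; orbit size; flattening of the canonical form", where the flattening is written as a word of $27$ bits in three blocks of nine. Rank 1: 1; 343; 000000000 000000000 000000001. Rank 2: 2; 6174; 000000000 000000000 000001010. 3; 37044; 000000000 000000001 000010000. Rank 3: 4; 3528; 000000000 000000000 001010100. 5; 4116; 000000000 000001010 000010011. 6; 18522; 000000000 000000001 000001010. 7; 148176; 000000000 000001010 000010100. 8; 222264; 000000000 000000001 000010100. 9; 592704; 000000000 000000001 010100000. 10; 592704; 000000000 000001010 100000010. 11; 790272; 000000001 000010000 100000000. Rank 4: 12; 148176; 000000000 000001010 001000100. 13; 197568; 000001010 001000100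 010110010. 14; 222264; 000000000 000000001 001010100. 15; 263424; 000000001 010100000 100110000. 16; 444528; 000000000 000001010 001010100. 17; 592704; 000000000 000001010 100010011. 18; 1185408; 000000001 000001010 100000000. 19; 1778112; 000000000 000001010 001100000. 20; 1778112; 000000001 000000010 001100000. 21; 1778112; 000000001 000010000 011100100. 22; 2370816; 000000001 010100000 100110010. 23; 2370816; 000000001 010100000 100111010. 24; 3556224; 000000001 000001010 100000010. 25; 4741632; 000000001 000010000 100000010. 26; 4741632; 000000001 000010100 100001000. 27; 7112448; 000000001 000001010 100010000. 28; 7112448; 000000001 000010000 100001010. 29; 7112448; 000000001 000010100 011100000. Rank 5: 30; 28224; 000001010 001000100 010100000. 31; 148176; 000000001 000000010 001010100. 32; 148176; 000000001 000001010 001010100. 33; 169344; 000000000 001010100 010100011. 34; 592704; 000001010 001000100 010110011. 35; 1185408; 000001010 001000100 010100010. 36; 1580544; 000001010 001000100 100110000. 37; 1580544; 000001010 001000100 100110001. 38; 1778112; 000000001 000001010 001100000. 39; 1778112; 000000001 000010100 001100110. 40; 2370816; 000001010 001000100 010110100. 41; 2370816; 000001010 001010100 100100001. 42; 2370816; 000001010 001010100 100100101. 43; 3556224; 000000001 000001010 010100000. 44; 4741632; 000000001 010100000 100111100. 45; 4741632; 000001010 001010100 010100100. 46; 4741632; 000001010 001010100 100000010. 47; 4741632; 000001010 001010100 100000011. 48; 4741632; 000001010 001010100 100100010. 49; 4741632; 000001010 001010100 100100110. 50; 7112448; 000000001 001010100 100001010. 51; 14224896; 000000001 000010100 100001010.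 52; 14224896; 000000001 001010100 010100000. Rank 6: 53; 32256; 001010100 010100011 100011110. 54; 197568; 000001010 001000100 010100001. 55; 395136; 000001010 001010100 010100011.
   Context: A tensor here is a $3 \times 3 \times 3$ array $X = [x_{ijk}]_{1 \le i,j,k \le 3}$ with entries in the field $\mathbb{F}_2$ with two elements, identified with an element of $\mathbb{F}_2^3 \otimes \mathbb{F}_2^3 \otimes \mathbb{F}_2^3$. For $\mathbf{a},\mathbf{b},\mathbf{c} \in \mathbb{F}_2^3$, the outer product $\mathbf{a} \otimes \mathbf{b} \otimes \mathbf{c}$ is the tensor with $ijk$ entry $a_i b_j c_k$; a simple tensor is an outer product of nonzero vectors. The rank of $X$ is the smallest non-negative integer $n$ such that $X$ is a sum of $n$ simple tensors over $\mathbb{F}_2$; rank is constant on the orbits considered here. The group $H = GL_3(\mathbb{F}_2)^3$ acts by $((A,B,C)\cdot X)_{i_1 j_1 k_1} = \sum_{i_2,j_2,k_2=1}^3 a_{i_1 i_2} b_{j_1 j_2} c_{k_1 k_2} x_{i_2 j_2 k_2}$ for $A = (a_{ij})$, $B = (b_{ij})$, $C = (c_{ij})$ in $GL_3(\mathbb{F}_2)$. The symmetric group $S_3$ acts by permuting the three directions: $(\delta \cdot X)_{i_{\delta(1)} i_{\delta(2)} i_{\delta(3)}} = x_{i_1 i_2 i_3}$ for $\delta \in S_3$. Together these give the action of $G = H \rtimes S_3$. The flattening of $X$ is the row vector $[x_{111}, x_{112}, x_{113}, x_{121}, \dots, x_{333}]$ with the entries in lexicographic order of the subscripts $(i,j,k)$.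 Tensors are totally ordered by the lexicographic order on flattenings with $0<1$ (equivalently, by the integers whose base-2 representations are the flattenings). The canonical form of a $G$-orbit is its minimal element in this order. The size of an orbit is the number of tensors in it. *)

theory Defs
  imports
    "HOL-Analysis.Cartesian_Space"
    "HOL-Algebra.Group_Action"
    "HOL-Library.Z2"
begin

section \<open>Tensors over the field with two elements and their rank\<close>

text \<open>
  The field is \<^typ>\<open>bit\<close>; the indices 1, 2, 3 are the elements of the type \<^typ>\<open>3\<close>
  (where \<open>3 = 0\<close>, which matters only for the order of the entries in \<open>flattening\<close> below).
  The entry \<open>x\<^sub>i\<^sub>j\<^sub>k\<close> of \<open>X\<close> is \<open>X $ i $ j $ k\<close>.
\<close>

type_synonym matrix3 = "bit ^ 3 ^ 3"
type_synonym tensor = "bit ^ 3 ^ 3 ^ 3"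

definition outer_product :: "bit ^ 3 \<Rightarrow> bit ^ 3 \<Rightarrow> bit ^ 3 \<Rightarrow> tensor" where
  "outer_product a b c = (\<chi> i j k. a $ i * b $ j * c $ k)"

definition simple_tensor :: "tensor \<Rightarrow> bool" where
  "simple_tensor X \<longleftrightarrow> (\<exists>a b c. a \<noteq> 0 \<and> b \<noteq> 0 \<and> c \<noteq> 0 \<and> X = outer_product a b c)"

definition is_sum_of_simple :: "nat \<Rightarrow> tensor \<Rightarrow> bool" where
  "is_sum_of_simple n X \<longleftrightarrow>
     (\<exists>Ts. length Ts = n \<and> (\<forall>T \<in> set Ts. simple_tensor T) \<and> X = sum_list Ts)"

definition tensor_rank :: "tensor \<Rightarrow> nat" where
  "tensor_rank X = (LEAST n. is_sum_of_simple n X)"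


section \<open>The group actions\<close>

definition GL3 :: "matrix3 monoid" where
  "GL3 = \<lparr>carrier = {A. invertible A}, mult = (**), one = mat 1\<rparr>"

definition H_group :: "(matrix3 \<times> matrix3 \<times> matrix3) monoid" where
  "H_group = GL3 \<times>\<times> GL3 \<times>\<times> GL3"

definition H_act :: "matrix3 \<times> matrix3 \<times> matrix3 \<Rightarrow> tensor \<Rightarrow> tensor" where
  "H_act = (\<lambda>(A, B, C) X. \<chi> i1 j1 k1.
     \<Sum>i2\<in>UNIV. \<Sum>j2\<in>UNIV. \<Sum>k2\<in>UNIV. A $ i1 $ i2 * B $ j1 $ j2 * C $ k1 $ k2 * X $ i2 $ j2 $ k2)"

text \<open>
  The formula \<open>(\<delta> \<cdot> X)\<^bsub>i \<circ> \<delta>\<^esub> = X\<^bsub>i\<^esub>\<close> (for index triples \<open>i\<close>, see \<open>entry_S3_act\<close> below) is a left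
  action when permutations are multiplied from left to right; hence the order of composition
  in \<open>S3_group\<close>.
\<close>

definition S3_group :: "(3 \<Rightarrow> 3) monoid" where
  "S3_group = \<lparr>carrier = {\<delta>. bij \<delta>}, mult = (\<lambda>\<delta> \<epsilon>. \<epsilon> \<circ> \<delta>), one = id\<rparr>"

definition triple :: "'a::zero \<Rightarrow> 'a \<Rightarrow> 'a \<Rightarrow> 3 \<Rightarrow> 'a" where
  "triple x y z = ($) (vector [x, y, z] :: 'a ^ 3)"

definition entry :: "tensor \<Rightarrow> (3 \<Rightarrow> 3) \<Rightarrow> bit" where
  "entry X i = X $ i 1 $ i 2 $ i 3"

definition S3_act :: "(3 \<Rightarrow> 3) \<Rightarrow> tensor \<Rightarrow> tensor" where
  "S3_act \<delta> X = (\<chi> i j k. entry X (triple i j k \<circ> inv_into UNIV \<delta>))"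

definition permute_factors ::
    "(3 \<Rightarrow> 3) \<Rightarrow> matrix3 \<times> matrix3 \<times> matrix3 \<Rightarrow> matrix3 \<times> matrix3 \<times> matrix3" where
  "permute_factors \<delta> = (\<lambda>(A, B, C).
     (triple A B C (\<delta> 1), triple A B C (\<delta> 2), triple A B C (\<delta> 3)))"

definition semidirect_product ::
    "('a, 'm) monoid_scheme \<Rightarrow> ('b, 'n) monoid_scheme \<Rightarrow> ('b \<Rightarrow> 'a \<Rightarrow> 'a) \<Rightarrow> ('a \<times> 'b) monoid" where
  "semidirect_product N K \<theta> =
     \<lparr>carrier = carrier N \<times> carrier K,
      mult = (\<lambda>(n, k) (n', k'). (n \<otimes>\<^bsub>N\<^esub> \<theta> k n', k \<otimes>\<^bsub>K\<^esub> k')),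
      one = (\<one>\<^bsub>N\<^esub>, \<one>\<^bsub>K\<^esub>)\<rparr>"

definition G_group :: "((matrix3 \<times> matrix3 \<times> matrix3) \<times> (3 \<Rightarrow> 3)) monoid" where
  "G_group = semidirect_product H_group S3_group permute_factors"

definition G_act :: "(matrix3 \<times> matrix3 \<times> matrix3) \<times> (3 \<Rightarrow> 3) \<Rightarrow> tensor \<Rightarrow> tensor" where
  "G_act = (\<lambda>(h, \<delta>) X. H_act h (S3_act \<delta> X))"

abbreviation H_orbits :: "tensor set set" where
  "H_orbits \<equiv> orbits H_group UNIV H_act"

abbreviation G_orbits :: "tensor set set" where
  "G_orbits \<equiv> orbits G_group UNIV G_act"


section \<open>Flattenings and canonical forms\<close>

definition flattening :: "tensor \<Rightarrow> bit list" where
  "flattening X = [X $ i $ j $ k. i \<leftarrow> [1, 2, 3], j \<leftarrow> [1, 2, 3], k \<leftarrow> [1, 2, 3]]"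

definition tensor_less :: "tensor \<Rightarrow> tensor \<Rightarrow> bool" where
  "tensor_less X Y \<longleftrightarrow> (flattening X, flattening Y) \<in> lexord {(0, 1)}"

definition canonical_form :: "tensor set \<Rightarrow> tensor" where
  "canonical_form U = (THE X. X \<in> U \<and> (\<forall>Y \<in> U. Y \<noteq> X \<longrightarrow> tensor_less X Y))"

text \<open>The entries are (rank, orbit size, flattening of the canonical form).\<close>

definition canonical_list :: "(nat \<times> nat \<times> bit list) list" where
  "canonical_list = [
   (1, 343, [0,0,0,0,0,0,0,0,0,  0,0,0,0,0,0,0,0,0,  0,0,0,0,0,0,0,0,1]),
   (2, 6174, [0,0,0,0,0,0,0,0,0,  0,0,0,0,0,0,0,0,0,  0,0,0,0,0,1,0,1,0]),
   (2, 37044, [0,0,0,0,0,0,0,0,0,  0,0,0,0,0,0,0,0,1,  0,0,0,0,1,0,0,0,0]),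
   (3, 3528, [0,0,0,0,0,0,0,0,0,  0,0,0,0,0,0,0,0,0,  0,0,1,0,1,0,1,0,0]),
   (3, 4116, [0,0,0,0,0,0,0,0,0,  0,0,0,0,0,1,0,1,0,  0,0,0,0,1,0,0,1,1]),
   (3, 18522, [0,0,0,0,0,0,0,0,0,  0,0,0,0,0,0,0,0,1,  0,0,0,0,0,1,0,1,0]),
   (3, 148176, [0,0,0,0,0,0,0,0,0,  0,0,0,0,0,1,0,1,0,  0,0,0,0,1,0,1,0,0]),
   (3, 222264, [0,0,0,0,0,0,0,0,0,  0,0,0,0,0,0,0,0,1,  0,0,0,0,1,0,1,0,0]),
   (3, 592704, [0,0,0,0,0,0,0,0,0,  0,0,0,0,0,0,0,0,1,  0,1,0,1,0,0,0,0,0]),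
   (3, 592704, [0,0,0,0,0,0,0,0,0,  0,0,0,0,0,1,0,1,0,  1,0,0,0,0,0,0,1,0]),
   (3, 790272, [0,0,0,0,0,0,0,0,1,  0,0,0,0,1,0,0,0,0,  1,0,0,0,0,0,0,0,0]),
   (4, 148176, [0,0,0,0,0,0,0,0,0,  0,0,0,0,0,1,0,1,0,  0,0,1,0,0,0,1,0,0]),
   (4, 197568, [0,0,0,0,0,1,0,1,0,  0,0,1,0,0,0,1,0,0,  0,1,0,1,1,0,0,1,0]),
   (4, 222264, [0,0,0,0,0,0,0,0,0,  0,0,0,0,0,0,0,0,1,  0,0,1,0,1,0,1,0,0]),
   (4, 263424, [0,0,0,0,0,0,0,0,1,  0,1,0,1,0,0,0,0,0,  1,0,0,1,1,0,0,0,0]),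
   (4, 444528, [0,0,0,0,0,0,0,0,0,  0,0,0,0,0,1,0,1,0,  0,0,1,0,1,0,1,0,0]),
   (4, 592704, [0,0,0,0,0,0,0,0,0,  0,0,0,0,0,1,0,1,0,  1,0,0,0,1,0,0,1,1]),
   (4, 1185408, [0,0,0,0,0,0,0,0,1,  0,0,0,0,0,1,0,1,0,  1,0,0,0,0,0,0,0,0]),
   (4, 1778112, [0,0,0,0,0,0,0,0,0,  0,0,0,0,0,1,0,1,0,  0,0,1,1,0,0,0,0,0]),
   (4, 1778112, [0,0,0,0,0,0,0,0,1,  0,0,0,0,0,0,0,1,0,  0,0,1,1,0,0,0,0,0]),
   (4, 1778112, [0,0,0,0,0,0,0,0,1,  0,0,0,0,1,0,0,0,0,  0,1,1,1,0,0,1,0,0]),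
   (4, 2370816, [0,0,0,0,0,0,0,0,1,  0,1,0,1,0,0,0,0,0,  1,0,0,1,1,0,0,1,0]),
   (4, 2370816, [0,0,0,0,0,0,0,0,1,  0,1,0,1,0,0,0,0,0,  1,0,0,1,1,1,0,1,0]),
   (4, 3556224, [0,0,0,0,0,0,0,0,1,  0,0,0,0,0,1,0,1,0,  1,0,0,0,0,0,0,1,0]),
   (4, 4741632, [0,0,0,0,0,0,0,0,1,  0,0,0,0,1,0,0,0,0,  1,0,0,0,0,0,0,1,0]),
   (4, 4741632, [0,0,0,0,0,0,0,0,1,  0,0,0,0,1,0,1,0,0,  1,0,0,0,0,1,0,0,0]),
   (4, 7112448, [0,0,0,0,0,0,0,0,1,  0,0,0,0,0,1,0,1,0,  1,0,0,0,1,0,0,0,0]),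
   (4, 7112448, [0,0,0,0,0,0,0,0,1,  0,0,0,0,1,0,0,0,0,  1,0,0,0,0,1,0,1,0]),
   (4, 7112448, [0,0,0,0,0,0,0,0,1,  0,0,0,0,1,0,1,0,0,  0,1,1,1,0,0,0,0,0]),
   (5, 28224, [0,0,0,0,0,1,0,1,0,  0,0,1,0,0,0,1,0,0,  0,1,0,1,0,0,0,0,0]),
   (5, 148176, [0,0,0,0,0,0,0,0,1,  0,0,0,0,0,0,0,1,0,  0,0,1,0,1,0,1,0,0]),
   (5, 148176, [0,0,0,0,0,0,0,0,1,  0,0,0,0,0,1,0,1,0,  0,0,1,0,1,0,1,0,0]),
   (5, 169344, [0,0,0,0,0,0,0,0,0,  0,0,1,0,1,0,1,0,0,  0,1,0,1,0,0,0,1,1]),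
   (5, 592704, [0,0,0,0,0,1,0,1,0,  0,0,1,0,0,0,1,0,0,  0,1,0,1,1,0,0,1,1]),
   (5, 1185408, [0,0,0,0,0,1,0,1,0,  0,0,1,0,0,0,1,0,0,  0,1,0,1,0,0,0,1,0]),
   (5, 1580544, [0,0,0,0,0,1,0,1,0,  0,0,1,0,0,0,1,0,0,  1,0,0,1,1,0,0,0,0]),
   (5, 1580544, [0,0,0,0,0,1,0,1,0,  0,0,1,0,0,0,1,0,0,  1,0,0,1,1,0,0,0,1]),
   (5, 1778112, [0,0,0,0,0,0,0,0,1,  0,0,0,0,0,1,0,1,0,  0,0,1,1,0,0,0,0,0]),
   (5, 1778112, [0,0,0,0,0,0,0,0,1,  0,0,0,0,1,0,1,0,0,  0,0,1,1,0,0,1,1,0]),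
   (5, 2370816, [0,0,0,0,0,1,0,1,0,  0,0,1,0,0,0,1,0,0,  0,1,0,1,1,0,1,0,0]),
   (5, 2370816, [0,0,0,0,0,1,0,1,0,  0,0,1,0,1,0,1,0,0,  1,0,0,1,0,0,0,0,1]),
   (5, 2370816, [0,0,0,0,0,1,0,1,0,  0,0,1,0,1,0,1,0,0,  1,0,0,1,0,0,1,0,1]),
   (5, 3556224, [0,0,0,0,0,0,0,0,1,  0,0,0,0,0,1,0,1,0,  0,1,0,1,0,0,0,0,0]),
   (5, 4741632, [0,0,0,0,0,0,0,0,1,  0,1,0,1,0,0,0,0,0,  1,0,0,1,1,1,1,0,0]),
   (5, 4741632, [0,0,0,0,0,1,0,1,0,  0,0,1,0,1,0,1,0,0,  0,1,0,1,0,0,1,0,0]),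
   (5, 4741632, [0,0,0,0,0,1,0,1,0,  0,0,1,0,1,0,1,0,0,  1,0,0,0,0,0,0,1,0]),
   (5, 4741632, [0,0,0,0,0,1,0,1,0,  0,0,1,0,1,0,1,0,0,  1,0,0,0,0,0,0,1,1]),
   (5, 4741632, [0,0,0,0,0,1,0,1,0,  0,0,1,0,1,0,1,0,0,  1,0,0,1,0,0,0,1,0]),
   (5, 4741632, [0,0,0,0,0,1,0,1,0,  0,0,1,0,1,0,1,0,0,  1,0,0,1,0,0,1,1,0]),
   (5, 7112448, [0,0,0,0,0,0,0,0,1,  0,0,1,0,1,0,1,0,0,  1,0,0,0,0,1,0,1,0]),
   (5, 14224896, [0,0,0,0,0,0,0,0,1,  0,0,0,0,1,0,1,0,0,  1,0,0,0,0,1,0,1,0]),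
   (5, 14224896, [0,0,0,0,0,0,0,0,1,  0,0,1,0,1,0,1,0,0,  0,1,0,1,0,0,0,0,0]),
   (6, 32256, [0,0,1,0,1,0,1,0,0,  0,1,0,1,0,0,0,1,1,  1,0,0,0,1,1,1,1,0]),
   (6, 197568, [0,0,0,0,0,1,0,1,0,  0,0,1,0,0,0,1,0,0,  0,1,0,1,0,0,0,0,1]),
   (6, 395136, [0,0,0,0,0,1,0,1,0,  0,0,1,0,1,0,1,0,0,  0,1,0,1,0,0,0,1,1])]"


section \<open>The definitions are meaningful\<close>

lemma entry_S3_act:
  assumes "bij \<delta>"
  shows "entry (S3_act \<delta> X) (i \<circ> \<delta>) = entry X i"
proof -
  have "triple (i (\<delta> 1)) (i (\<delta> 2)) (i (\<delta> 3)) = i \<circ> \<delta>"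
    by (simp add: fun_eq_iff forall_3 triple_def)
  moreover have "i \<circ> \<delta> \<circ> inv_into UNIV \<delta> = i"
    using assms by (simp add: fun_eq_iff bij_is_surj surj_f_inv_f)
  ultimately show ?thesis
    unfolding entry_def[of "S3_act \<delta> X"] unfolding S3_act_def by simp
qed

lemma entry_eqI:
  assumes "\<And>i. entry X i = entry Y i"
  shows "X = Y"
proof -
  have "X $ i $ j $ k = Y $ i $ j $ k" for i j k
    using assms[of "triple i j k"] by (simp add: entry_def triple_def)
  then show ?thesis by (simp add: vec_eq_iff)
qed

lemma entry_S3_act':
  assumes "bij \<delta>"
  shows "entry (S3_act \<delta> X) i = entry X (i \<circ> inv_into UNIV \<delta>)"
proof -
  have "i \<circ> inv_into UNIV \<delta> \<circ> \<delta> = i"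
    using assms by (simp add: fun_eq_iff bij_is_inj)
  then show ?thesis
    using entry_S3_act[OF assms, of X "i \<circ> inv_into UNIV \<delta>"] by simp
qed

lemma S3_act_id: "S3_act id X = X"
  by (rule entry_eqI) (simp add: entry_S3_act')

lemma S3_act_comp:
  assumes "bij \<delta>" "bij \<epsilon>"
  shows "S3_act (\<epsilon> \<circ> \<delta>) X = S3_act \<delta> (S3_act \<epsilon> X)"
  by (rule entry_eqI)
     (simp add: entry_S3_act' assms bij_comp o_inv_distrib comp_assoc)

definition mv :: "'a::comm_semiring_1 ^ 3 ^ 3 \<Rightarrow> (3 \<Rightarrow> 'a) \<Rightarrow> 3 \<Rightarrow> 'a" where
  "mv A x i = (\<Sum>j\<in>UNIV. A $ i $ j * x j)"

lemma mv_mult: "mv A (mv B x) i = mv (A ** B) x i"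
proof -
  have "mv A (mv B x) i = (\<Sum>j\<in>UNIV. \<Sum>l\<in>UNIV. A $ i $ j * B $ j $ l * x l)"
    by (simp add: mv_def sum_distrib_left mult.assoc)
  also have "\<dots> = (\<Sum>l\<in>UNIV. \<Sum>j\<in>UNIV. A $ i $ j * B $ j $ l * x l)"
    by (rule sum.swap)
  also have "\<dots> = mv (A ** B) x i"
    by (simp add: mv_def matrix_matrix_mult_def sum_distrib_right)
  finally show ?thesis .
qed

lemma mv_commute:
  "mv A (\<lambda>a. mv B (\<lambda>b. y a b) j) i = mv B (\<lambda>b. mv A (\<lambda>a. y a b) i) j"
proof -
  have "mv A (\<lambda>a. mv B (\<lambda>b. y a b) j) i
      = (\<Sum>a\<in>UNIV. \<Sum>b\<in>UNIV. A $ i $ a * (B $ j $ b * y a b))"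
    by (simp add: mv_def sum_distrib_left)
  also have "\<dots> = (\<Sum>b\<in>UNIV. \<Sum>a\<in>UNIV. A $ i $ a * (B $ j $ b * y a b))"
    by (rule sum.swap)
  also have "\<dots> = mv B (\<lambda>b. mv A (\<lambda>a. y a b) i) j"
    by (simp add: mv_def sum_distrib_left mult.left_commute)
  finally show ?thesis .
qed

lemma mv_id: "mv (mat 1) x i = x i"
  by (simp add: mv_def mat_def if_distrib[where f = "\<lambda>u. u * _"] sum.delta cong: if_cong)

lemma H_act_nth:
  "H_act (A, B, C) X $ i $ j $ k
     = mv A (\<lambda>a. mv B (\<lambda>b. mv C (\<lambda>c. X $ a $ b $ c) k) j) i"
  by (simp only: H_act_def mv_def sum_distrib_left mult.assoc split_conv vec_lambda_beta)

lemma H_act_one: "H_act (mat 1, mat 1, mat 1) X = X"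
  by (simp add: vec_eq_iff H_act_nth mv_id)

lemma H_act_mult:
  "H_act (A ** A', B ** B', C ** C') X = H_act (A, B, C) (H_act (A', B', C') X)"
proof -
  have "H_act (A, B, C) (H_act (A', B', C') X) $ i $ j $ k
      = H_act (A ** A', B ** B', C ** C') X $ i $ j $ k" for i j k
  proof -
    have "H_act (A, B, C) (H_act (A', B', C') X) $ i $ j $ k
      = mv A (\<lambda>a. mv B (\<lambda>b. mv C (\<lambda>c.
          mv A' (\<lambda>a'. mv B' (\<lambda>b'. mv C' (\<lambda>c'. X $ a' $ b' $ c') c) b) a) k) j) i"
      by (simp add: H_act_nth)
    also have "\<dots> = mv A (\<lambda>a. mv A' (\<lambda>a'. mv B (\<lambda>b. mv B' (\<lambda>b'.
          mv C (\<lambda>c. mv C' (\<lambda>c'. X $ a' $ b' $ c') c) k) b) j) a) i"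
      by (subst mv_commute[of C A'], subst mv_commute[of B A'], subst mv_commute[of C B']) (rule refl)
    also have "\<dots> = H_act (A ** A', B ** B', C ** C') X $ i $ j $ k"
      unfolding H_act_nth mv_mult ..
    finally show ?thesis .
  qed
  then show ?thesis by (simp add: vec_eq_iff)
qed

lemma triple_simps: "triple x y z 1 = x" "triple x y z 2 = y" "triple x y z 3 = z"
  by (simp_all add: triple_def)

lemma bij_triple: "bij (\<lambda>(a, b, c). triple a b c :: 3 \<Rightarrow> 3)"
proof (rule bij_betw_byWitness[where f' = "\<lambda>i. (i 1, i 2, i 3)"])
  show "\<forall>i\<in>UNIV. (\<lambda>(a, b, c). triple a b c) (i 1, i 2, i 3) = (i :: 3 \<Rightarrow> 3)"
    by (simp add: fun_eq_iff forall_3 triple_simps del: num1_eq1)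
qed (auto simp: triple_simps)

lemma prod_3: "prod f (UNIV :: 3 set) = f 1 * f 2 * f 3"
  unfolding UNIV_3 by (simp add: ac_simps)

lemma entry_H_act:
  "entry (H_act (A, B, C) X) i
     = (\<Sum>j\<in>UNIV. (\<Prod>t\<in>UNIV. triple A B C t $ i t $ j t) * entry X j)"
proof -
  have "(\<Sum>j\<in>UNIV. (\<Prod>t\<in>UNIV. triple A B C t $ i t $ j t) * entry X j)
      = (\<Sum>u\<in>UNIV. (\<lambda>j. (\<Prod>t\<in>UNIV. triple A B C t $ i t $ j t) * entry X j)
          ((\<lambda>(a, b, c). triple a b c) u))"
    by (rule sum.reindex_bij_betw[OF bij_triple, symmetric])
  also have "\<dots> = (\<Sum>(a, b, c)\<in>UNIV. A $ i 1 $ a * B $ i 2 $ b * C $ i 3 $ c * X $ a $ b $ c)"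
    by (rule sum.cong) (simp_all only: entry_def prod_3 triple_simps split_def)
  also have "\<dots> = (\<Sum>(a, b, c)\<in>UNIV \<times> UNIV \<times> UNIV.
      A $ i 1 $ a * B $ i 2 $ b * C $ i 3 $ c * X $ a $ b $ c)"
    by simp
  also have "\<dots> = entry (H_act (A, B, C) X) i"
    by (simp only: entry_def H_act_def split_conv vec_lambda_beta flip: sum.cartesian_product)
  finally show ?thesis by simp
qed

lemma triple_permute: "triple (x (\<delta> 1)) (x (\<delta> 2)) (x (\<delta> 3)) t = x (\<delta> t)"
  using exhaust_3[of t] by (auto simp: triple_simps)

lemma S3_act_H_act:
  assumes "bij \<delta>"
  shows "S3_act \<delta> (H_act h X) = H_act (permute_factors \<delta> h) (S3_act \<delta> X)"
proof (rule entry_eqI)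
  fix i
  obtain A B C where h: "h = (A, B, C)" by (cases h) auto
  define M where "M = triple A B C"
  let ?d = "inv_into UNIV \<delta>"
  have d: "\<delta> (?d t) = t" "?d (\<delta> t) = t" for t
    using assms by (simp_all add: bij_is_surj surj_f_inv_f bij_is_inj)
  have bij': "bij (\<lambda>j. j \<circ> ?d :: 3 \<Rightarrow> 3)"
    by (rule bij_betw_byWitness[where f' = "\<lambda>j. j \<circ> \<delta>"]) (auto simp: fun_eq_iff d)
  have "entry (H_act (permute_factors \<delta> h) (S3_act \<delta> X)) i
      = (\<Sum>j\<in>UNIV. (\<Prod>t\<in>UNIV. M (\<delta> t) $ i t $ j t) * entry X (j \<circ> ?d))"
    by (simp only: h permute_factors_def split_conv entry_H_act entry_S3_act'[OF assms]
        triple_permute flip: M_def)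
  also have "\<dots> = (\<Sum>j\<in>UNIV. (\<Prod>t\<in>UNIV. M t $ (i \<circ> ?d) t $ (j \<circ> ?d) t) * entry X (j \<circ> ?d))"
  proof (rule sum.cong)
    fix j
    have "(\<Prod>t\<in>UNIV. M (\<delta> t) $ i t $ j t)
        = (\<Prod>t\<in>UNIV. (\<lambda>t. M t $ (i \<circ> ?d) t $ (j \<circ> ?d) t) (\<delta> t))"
      by (simp only: comp_apply d)
    also have "\<dots> = (\<Prod>t\<in>UNIV. M t $ (i \<circ> ?d) t $ (j \<circ> ?d) t)"
      by (rule prod.reindex_bij_betw[OF assms])
    finally show "(\<Prod>t\<in>UNIV. M (\<delta> t) $ i t $ j t) * entry X (j \<circ> ?d)
        = (\<Prod>t\<in>UNIV. M t $ (i \<circ> ?d) t $ (j \<circ> ?d) t) * entry X (j \<circ> ?d)"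
      by (rule arg_cong)
  qed simp
  also have "\<dots> = (\<Sum>j\<in>UNIV. (\<Prod>t\<in>UNIV. M t $ (i \<circ> ?d) t $ j t) * entry X j)"
    by (rule sum.reindex_bij_betw[OF bij'])
  also have "\<dots> = entry (S3_act \<delta> (H_act h X)) i"
    by (simp only: h entry_H_act entry_S3_act'[OF assms] flip: M_def)
  finally show "entry (S3_act \<delta> (H_act h X)) i
      = entry (H_act (permute_factors \<delta> h) (S3_act \<delta> X)) i" ..
qed

lemma invertible_mat_1: "invertible (mat 1 :: matrix3)"
  by (auto simp: invertible_def)

lemma group_GL3: "group GL3"
proof (rule groupI)
  fix A assume "A \<in> carrier GL3"
  then show "\<exists>B\<in>carrier GL3. B \<otimes>\<^bsub>GL3\<^esub> A = \<one>\<^bsub>GL3\<^esub>"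
    unfolding GL3_def by (auto simp: invertible_def)
qed (auto simp: GL3_def invertible_mult matrix_mul_assoc invertible_mat_1)

lemma group_H_group: "group H_group"
  unfolding H_group_def by (intro DirProd_group group_GL3)

lemma group_S3_group: "group S3_group"
proof (rule groupI)
  fix \<delta> assume "\<delta> \<in> carrier S3_group"
  then have "bij \<delta>" by (simp add: S3_group_def)
  then show "\<exists>\<epsilon>\<in>carrier S3_group. \<epsilon> \<otimes>\<^bsub>S3_group\<^esub> \<delta> = \<one>\<^bsub>S3_group\<^esub>"
    by (intro bexI[of _ "inv_into UNIV \<delta>"])
       (auto simp: S3_group_def bij_imp_bij_inv fun_eq_iff bij_is_surj surj_f_inv_f)
qed (auto simp: S3_group_def bij_comp comp_assoc)

lemma group_semidirect_product:
  assumes "group N" "group K"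
    and hom: "\<And>k. k \<in> carrier K \<Longrightarrow> \<theta> k \<in> hom N N"
    and one: "\<And>n. n \<in> carrier N \<Longrightarrow> \<theta> \<one>\<^bsub>K\<^esub> n = n"
    and mult: "\<And>k l n. k \<in> carrier K \<Longrightarrow> l \<in> carrier K \<Longrightarrow> n \<in> carrier N \<Longrightarrow>
      \<theta> (k \<otimes>\<^bsub>K\<^esub> l) n = \<theta> k (\<theta> l n)"
  shows "group (semidirect_product N K \<theta>)"
proof -
  interpret N: group N by fact
  interpret K: group K by fact
  have closed: "\<theta> k n \<in> carrier N" if "k \<in> carrier K" "n \<in> carrier N" for k n
    using hom[OF that(1)] that(2) by (auto simp: hom_def)
  show ?thesis
  proof (rule groupI)
    fix x assume x: "x \<in> carrier (semidirect_product N K \<theta>)"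
    obtain n k where nk: "x = (n, k)" "n \<in> carrier N" "k \<in> carrier K"
      using x by (auto simp: semidirect_product_def)
    let ?k = "inv\<^bsub>K\<^esub> k"
    let ?y = "(inv\<^bsub>N\<^esub> (\<theta> ?k n), ?k)"
    have "?y \<in> carrier (semidirect_product N K \<theta>)"
      using nk closed by (simp add: semidirect_product_def)
    moreover have "?y \<otimes>\<^bsub>semidirect_product N K \<theta>\<^esub> x = \<one>\<^bsub>semidirect_product N K \<theta>\<^esub>"
      using nk closed by (simp add: semidirect_product_def)
    ultimately show "\<exists>y\<in>carrier (semidirect_product N K \<theta>).
        y \<otimes>\<^bsub>semidirect_product N K \<theta>\<^esub> x = \<one>\<^bsub>semidirect_product N K \<theta>\<^esub>" by blast
  qed (auto simp: semidirect_product_def closed one mult hom_mult[OF hom] N.m_assoc K.m_assoc)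
qed

lemma H_group_simps:
  "(A, B, C) \<in> carrier H_group \<longleftrightarrow> invertible A \<and> invertible B \<and> invertible C"
  "(A, B, C) \<otimes>\<^bsub>H_group\<^esub> (A', B', C') = (A ** A', B ** B', C ** C')"
  "\<one>\<^bsub>H_group\<^esub> = (mat 1, mat 1, mat 1)"
  by (auto simp: H_group_def GL3_def)

lemma S3_group_simps:
  "\<delta> \<in> carrier S3_group \<longleftrightarrow> bij \<delta>" "\<delta> \<otimes>\<^bsub>S3_group\<^esub> \<epsilon> = \<epsilon> \<circ> \<delta>" "\<one>\<^bsub>S3_group\<^esub> = id"
  by (auto simp: S3_group_def)

lemma group_G_group: "group G_group"
  unfolding G_group_def
proof (rule group_semidirect_product[OF group_H_group group_S3_group])
  fix \<delta>
  have inv: "invertible (triple A B C t)" if "invertible A" "invertible B" "invertible C"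
    for A B C :: matrix3 and t
    using that exhaust_3[of t] by (auto simp: triple_simps)
  have mul: "triple (A ** A') (B ** B') (C ** C') t = triple A B C t ** triple A' B' C' t"
    for A B C A' B' C' :: matrix3 and t
    using exhaust_3[of t] by (auto simp: triple_simps)
  show "permute_factors \<delta> \<in> hom H_group H_group"
    by (rule homI) (auto simp: H_group_simps permute_factors_def inv mul)
next
  fix h
  show "permute_factors \<one>\<^bsub>S3_group\<^esub> h = h"
    by (cases h) (auto simp: permute_factors_def S3_group_simps triple_simps)
next
  fix \<delta> \<epsilon> h
  show "permute_factors (\<delta> \<otimes>\<^bsub>S3_group\<^esub> \<epsilon>) h = permute_factors \<delta> (permute_factors \<epsilon> h)"
    by (cases h) (auto simp: permute_factors_def S3_group_simps triple_permute)
qed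

lemma group_action_UNIV_I:
  assumes "group K" and one: "\<And>x. \<phi> \<one>\<^bsub>K\<^esub> x = x"
    and mult: "\<And>g h x. g \<in> carrier K \<Longrightarrow> h \<in> carrier K \<Longrightarrow> \<phi> (g \<otimes>\<^bsub>K\<^esub> h) x = \<phi> g (\<phi> h x)"
  shows "group_action K UNIV \<phi>"
proof -
  interpret group K by fact
  have bij: "\<phi> g \<in> Bij UNIV" if g: "g \<in> carrier K" for g
  proof -
    have "bij (\<phi> g)"
      by (rule bij_betw_byWitness[where f' = "\<phi> (inv\<^bsub>K\<^esub> g)"])
         (auto simp: g one simp flip: mult)
    then show ?thesis by (simp add: Bij_def)
  qed
  have "\<phi> \<in> hom K (BijGroup UNIV)"
    by (rule homI) (auto simp: BijGroup_def bij mult compose_def fun_eq_iff)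
  then show ?thesis
    by (simp add: group_action_def group_hom_def group_hom_axioms_def group_BijGroup \<open>group K\<close>)
qed

lemma H_act_mult': "H_act (g \<otimes>\<^bsub>H_group\<^esub> h) X = H_act g (H_act h X)"
  by (cases g, cases h) (simp add: H_group_simps H_act_mult)

lemma group_action_H: "group_action H_group UNIV H_act"
  by (rule group_action_UNIV_I)
     (simp_all add: group_H_group H_group_simps(3) H_act_one H_act_mult')

lemma group_action_G: "group_action G_group UNIV G_act"
proof (rule group_action_UNIV_I[OF group_G_group])
  fix X
  show "G_act \<one>\<^bsub>G_group\<^esub> X = X"
    by (simp add: G_group_def semidirect_product_def G_act_def H_group_simps(3) S3_group_simps
        H_act_one S3_act_id)
next
  fix g g' X assume "g \<in> carrier G_group" "g' \<in> carrier G_group"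
  then show "G_act (g \<otimes>\<^bsub>G_group\<^esub> g') X = G_act g (G_act g' X)"
    by (auto simp: G_group_def semidirect_product_def G_act_def S3_group_simps
        H_act_mult' S3_act_comp S3_act_H_act)
qed

lemma exists_sum_of_simple: "\<exists>n. is_sum_of_simple n X"
proof -
  have add: "\<exists>n. is_sum_of_simple n (Y + Z)"
    if "\<exists>n. is_sum_of_simple n Y" "\<exists>n. is_sum_of_simple n Z" for Y Z
  proof -
    from that obtain Ts Us where
      "\<forall>T\<in>set Ts. simple_tensor T" "Y = sum_list Ts" "\<forall>T\<in>set Us. simple_tensor T" "Z = sum_list Us"
      by (auto simp: is_sum_of_simple_def)
    then have "is_sum_of_simple (length (Ts @ Us)) (Y + Z)"
      unfolding is_sum_of_simple_def by (intro exI[of _ "Ts @ Us"]) auto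
    then show ?thesis ..
  qed
  have zero: "\<exists>n. is_sum_of_simple n 0"
    by (rule exI[of _ 0]) (simp add: is_sum_of_simple_def)
  have sum: "\<exists>n. is_sum_of_simple n (sum f S)"
    if "finite S" "\<And>s. s \<in> S \<Longrightarrow> \<exists>n. is_sum_of_simple n (f s)" for f and S :: "(3 \<times> 3 \<times> 3) set"
    using that by (induction S rule: finite_induct) (auto intro: zero add)
  let ?E = "\<lambda>(a, b, c). if X $ a $ b $ c = 1
    then outer_product (axis a 1) (axis b 1) (axis c 1) else 0"
  have "\<exists>n. is_sum_of_simple n (?E s)" for s
  proof -
    obtain a b c where s: "s = (a, b, c)" by (cases s) auto
    have "is_sum_of_simple 1 (outer_product (axis a 1) (axis b 1) (axis c 1))"
      unfolding is_sum_of_simple_def simple_tensor_def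
      by (rule exI[of _ "[outer_product (axis a 1) (axis b 1) (axis c 1)]"])
         (simp, metis axis_eq_0_iff zero_neq_one)
    then show ?thesis using zero by (auto simp: s)
  qed
  then have "\<exists>n. is_sum_of_simple n (\<Sum>s\<in>UNIV. ?E s)"
    by (intro sum) auto
  also have "(\<Sum>s\<in>UNIV. ?E s) = X"
  proof -
    have "(\<Sum>s\<in>UNIV. ?E s) $ i $ j $ k = X $ i $ j $ k" for i j k
    proof -
      have "(\<Sum>s\<in>UNIV. ?E s) $ i $ j $ k = (\<Sum>s\<in>UNIV. ?E s $ i $ j $ k)"
        by simp
      also have "\<dots> = (\<Sum>s\<in>UNIV. if s = (i, j, k) then X $ i $ j $ k else 0)"
        by (rule sum.cong) (auto simp: outer_product_def axis_def split: if_splits)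
      also have "\<dots> = X $ i $ j $ k"
        by (simp only: sum.delta finite if_True UNIV_I)
      finally show ?thesis .
    qed
    then show ?thesis by (simp add: vec_eq_iff)
  qed
  finally show ?thesis .
qed

instance bit :: finite
proof
  have "(UNIV :: bit set) = {0, 1}"
    by auto
  then show "finite (UNIV :: bit set)" by (metis finite.emptyI finite_insert)
qed

lemma flattening_inject: "flattening X = flattening Y \<longleftrightarrow> X = Y"
  by (auto simp: flattening_def vec_eq_iff forall_3)

lemma tensor_less_linear: "tensor_less X Y \<or> X = Y \<or> tensor_less Y X"
proof -
  have "\<forall>a b :: bit. (a, b) \<in> {(0, 1)} \<or> a = b \<or> (b, a) \<in> {(0, 1)}"
    by (metis bit_not_one_iff singletonI)
  from lexord_linear[OF this] show ?thesis
    unfolding tensor_less_def flattening_inject[symmetric] by blast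
qed

lemma tensor_less_trans: "tensor_less X Y \<Longrightarrow> tensor_less Y Z \<Longrightarrow> tensor_less X Z"
  unfolding tensor_less_def by (rule lexord_trans) (auto intro: transI)

lemma tensor_less_asym: "tensor_less X Y \<Longrightarrow> \<not> tensor_less Y X"
  unfolding tensor_less_def by (rule lexord_asymmetric) (auto intro: asymI)

lemma canonical_form_minimal:
  assumes "U \<noteq> {}"
  shows "canonical_form U \<in> U" and "\<And>Y. Y \<in> U \<Longrightarrow> Y \<noteq> canonical_form U \<Longrightarrow> tensor_less (canonical_form U) Y"
proof -
  have "finite U" by simp
  from this assms have "\<exists>X. X \<in> U \<and> (\<forall>Y\<in>U. Y \<noteq> X \<longrightarrow> tensor_less X Y)"
  proof (induction U rule: finite_ne_induct)
    case (insert x F)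
    then obtain X where X: "X \<in> F" "\<forall>Y\<in>F. Y \<noteq> X \<longrightarrow> tensor_less X Y" by blast
    show ?case
    proof (cases "tensor_less x X")
      case True
      with X show ?thesis by (intro exI[of _ x]) (auto intro: tensor_less_trans)
    next
      case False
      with X tensor_less_linear[of x X] show ?thesis by (intro exI[of _ X]) auto
    qed
  qed auto
  then have "\<exists>!X. X \<in> U \<and> (\<forall>Y\<in>U. Y \<noteq> X \<longrightarrow> tensor_less X Y)"
    by (metis tensor_less_asym)
  from theI'[OF this]
  show "canonical_form U \<in> U"
    and "\<And>Y. Y \<in> U \<Longrightarrow> Y \<noteq> canonical_form U \<Longrightarrow> tensor_less (canonical_form U) Y"
    by (auto simp: canonical_form_def)
qed

end

theory Submission
  imports Defs
begin

text \<open>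
  Extend initial segments of flattenings row by row, and drop a segment as soon as one of 58
  fixed elements of \<open>G\<close> makes every tensor with this segment smaller. Only 56 tensors survive, hence
  every tensor \<open>X\<close> can be moved to one of these forms that is at most \<open>X\<close>. For each form \<open>F\<close>,
  elements of its stabiliser bound the size of \<open>H F\<close> and the number of \<open>H\<close>-orbits in \<open>G F\<close> from
  above. The resulting bounds on the sizes of the \<open>G F\<close> add up to \<open>2\<^sup>2\<^sup>7\<close>, so they are attained and
  the forms lie in different orbits, which makes each of them the minimum of its orbit.

  Ranks are bounded from above by explicit decompositions. For the lower bounds it is enough to add
  the simple tensors to the forms of rank \<open>r \<le> 3\<close>, which leads to rank at most \<open>r + 1\<close>, and to the three
  forms of rank 6, which does not lead below rank 5. Modulo the stabiliser of the form, few simple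
  tensors have to be considered.
\<close>

section \<open>Executable tensors\<close>

text \<open>Neither the 2^27 tensors nor the 6 * 168^3 elements of G can be listed by evaluation
  inside the logic. So every certificate is one-sided: a move settles all tensors with a given
  initial segment, a list of stabiliser elements may be incomplete, and no invariant tells two forms
  apart. Sharpness is recovered for all of them at once, because the upper bounds for the orbit
  sizes leave no room within 2^27. Orbits of stabilisers on simple tensors are not listed either:
  there, as in the passage to the forms, a strict decrease in the order of tensors gives a
  well-founded induction. For ranks, let r(F) be the number of terms in the decomposition recorded
  for F. Adding a simple tensor T must raise r by at most 1. No r exceeds 6, so nothing can go wrong
  at r = 5 or 6, and at r = 4 only a jump to 6 could. As X + T = Z is equivalent to Z + T = X in
  characteristic 2, this jump is excluded from the side of the three forms with r = 6 instead of the
  18 forms with r = 4.\<close>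

text \<open>
  A tensor is represented by its nine rows \<open>(x\<^sub>i\<^sub>j\<^sub>1, x\<^sub>i\<^sub>j\<^sub>2, x\<^sub>i\<^sub>j\<^sub>3)\<close>, and \<open>Rn\<close> is the row that spells \<open>n\<close> in
  binary. \<open>Unknown\<close> stands for an arbitrary row, which allows computations with initial segments.
\<close>

datatype row = R0 | R1 | R2 | R3 | R4 | R5 | R6 | R7 | Unknown

primrec row_vec :: "row \<Rightarrow> bit ^ 3" where
  "row_vec R0 = vector [0, 0, 0]"
| "row_vec R1 = vector [0, 0, 1]"
| "row_vec R2 = vector [0, 1, 0]"
| "row_vec R3 = vector [0, 1, 1]"
| "row_vec R4 = vector [1, 0, 0]"
| "row_vec R5 = vector [1, 0, 1]"
| "row_vec R6 = vector [1, 1, 0]"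
| "row_vec R7 = vector [1, 1, 1]"
| "row_vec Unknown = 0"

text \<open>A row describes a set of vectors, as in abstract interpretation. \<open>Unknown\<close>
  describes all of them, so its value 0 under \<open>row_vec\<close> is a dummy that has no
  influence here.\<close>

definition matches :: "row \<Rightarrow> bit ^ 3 \<Rightarrow> bool" where
  "matches u x \<longleftrightarrow> u = Unknown \<or> row_vec u = x"

lemma vec3_eq_iff: "(x :: 'a ^ 3) = y \<longleftrightarrow> x $ 1 = y $ 1 \<and> x $ 2 = y $ 2 \<and> x $ 3 = y $ 3"
  by (simp add: vec_eq_iff forall_3)

lemma row_vec_surj: "\<exists>u. u \<noteq> Unknown \<and> row_vec u = x"
proof -
  have "row_vec R0 = x \<or> row_vec R1 = x \<or> row_vec R2 = x \<or> row_vec R3 = x \<or>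
      row_vec R4 = x \<or> row_vec R5 = x \<or> row_vec R6 = x \<or> row_vec R7 = x"
    by (cases "x $ 1"; cases "x $ 2"; cases "x $ 3") (simp_all add: vec3_eq_iff)
  then show ?thesis
    by (metis row.distinct)
qed

text \<open>\<open>flip1\<close>, \<open>flip2\<close> and \<open>flip4\<close> add the vectors
  spelled 1, 2 and 4; composed, they give addition in F_2^3 without a table of all pairs.\<close>

primrec flip1 :: "row \<Rightarrow> row" where
  "flip1 R0 = R1" | "flip1 R1 = R0" | "flip1 R2 = R3" | "flip1 R3 = R2"
| "flip1 R4 = R5" | "flip1 R5 = R4" | "flip1 R6 = R7" | "flip1 R7 = R6"
| "flip1 Unknown = Unknown"

primrec flip2 :: "row \<Rightarrow> row" where
  "flip2 R0 = R2" | "flip2 R1 = R3" | "flip2 R2 = R0" | "flip2 R3 = R1"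
| "flip2 R4 = R6" | "flip2 R5 = R7" | "flip2 R6 = R4" | "flip2 R7 = R5"
| "flip2 Unknown = Unknown"

primrec flip4 :: "row \<Rightarrow> row" where
  "flip4 R0 = R4" | "flip4 R1 = R5" | "flip4 R2 = R6" | "flip4 R3 = R7"
| "flip4 R4 = R0" | "flip4 R5 = R1" | "flip4 R6 = R2" | "flip4 R7 = R3"
| "flip4 Unknown = Unknown"

primrec row_add :: "row \<Rightarrow> row \<Rightarrow> row" where
  "row_add R0 y = y"
| "row_add R1 y = flip1 y"
| "row_add R2 y = flip2 y"
| "row_add R3 y = flip1 (flip2 y)"
| "row_add R4 y = flip4 y"
| "row_add R5 y = flip1 (flip4 y)"
| "row_add R6 y = flip2 (flip4 y)"
| "row_add R7 y = flip1 (flip2 (flip4 y))"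
| "row_add Unknown y = Unknown"

text \<open>The product of the row vector in the first argument with the matrix whose rows are the
  other three. A zero coefficient discards its row even if that row is \<open>Unknown\<close>; this
  is how a move can yield known rows from an initial segment.\<close>

primrec comb :: "row \<Rightarrow> row \<Rightarrow> row \<Rightarrow> row \<Rightarrow> row" where
  "comb R0 x y z = R0"
| "comb R1 x y z = z"
| "comb R2 x y z = y"
| "comb R3 x y z = row_add y z"
| "comb R4 x y z = x"
| "comb R5 x y z = row_add x z"
| "comb R6 x y z = row_add x y"
| "comb R7 x y z = row_add x (row_add y z)"
| "comb Unknown x y z = Unknown"

text \<open>\<open>Unknown\<close> is comparable with nothing, so a positive answer is valid for all
  vectors that the two rows stand for.\<close>

primrec row_less :: "row \<Rightarrow> row \<Rightarrow> bool" where
  "row_less x R0 \<longleftrightarrow> False"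
| "row_less x R1 \<longleftrightarrow> x = R0"
| "row_less x R2 \<longleftrightarrow> x = R0 \<or> x = R1"
| "row_less x R3 \<longleftrightarrow> x = R0 \<or> x = R1 \<or> x = R2"
| "row_less x R4 \<longleftrightarrow> x = R0 \<or> x = R1 \<or> x = R2 \<or> x = R3"
| "row_less x R5 \<longleftrightarrow> x = R0 \<or> x = R1 \<or> x = R2 \<or> x = R3 \<or> x = R4"
| "row_less x R6 \<longleftrightarrow> x = R0 \<or> x = R1 \<or> x = R2 \<or> x = R3 \<or> x = R4 \<or> x = R5"
| "row_less x R7 \<longleftrightarrow> x = R0 \<or> x = R1 \<or> x = R2 \<or> x = R3 \<or> x = R4 \<or> x = R5 \<or> x = R6"
| "row_less x Unknown \<longleftrightarrow> False"

lemma matches_R0 [simp]: "matches R0 x \<longleftrightarrow> x = 0"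
  by (auto simp: matches_def vec3_eq_iff)

lemma matches_row_add:
  assumes "matches u x" "matches v y"
  shows "matches (row_add u v) (x + y)"
proof (cases "u = Unknown \<or> v = Unknown")
  case True
  then show ?thesis by (cases u) (auto simp: matches_def)
next
  case False
  with assms have "x = row_vec u" "y = row_vec v" by (auto simp: matches_def)
  with False show ?thesis
    by (cases u; cases v) (simp_all add: matches_def vec3_eq_iff)
qed

lemma matches_comb:
  assumes "matches u w" "matches a x" "matches b y" "matches c z"
  shows "matches (comb u a b c) (w $ 1 *s x + w $ 2 *s y + w $ 3 *s z)"
proof (cases "u = Unknown")
  case True
  then show ?thesis by (simp add: matches_def)
next
  case False
  with assms(1) have "w = row_vec u" by (simp add: matches_def)
  moreover note matches_row_add[OF assms(2) matches_row_add[OF assms(3,4)]]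
    matches_row_add[OF assms(2,3)] matches_row_add[OF assms(2,4)] matches_row_add[OF assms(3,4)]
  ultimately show ?thesis
    using assms by (cases u) (simp_all add: add.assoc)
qed

section \<open>Matrices over F_2 given by their rows\<close>

datatype mat = Mat row row row

primrec mat_matrix :: "mat \<Rightarrow> matrix3" where
  "mat_matrix (Mat a b c) = vector [row_vec a, row_vec b, row_vec c]"

primrec mat_known :: "mat \<Rightarrow> bool" where
  "mat_known (Mat a b c) \<longleftrightarrow> a \<noteq> Unknown \<and> b \<noteq> Unknown \<and> c \<noteq> Unknown"

text \<open>Linear independence of the rows, tested on all seven nonzero coefficient vectors. The
  coefficients \<open>R4\<close>, \<open>R2\<close>, \<open>R1\<close> return the rows themselves,
  so unknown rows are excluded as well.\<close>

primrec mat_regular :: "mat \<Rightarrow> bool" where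
  "mat_regular (Mat a b c) \<longleftrightarrow>
     list_all (\<lambda>u. comb u a b c \<noteq> R0 \<and> comb u a b c \<noteq> Unknown) [R1, R2, R3, R4, R5, R6, R7]"

lemma mat_regular_known: "mat_regular m \<Longrightarrow> mat_known m"
  by (cases m) auto

lemma matches_row_vec: "matches u (row_vec u)"
  by (simp add: matches_def)

lemma transpose_vector3:
  fixes a b c x :: "'a :: comm_semiring_1 ^ 3"
  shows "transpose (vector [a, b, c]) *v x = x $ 1 *s a + x $ 2 *s b + x $ 3 *s c"
  by (simp add: vec3_eq_iff matrix_vector_mult_def transpose_def sum_3 mult.commute)

text \<open>Independent rows mean that the transpose has trivial kernel, hence a left inverse;
  transposing gives a right inverse of the matrix, which for square matrices is two-sided.\<close>

lemma mat_regular_invertible: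
  assumes "mat_regular m"
  shows "invertible (mat_matrix m)"
proof -
  obtain a b c where m: "m = Mat a b c" by (cases m)
  let ?A = "mat_matrix m"
  have "x = 0" if "transpose ?A *v x = 0" for x
  proof -
    obtain u where u: "u \<noteq> Unknown" "row_vec u = x" using row_vec_surj by blast
    have "matches (comb u a b c) (x $ 1 *s row_vec a + x $ 2 *s row_vec b + x $ 3 *s row_vec c)"
      by (rule matches_comb) (auto simp: matches_def u)
    also have "x $ 1 *s row_vec a + x $ 2 *s row_vec b + x $ 3 *s row_vec c = transpose ?A *v x"
      by (simp only: m mat_matrix.simps transpose_vector3)
    finally have *: "matches (comb u a b c) 0" by (simp only: that)
    have z: "\<not> matches v 0" if "v \<noteq> R0" "v \<noteq> Unknown" for v
      using that by (cases v) (simp_all add: matches_def vec3_eq_iff)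
    have "u = R0"
      using assms z * u(1) unfolding m by (cases u) auto
    with u(2) show ?thesis by (simp add: vec3_eq_iff)
  qed
  then obtain B where "B ** transpose ?A = mat 1"
    using matrix_left_invertible_ker[of "transpose ?A"] by auto
  then have "transpose (B ** transpose ?A) = mat 1"
    by (simp add: transpose_mat)
  then have "?A ** transpose B = mat 1"
    by (simp add: matrix_transpose_mul)
  then show ?thesis
    using matrix_left_right_inverse unfolding invertible_def by blast
qed

text \<open>\<open>comb a R4 R0 R0\<close> is a_1 times the first unit vector, and likewise for the
  other summands. Using only \<open>comb\<close> and \<open>row_add\<close> lets correctness follow
  from their lemmas. A single \<open>Unknown\<close> row makes the whole result
  \<open>Unknown\<close>.\<close>

primrec mat_transpose :: "mat \<Rightarrow> mat" where
  "mat_transpose (Mat a b c) = Mat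
     (row_add (comb a R4 R0 R0) (row_add (comb b R2 R0 R0) (comb c R1 R0 R0)))
     (row_add (comb a R0 R4 R0) (row_add (comb b R0 R2 R0) (comb c R0 R1 R0)))
     (row_add (comb a R0 R0 R4) (row_add (comb b R0 R0 R2) (comb c R0 R0 R1)))"

text \<open>The left-hand sides have exactly the shape that \<open>matches_row_add\<close> and
  \<open>matches_comb\<close> produce for \<open>mat_transpose\<close>. The variables in front of 0
  are the coordinates that do not enter the column; they are instantiated where the lemma is
  applied.\<close>

lemma vector3_columns:
  fixes p q r :: "'a :: semiring_1"
  shows
    "p *s vector [1, 0, 0] + s *s 0 + t *s 0 + ((q *s vector [0, 1, 0] + u *s 0 + v *s 0) +
       (r *s vector [0, 0, 1] + w *s 0 + x *s 0)) = (vector [p, q, r] :: 'a ^ 3)"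
    "s *s 0 + p *s vector [1, 0, 0] + t *s 0 + ((u *s 0 + q *s vector [0, 1, 0] + v *s 0) +
       (w *s 0 + r *s vector [0, 0, 1] + x *s 0)) = (vector [p, q, r] :: 'a ^ 3)"
    "s *s 0 + t *s 0 + p *s vector [1, 0, 0] + ((u *s 0 + v *s 0 + q *s vector [0, 1, 0]) +
       (w *s 0 + x *s 0 + r *s vector [0, 0, 1])) = (vector [p, q, r] :: 'a ^ 3)"
  by (simp_all add: vec3_eq_iff)

lemma matches_mat_transpose:
  assumes "mat_transpose (Mat a b c) = Mat d e f" "matches a x" "matches b y" "matches c z"
  shows "matches d (vector [x $ 1, y $ 1, z $ 1])" "matches e (vector [x $ 2, y $ 2, z $ 2])"
    "matches f (vector [x $ 3, y $ 3, z $ 3])"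
proof -
  have R: "matches R4 (vector [1, 0, 0])" "matches R2 (vector [0, 1, 0])" "matches R1 (vector [0, 0, 1])"
    "matches R0 0"
    by (simp_all add: matches_def vec3_eq_iff)
  have *:
    "d = row_add (comb a R4 R0 R0) (row_add (comb b R2 R0 R0) (comb c R1 R0 R0))"
    "e = row_add (comb a R0 R4 R0) (row_add (comb b R0 R2 R0) (comb c R0 R1 R0))"
    "f = row_add (comb a R0 R0 R4) (row_add (comb b R0 R0 R2) (comb c R0 R0 R1))"
    using assms(1) by auto
  show "matches d (vector [x $ 1, y $ 1, z $ 1])"
    unfolding *
    by (subst vector3_columns(1)[of _ "x $ 2" "x $ 3" _ "y $ 2" "y $ 3" _ "z $ 2" "z $ 3", symmetric])
       (intro matches_row_add matches_comb R assms(2-4))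
  show "matches e (vector [x $ 2, y $ 2, z $ 2])"
    unfolding *
    by (subst vector3_columns(2)[of "x $ 1" _ "x $ 3" "y $ 1" _ "y $ 3" "z $ 1" _ "z $ 3", symmetric])
       (intro matches_row_add matches_comb R assms(2-4))
  show "matches f (vector [x $ 3, y $ 3, z $ 3])"
    unfolding *
    by (subst vector3_columns(3)[of "x $ 1" "x $ 2" _ "y $ 1" "y $ 2" _ "z $ 1" "z $ 2", symmetric])
       (intro matches_row_add matches_comb R assms(2-4))
qed

section \<open>The action of G on lists of rows\<close>

primrec act_C :: "mat \<Rightarrow> row list \<Rightarrow> row list" where
  "act_C (Mat x y z) p = map (\<lambda>r. comb r x y z) p"

fun act_B :: "mat \<Rightarrow> row list \<Rightarrow> row list" where
  "act_B (Mat x y z) (a # b # c # p) =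
     comb x a b c # comb y a b c # comb z a b c # act_B (Mat x y z) p"
| "act_B m p = []"

fun act_A :: "mat \<Rightarrow> row list \<Rightarrow> row list" where
  "act_A (Mat x y z) [a, b, c, d, e, f, g, h, i] =
     [comb x a d g, comb x b e h, comb x c f i,
      comb y a d g, comb y b e h, comb y c f i,
      comb z a d g, comb z b e h, comb z c f i]"

fun swap12_rows :: "row list \<Rightarrow> row list" where
  "swap12_rows [a, b, c, d, e, f, g, h, i] = [a, d, g, b, e, h, c, f, i]"

primrec mat_rows :: "mat \<Rightarrow> row list" where
  "mat_rows (Mat a b c) = [a, b, c]"

text \<open>Exchanging the last two directions transposes each of the three slices with fixed first
  index.\<close>

fun swap23_rows :: "row list \<Rightarrow> row list" where
  "swap23_rows (a # b # c # p) = mat_rows (mat_transpose (Mat a b c)) @ swap23_rows p"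
| "swap23_rows p = []"

datatype swap = Swap12 | Swap23

primrec swap_rows :: "swap \<Rightarrow> row list \<Rightarrow> row list" where
  "swap_rows Swap12 p = swap12_rows p"
| "swap_rows Swap23 p = swap23_rows p"

type_synonym move = "swap list \<times> mat \<times> mat \<times> mat"

text \<open>In the third direction a row r becomes r times the transpose of C, whence
  \<open>mat_transpose C\<close>. The last swap of the word acts first, and the matrices act after
  all swaps, as in \<open>G_act\<close>.\<close>

fun move_rows :: "move \<Rightarrow> row list \<Rightarrow> row list" where
  "move_rows (ss, A, B, C) p =
     act_A A (act_B B (act_C (mat_transpose C) (foldr swap_rows ss p)))"

fun move_valid :: "move \<Rightarrow> bool" where
  "move_valid (ss, A, B, C) \<longleftrightarrow> mat_regular A \<and> mat_regular B \<and> mat_regular C"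

primrec swap_tensor :: "swap \<Rightarrow> tensor \<Rightarrow> tensor" where
  "swap_tensor Swap12 X = (\<chi> i j k. X $ j $ i $ k)"
| "swap_tensor Swap23 X = (\<chi> i j k. X $ i $ k $ j)"

fun move_tensor :: "move \<Rightarrow> tensor \<Rightarrow> tensor" where
  "move_tensor (ss, A, B, C) X =
     H_act (mat_matrix A, mat_matrix B, mat_matrix C) (foldr swap_tensor ss X)"

definition tensor_rows :: "tensor \<Rightarrow> (bit ^ 3) list" where
  "tensor_rows X = [X $ 1 $ 1, X $ 1 $ 2, X $ 1 $ 3, X $ 2 $ 1, X $ 2 $ 2, X $ 2 $ 3,
     X $ 3 $ 1, X $ 3 $ 2, X $ 3 $ 3]"

definition fits :: "row list \<Rightarrow> tensor \<Rightarrow> bool" where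
  "fits p X \<longleftrightarrow> list_all2 matches p (tensor_rows X)"

lemma fits_conv:
  "fits p X \<longleftrightarrow> (\<exists>a b c d e f g h i. p = [a, b, c, d, e, f, g, h, i] \<and>
     matches a (X $ 1 $ 1) \<and> matches b (X $ 1 $ 2) \<and> matches c (X $ 1 $ 3) \<and>
     matches d (X $ 2 $ 1) \<and> matches e (X $ 2 $ 2) \<and> matches f (X $ 2 $ 3) \<and>
     matches g (X $ 3 $ 1) \<and> matches h (X $ 3 $ 2) \<and> matches i (X $ 3 $ 3))"
  unfolding fits_def tensor_rows_def list_all2_Cons2 by auto

lemma fits_act_A:
  assumes "fits p X" "mat_known m"
  shows "fits (act_A m p) (H_act (mat_matrix m, mat 1, mat 1) X)"
proof -
  obtain x y z where m: "m = Mat x y z" by (cases m)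
  have row: "H_act (mat_matrix m, mat 1, mat 1) X $ i $ j =
      mat_matrix m $ i $ 1 *s X $ 1 $ j + mat_matrix m $ i $ 2 *s X $ 2 $ j + mat_matrix m $ i $ 3 *s X $ 3 $ j"
    for i j
    by (simp only: vec_eq_iff H_act_nth mv_id)
       (simp only: mv_def sum_3 vector_add_component vector_smult_component simp_thms)
  from assms(1) show ?thesis
    unfolding fits_conv m
    by (elim exE conjE) (simp add: row[unfolded m mat_matrix.simps] matches_comb matches_row_vec)
qed

lemma fits_act_B:
  assumes "fits p X" "mat_known m"
  shows "fits (act_B m p) (H_act (mat 1, mat_matrix m, mat 1) X)"
proof -
  obtain x y z where m: "m = Mat x y z" by (cases m)
  have row: "H_act (mat 1, mat_matrix m, mat 1) X $ i $ j =
      mat_matrix m $ j $ 1 *s X $ i $ 1 + mat_matrix m $ j $ 2 *s X $ i $ 2 + mat_matrix m $ j $ 3 *s X $ i $ 3"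
    for i j
    by (simp only: vec_eq_iff H_act_nth mv_id)
       (simp only: mv_def sum_3 vector_add_component vector_smult_component simp_thms)
  from assms(1) show ?thesis
    unfolding fits_conv m
    by (elim exE conjE) (simp add: row[unfolded m mat_matrix.simps] matches_comb matches_row_vec)
qed

lemma fits_act_C:
  assumes "fits p X" "mat_known m"
  shows "fits (act_C (mat_transpose m) p) (H_act (mat 1, mat 1, mat_matrix m) X)"
proof -
  obtain a b c where m: "m = Mat a b c" by (cases m)
  obtain x y z where t: "mat_transpose m = Mat x y z" by (cases "mat_transpose m")
  note mt = matches_mat_transpose[OF t[unfolded m] matches_row_vec matches_row_vec matches_row_vec]
  have row: "H_act (mat 1, mat 1, mat_matrix m) X $ i $ j =
      X $ i $ j $ 1 *s vector [row_vec a $ 1, row_vec b $ 1, row_vec c $ 1] +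
      X $ i $ j $ 2 *s vector [row_vec a $ 2, row_vec b $ 2, row_vec c $ 2] +
      X $ i $ j $ 3 *s vector [row_vec a $ 3, row_vec b $ 3, row_vec c $ 3]"
    for i j
    by (simp only: vec3_eq_iff H_act_nth mv_id)
       (simp only: mv_def sum_3 vector_add_component vector_smult_component m mat_matrix.simps
         vector_3 mult.commute simp_thms)
  from assms(1) show ?thesis
    unfolding fits_conv t
    by (elim exE conjE) (simp add: row matches_comb mt)
qed

lemma fits_H_act:
  assumes "fits p X" "mat_known A" "mat_known B" "mat_known C"
  shows "fits (act_A A (act_B B (act_C (mat_transpose C) p)))
    (H_act (mat_matrix A, mat_matrix B, mat_matrix C) X)"
proof -
  \<comment> \<open>(A, B, C) = (A, 1, 1)(1, B, 1)(1, 1, C), so one direction is treated at a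
    time.\<close>
  have "H_act (mat_matrix A, mat_matrix B, mat_matrix C) X =
      H_act (mat_matrix A, mat 1, mat 1) (H_act (mat 1, mat_matrix B, mat 1)
        (H_act (mat 1, mat 1, mat_matrix C) X))"
    by (simp flip: H_act_mult)
  with assms show ?thesis
    by (simp add: fits_act_A fits_act_B fits_act_C)
qed

lemma fits_swap:
  assumes "fits p X"
  shows "fits (swap_rows s p) (swap_tensor s X)"
proof (cases s)
  case Swap12
  from assms show ?thesis
    unfolding fits_conv Swap12 by (elim exE conjE) simp
next
  case Swap23
  have row: "swap_tensor Swap23 X $ i $ j = vector [X $ i $ 1 $ j, X $ i $ 2 $ j, X $ i $ 3 $ j]" for i j
    by (simp add: vec3_eq_iff)
  from assms obtain a b c d e f g h i where p: "p = [a, b, c, d, e, f, g, h, i]" 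
     "matches a (X $ 1 $ 1)" "matches b (X $ 1 $ 2)" "matches c (X $ 1 $ 3)" 
     "matches d (X $ 2 $ 1)" "matches e (X $ 2 $ 2)" "matches f (X $ 2 $ 3)" 
     "matches g (X $ 3 $ 1)" "matches h (X $ 3 $ 2)" "matches i (X $ 3 $ 3)"
    unfolding fits_conv by blast
  obtain x y z where 1: "mat_transpose (Mat a b c) = Mat x y z" by (cases "mat_transpose (Mat a b c)")
  obtain x' y' z' where 2: "mat_transpose (Mat d e f) = Mat x' y' z'" by (cases "mat_transpose (Mat d e f)")
  obtain x'' y'' z'' where 3: "mat_transpose (Mat g h i) = Mat x'' y'' z''" by (cases "mat_transpose (Mat g h i)")
  have "swap_rows s p = [x, y, z, x', y', z', x'', y'', z'']"
    by (simp only: Swap23 p(1) swap_rows.simps swap23_rows.simps 1 2 3 mat_rows.simps append.simps)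
  then show ?thesis
    unfolding fits_conv Swap23 row
    using matches_mat_transpose[OF 1 p(2-4)] matches_mat_transpose[OF 2 p(5-7)]
      matches_mat_transpose[OF 3 p(8-10)] by simp
qed

text \<open>Soundness of the symbolic computation: each known row of the result is correct for every
  tensor that the input list describes.\<close>

lemma fits_move:
  assumes "fits p X" "move_valid m"
  shows "fits (move_rows m p) (move_tensor m X)"
proof -
  obtain ss A B C where m: "m = (ss, A, B, C)" by (cases m)
  have "fits (foldr swap_rows ss p) (foldr swap_tensor ss X)"
    by (induction ss) (auto simp: assms(1) fits_swap)
  then show ?thesis
    using assms(2) by (auto simp: m intro!: fits_H_act mat_regular_known)
qed

text \<open>The comparison succeeds only if it is decided before an \<open>Unknown\<close> row
  matters: going on past equal rows requires them to be known. Comparing blocks of three bits as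
  numbers agrees with comparing bit by bit.\<close>

fun rows_less :: "row list \<Rightarrow> row list \<Rightarrow> bool" where
  "rows_less (x # xs) (y # ys) \<longleftrightarrow> row_less x y \<or> x = y \<and> x \<noteq> Unknown \<and> rows_less xs ys"
| "rows_less xs ys \<longleftrightarrow> False"

definition vec_bits :: "bit ^ 3 \<Rightarrow> bit list" where
  "vec_bits x = [x $ 1, x $ 2, x $ 3]"

lemma flattening_tensor_rows: "flattening X = concat (map vec_bits (tensor_rows X))"
  by (simp add: flattening_def tensor_rows_def vec_bits_def)

lemma row_less_lexord:
  assumes "row_less u v" "matches u x" "matches v y"
  shows "(vec_bits x @ xs, vec_bits y @ ys) \<in> lexord {(0, 1)}"
proof -
  have known: "u \<noteq> Unknown" "v \<noteq> Unknown"
    using assms(1) by (cases v; auto)+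
  then have "x = row_vec u" "y = row_vec v"
    using assms(2,3) by (simp_all add: matches_def)
  then show ?thesis
    using assms(1) known by (cases v; cases u) (simp_all add: vec_bits_def)
qed

lemma rows_less_lexord:
  assumes "rows_less p q" "list_all2 matches p xs" "list_all2 matches q ys"
  shows "(concat (map vec_bits xs), concat (map vec_bits ys)) \<in> lexord {(0, 1)}"
  using assms
proof (induction p q arbitrary: xs ys rule: rows_less.induct)
  case (1 u us v vs)
  from "1.prems"(2,3) obtain x xs' y ys' where xy: "xs = x # xs'" "ys = y # ys'"
    "matches u x" "matches v y" "list_all2 matches us xs'" "list_all2 matches vs ys'"
    by (auto simp: list_all2_Cons1)
  consider "row_less u v" | "u = v" "u \<noteq> Unknown" "rows_less us vs"
    using "1.prems"(1) by auto
  then show ?case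
  proof cases
    case 1
    then show ?thesis using row_less_lexord[OF 1 xy(3,4)] xy(1,2) by simp
  next
    case 2
    then have "x = y" using xy(3,4) by (simp add: matches_def)
    then show ?thesis
      using "1.IH"[OF 2(3) xy(5,6)] xy(1,2) by (simp add: lexord_append_leftI)
  qed
qed auto

definition improves :: "move \<Rightarrow> row list \<Rightarrow> bool" where
  "improves m p \<longleftrightarrow> rows_less (move_rows m p) p"

text \<open>One evaluation on an initial segment padded with \<open>Unknown\<close> covers all
  tensors with this segment, which is what makes dropping the segment legitimate.\<close>

lemma improves_tensor_less:
  assumes "improves m p" "fits p X" "move_valid m"
  shows "tensor_less (move_tensor m X) X"
  using rows_less_lexord[of "move_rows m p" p] assms fits_move[of p X m]
  by (simp add: improves_def fits_def tensor_less_def flattening_tensor_rows)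

fun tensor_of :: "row list \<Rightarrow> tensor" where
  "tensor_of [a, b, c, d, e, f, g, h, i] = vector
     [vector [row_vec a, row_vec b, row_vec c],
      vector [row_vec d, row_vec e, row_vec f],
      vector [row_vec g, row_vec h, row_vec i]]"

lemma fits_tensor_of:
  assumes "length p = 9"
  shows "fits p (tensor_of p)"
proof -
  from assms obtain a b c d e f g h i where "p = [a, b, c, d, e, f, g, h, i]"
    by (cases p rule: tensor_of.cases) auto
  then show ?thesis by (simp add: fits_conv matches_row_vec)
qed

lemma fits_length: "fits p X \<Longrightarrow> length p = 9"
  by (auto simp: fits_conv)

lemma fits_known:
  assumes "fits p X" "Unknown \<notin> set p"
  shows "X = tensor_of p"
proof -
  have X: "X = vector [vector [X $ 1 $ 1, X $ 1 $ 2, X $ 1 $ 3],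
    vector [X $ 2 $ 1, X $ 2 $ 2, X $ 2 $ 3], vector [X $ 3 $ 1, X $ 3 $ 2, X $ 3 $ 3]]"
    by (simp add: vec_eq_iff forall_3)
  have known: "x = row_vec u" if "u \<noteq> Unknown" "matches u x" for u x
    using that by (simp add: matches_def)
  obtain a b c d e f g h i where p: "p = [a, b, c, d, e, f, g, h, i]"
    "matches a (X $ 1 $ 1)" "matches b (X $ 1 $ 2)" "matches c (X $ 1 $ 3)"
    "matches d (X $ 2 $ 1)" "matches e (X $ 2 $ 2)" "matches f (X $ 2 $ 3)"
    "matches g (X $ 3 $ 1)" "matches h (X $ 3 $ 2)" "matches i (X $ 3 $ 3)"
    using assms(1) unfolding fits_conv by blast
  have "a \<noteq> Unknown" "b \<noteq> Unknown" "c \<noteq> Unknown" "d \<noteq> Unknown" "e \<noteq> Unknown"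
    "f \<noteq> Unknown" "g \<noteq> Unknown" "h \<noteq> Unknown" "i \<noteq> Unknown"
    using assms(2) by (auto simp: p(1))
  note eqs = this[THEN known]
  show ?thesis
    unfolding p(1) tensor_of.simps
    by (subst X) (simp only: eqs(1)[OF p(2)] eqs(2)[OF p(3)] eqs(3)[OF p(4)] eqs(4)[OF p(5)]
      eqs(5)[OF p(6)] eqs(6)[OF p(7)] eqs(7)[OF p(8)] eqs(8)[OF p(9)] eqs(9)[OF p(10)])
qed


section \<open>Orbits and stabilisers\<close>

abbreviation H_orbit :: "tensor \<Rightarrow> tensor set" where
  "H_orbit X \<equiv> orbit H_group H_act X"

abbreviation G_orbit :: "tensor \<Rightarrow> tensor set" where
  "G_orbit X \<equiv> orbit G_group G_act X"

interpretation H: group_action H_group UNIV H_act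
  by (rule group_action_H)

interpretation G: group_action G_group UNIV G_act
  by (rule group_action_G)

lemma H_orbit_eqI: "Y \<in> H_orbit X \<Longrightarrow> H_orbit Y = H_orbit X"
  by (meson H.orbit_sym H.orbit_trans UNIV_I subsetI subset_antisym)

lemma G_orbit_eqI: "Y \<in> G_orbit X \<Longrightarrow> G_orbit Y = G_orbit X"
  by (meson G.orbit_sym G.orbit_trans UNIV_I subsetI subset_antisym)

lemma H_orbit_refl: "X \<in> H_orbit X" and G_orbit_refl: "X \<in> G_orbit X"
  by (simp_all add: H.orbit_refl G.orbit_refl)

lemma H_act_in_H_orbit:
  "invertible A \<Longrightarrow> invertible B \<Longrightarrow> invertible C \<Longrightarrow> H_act (A, B, C) X \<in> H_orbit X"
  unfolding orbit_def by (auto simp: H_group_simps)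

lemma G_orbit_conv: "G_orbit X = (\<Union>\<delta>\<in>{\<delta>. bij \<delta>}. H_orbit (S3_act \<delta> X))"
  by (auto simp: orbit_def G_group_def semidirect_product_def G_act_def S3_group_simps)

section \<open>S_3 through its two adjacent transpositions\<close>

primrec swap_perm :: "swap \<Rightarrow> 3 \<Rightarrow> 3" where
  "swap_perm Swap12 = triple 2 1 3"
| "swap_perm Swap23 = triple 1 3 2"

lemma swap_perm_involution: "swap_perm s (swap_perm s i) = i"
  using exhaust_3[of i] by (cases s) (auto simp: triple_simps)

lemma bij_swap_perm: "bij (swap_perm s)"
  by (rule involuntory_imp_bij) (rule swap_perm_involution)

lemma swap_tensor_S3_act: "swap_tensor s X = S3_act (swap_perm s) X"
proof -
  have "inv_into UNIV (swap_perm s) = swap_perm s"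
    by (rule inv_unique_comp) (auto simp: fun_eq_iff swap_perm_involution)
  then show ?thesis
    by (cases s) (simp_all add: S3_act_def entry_def triple_simps)
qed

lemma swap_tensor_involution [simp]: "swap_tensor s (swap_tensor s X) = X"
  by (cases s) (simp_all add: vec_eq_iff)

lemma swap_tensor_braid:
  "swap_tensor Swap23 (swap_tensor Swap12 (swap_tensor Swap23 X)) =
   swap_tensor Swap12 (swap_tensor Swap23 (swap_tensor Swap12 X))"
  by (simp add: vec_eq_iff)

lemma permute_factors_closed:
  assumes "h \<in> carrier H_group"
  shows "permute_factors \<delta> h \<in> carrier H_group"
proof -
  obtain A B C where h: "h = (A, B, C)" by (metis prod_cases3)
  have "invertible (triple A B C t)" for t
    using assms exhaust_3[of t] by (auto simp: h H_group_simps triple_simps)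
  then show ?thesis
    by (simp only: h permute_factors_def split_conv H_group_simps simp_thms)
qed

text \<open>H is normal in G: a swap can be moved past an element of H at the cost of permuting its
  three matrices.\<close>

lemma swap_tensor_H_orbit: "Y \<in> H_orbit X \<Longrightarrow> swap_tensor s Y \<in> H_orbit (swap_tensor s X)"
  unfolding orbit_def swap_tensor_S3_act mem_Collect_eq
  by (metis S3_act_H_act bij_swap_perm permute_factors_closed)

lemma image_swap_tensor_H_orbit: "swap_tensor s ` H_orbit X = H_orbit (swap_tensor s X)"
proof
  show "swap_tensor s ` H_orbit X \<subseteq> H_orbit (swap_tensor s X)"
    using swap_tensor_H_orbit by blast
  show "H_orbit (swap_tensor s X) \<subseteq> swap_tensor s ` H_orbit X"
  proof
    fix Y assume "Y \<in> H_orbit (swap_tensor s X)"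
    from swap_tensor_H_orbit[OF this, of s] have "swap_tensor s Y \<in> H_orbit X" by simp
    then show "Y \<in> swap_tensor s ` H_orbit X"
      by (metis image_eqI swap_tensor_involution)
  qed
qed

lemma H_orbit_swap_cong:
  "H_orbit X = H_orbit Y \<Longrightarrow> H_orbit (swap_tensor s X) = H_orbit (swap_tensor s Y)"
  by (metis image_swap_tensor_H_orbit)

lemma inj_swap_tensor: "inj (swap_tensor s)"
  by (metis injI swap_tensor_involution)

lemma card_H_orbit_swaps: "card (H_orbit (foldr swap_tensor ss X)) = card (H_orbit X)"
proof (induction ss)
  case (Cons s ss)
  have "card (H_orbit (swap_tensor s (foldr swap_tensor ss X))) = card (H_orbit (foldr swap_tensor ss X))"
    unfolding image_swap_tensor_H_orbit[symmetric]
    by (rule card_image) (rule inj_on_subset[OF inj_swap_tensor], simp)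
  with Cons show ?case by simp
qed simp

definition S3_words :: "swap list list" where
  "S3_words = [[], [Swap12], [Swap23], [Swap12, Swap23], [Swap23, Swap12], [Swap12, Swap23, Swap12]]"

lemma S3_act_word:
  assumes "bij \<delta>"
  shows "\<exists>ss\<in>set S3_words. S3_act \<delta> X = foldr swap_tensor ss X"
proof -
  define \<epsilon> where "\<epsilon> = inv_into UNIV \<delta>"
  have "inj \<epsilon>" unfolding \<epsilon>_def by (simp add: assms bij_imp_bij_inv bij_is_inj)
  then have neq: "\<epsilon> 1 \<noteq> \<epsilon> 2" "\<epsilon> 1 \<noteq> \<epsilon> 3" "\<epsilon> 2 \<noteq> \<epsilon> 3"
    by (simp_all add: inj_eq)
  have act: "S3_act \<delta> X $ i $ j $ k = X $ triple i j k (\<epsilon> 1) $ triple i j k (\<epsilon> 2) $ triple i j k (\<epsilon> 3)"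
    for i j k
    by (simp add: S3_act_def entry_def \<epsilon>_def)
  have word: "S3_act \<delta> X = foldr swap_tensor ss X"
    if "\<And>i j k. X $ triple i j k (\<epsilon> 1) $ triple i j k (\<epsilon> 2) $ triple i j k (\<epsilon> 3) =
      foldr swap_tensor ss X $ i $ j $ k" for ss
    using that by (simp only: vec_eq_iff act) blast
  consider
      "\<epsilon> 1 = 1" "\<epsilon> 2 = 2" "\<epsilon> 3 = 3" | "\<epsilon> 1 = 2" "\<epsilon> 2 = 1" "\<epsilon> 3 = 3"
    | "\<epsilon> 1 = 1" "\<epsilon> 2 = 3" "\<epsilon> 3 = 2" | "\<epsilon> 1 = 3" "\<epsilon> 2 = 1" "\<epsilon> 3 = 2"
    | "\<epsilon> 1 = 2" "\<epsilon> 2 = 3" "\<epsilon> 3 = 1" | "\<epsilon> 1 = 3" "\<epsilon> 2 = 2" "\<epsilon> 3 = 1"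
    using neq exhaust_3[of "\<epsilon> 1"] exhaust_3[of "\<epsilon> 2"] exhaust_3[of "\<epsilon> 3"] by metis
  then show ?thesis
  proof cases
    case 1
    have "S3_act \<delta> X = foldr swap_tensor [] X"
      by (rule word) (simp add: 1 triple_simps)
    then show ?thesis unfolding S3_words_def by (metis list.set_intros)
  next
    case 2
    have "S3_act \<delta> X = foldr swap_tensor [Swap12] X"
      by (rule word) (simp add: 2 triple_simps)
    then show ?thesis unfolding S3_words_def by (metis list.set_intros)
  next
    case 3
    have "S3_act \<delta> X = foldr swap_tensor [Swap23] X"
      by (rule word) (simp add: 3 triple_simps)
    then show ?thesis unfolding S3_words_def by (metis list.set_intros)
  next
    case 4
    have "S3_act \<delta> X = foldr swap_tensor [Swap23, Swap12] X"
      by (rule word) (simp add: 4 triple_simps)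
    then show ?thesis unfolding S3_words_def by (metis list.set_intros)
  next
    case 5
    have "S3_act \<delta> X = foldr swap_tensor [Swap12, Swap23] X"
      by (rule word) (simp add: 5 triple_simps)
    then show ?thesis unfolding S3_words_def by (metis list.set_intros)
  next
    case 6
    have "S3_act \<delta> X = foldr swap_tensor [Swap12, Swap23, Swap12] X"
      by (rule word) (simp add: 6 triple_simps)
    then show ?thesis unfolding S3_words_def by (metis list.set_intros)
  qed
qed

declare swap_tensor.simps [simp del]

lemma word_S3_act: "\<exists>\<delta>. bij \<delta> \<and> foldr swap_tensor ss X = S3_act \<delta> X"
proof (induction ss)
  case Nil
  show ?case by (metis S3_act_id bij_id foldr.simps(1) id_apply)
next
  case (Cons s ss)
  then obtain \<delta> where "bij \<delta>" "foldr swap_tensor ss X = S3_act \<delta> X" by blast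
  then have "bij (\<delta> \<circ> swap_perm s)" "foldr swap_tensor (s # ss) X = S3_act (\<delta> \<circ> swap_perm s) X"
    by (simp_all only: bij_comp bij_swap_perm S3_act_comp foldr.simps o_apply swap_tensor_S3_act[of s])
  then show ?case by blast
qed

lemma G_orbit_words: "G_orbit X = (\<Union>ss\<in>set S3_words. H_orbit (foldr swap_tensor ss X))"
proof -
  have "\<exists>ss\<in>set S3_words. Y \<in> H_orbit (foldr swap_tensor ss X)"
    if "bij \<delta>" "Y \<in> H_orbit (S3_act \<delta> X)" for \<delta> Y
    using that S3_act_word by metis
  moreover have "\<exists>\<delta>. bij \<delta> \<and> Y \<in> H_orbit (S3_act \<delta> X)"
    if "Y \<in> H_orbit (foldr swap_tensor ss X)" for ss Y
    using that word_S3_act by metis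
  ultimately show ?thesis unfolding G_orbit_conv by blast
qed

lemma H_orbit_subset_G_orbit: "H_orbit X \<subseteq> G_orbit X"
proof -
  have "[] \<in> set S3_words" by (simp add: S3_words_def)
  then show ?thesis
    unfolding G_orbit_words by (metis UN_upper foldr.simps(1) id_apply)
qed

lemma swaps_in_G_orbit: "foldr swap_tensor ss X \<in> G_orbit X"
proof -
  obtain \<delta> where "bij \<delta>" "foldr swap_tensor ss X = S3_act \<delta> X"
    using word_S3_act by blast
  then have "foldr swap_tensor ss X \<in> H_orbit (S3_act \<delta> X)"
    by (simp only: H_orbit_refl)
  with \<open>bij \<delta>\<close> show ?thesis
    by (simp only: G_orbit_conv UN_iff mem_Collect_eq) (rule bexI[of _ \<delta>], simp_all)
qed

lemma move_tensor_H_orbit: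
  "move_valid (ss, u) \<Longrightarrow> move_tensor (ss, u) X \<in> H_orbit (foldr swap_tensor ss X)"
  by (cases u) (simp add: H_act_in_H_orbit mat_regular_invertible)

lemma move_tensor_G_orbit:
  assumes "move_valid m"
  shows "move_tensor m X \<in> G_orbit X"
proof -
  obtain ss u where m: "m = (ss, u)" by (cases m)
  from move_tensor_H_orbit[OF assms[unfolded m], of X]
  have "move_tensor m X \<in> G_orbit (foldr swap_tensor ss X)"
    using H_orbit_subset_G_orbit unfolding m by blast
  also have "\<dots> = G_orbit X"
    by (rule G_orbit_eqI) (rule swaps_in_G_orbit)
  finally show ?thesis .
qed

text \<open>A strict order on a finite type. The resulting induction drives both descents, that of
  tensors to the forms and that of simple tensors under the stabiliser of a form.\<close>

lemma wf_tensor_less: "wf {(X, Y). tensor_less X Y}"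
proof (rule finite_acyclic_wf)
  have "trans {(X, Y). tensor_less X Y}"
    by (auto intro: transI tensor_less_trans)
  then show "acyclic {(X, Y). tensor_less X Y}"
    by (auto simp: acyclic_def trancl_id dest: tensor_less_asym)
qed simp

lemmas tensor_less_induct = wf_induct_rule[OF wf_tensor_less, unfolded mem_Collect_eq split_conv]

section \<open>The H-orbits inside a G-orbit\<close>

definition H_orbits_in :: "tensor \<Rightarrow> tensor set set" where
  "H_orbits_in X = (\<lambda>ss. H_orbit (foldr swap_tensor ss X)) ` set S3_words"

lemma H_orbits_in_conv: "H_orbits_in X = {U \<in> H_orbits. U \<subseteq> G_orbit X}"
proof -
  have "U \<in> H_orbits_in X" if "U \<in> H_orbits" "U \<subseteq> G_orbit X" for U
  proof -
    from that(1) obtain Y where Y: "U = H_orbit Y" by (auto simp: orbits_def)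
    then have "Y \<in> G_orbit X" using that(2) H_orbit_refl by blast
    then show ?thesis
      unfolding G_orbit_words H_orbits_in_def Y using H_orbit_eqI by blast
  qed
  moreover have "U \<in> H_orbits" "U \<subseteq> G_orbit X" if "U \<in> H_orbits_in X" for U
    using that unfolding H_orbits_in_def G_orbit_words by (auto simp: orbits_def)
  ultimately show ?thesis by blast
qed

text \<open>The index in \<open>S\<^sub>3\<close> of the subgroup generated by the given words (6 if not recognised).\<close>

definition symmetry_bound :: "swap list list \<Rightarrow> nat" where
  "symmetry_bound ws = (if ws = [[Swap12], [Swap23]] then 1
     else if ws = [[Swap12]] \<or> ws = [[Swap23]] \<or> ws = [[Swap12, Swap23, Swap12]] then 3 else 6)"

text \<open>S_3 permutes the H-orbits in a G-orbit transitively, so their number is the index of the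
  stabiliser of one of them. Any known subgroup of that stabiliser bounds the index from
  above.\<close>

lemma card_H_orbits_in_le:
  assumes "\<And>ss. ss \<in> set ws \<Longrightarrow> H_orbit (foldr swap_tensor ss X) = H_orbit X"
  shows "card (H_orbits_in X) \<le> symmetry_bound ws"
proof -
  note cong = H_orbit_swap_cong
  define O1 where "O1 = H_orbit X"
  define O2 where "O2 = H_orbit (swap_tensor Swap12 X)"
  define O3 where "O3 = H_orbit (swap_tensor Swap23 X)"
  define O4 where "O4 = H_orbit (swap_tensor Swap12 (swap_tensor Swap23 X))"
  define O5 where "O5 = H_orbit (swap_tensor Swap23 (swap_tensor Swap12 X))"
  define O6 where "O6 = H_orbit (swap_tensor Swap12 (swap_tensor Swap23 (swap_tensor Swap12 X)))"
  note defs = O1_def O2_def O3_def O4_def O5_def O6_def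
  have eq: "H_orbits_in X = {O1, O2, O3, O4, O5, O6}"
    unfolding H_orbits_in_def S3_words_def defs by (simp only: list.set image_insert image_empty
      foldr.simps id_apply o_apply)
  \<comment> \<open>Applying further swaps to both sides of an equality between two of the orbits
    identifies the remaining ones in pairs.\<close>
  have swap12: "O5 = O3" "O6 = O4" if "O2 = O1"
  proof -
    show "O5 = O3" using cong[OF that[unfolded defs]] unfolding defs .
    from cong[OF this[unfolded defs]] show "O6 = O4" unfolding defs .
  qed
  have swap23: "O4 = O2" "O6 = O5" if "O3 = O1"
  proof -
    show "O4 = O2" using cong[OF that[unfolded defs]] unfolding defs .
    \<comment> \<open>The word that arises is 23-12-23, while \<open>O6\<close> is defined by
      12-23-12; the braid relation identifies them.\<close>
    from cong[OF this[unfolded defs], of Swap23] show "O6 = O5" unfolding defs swap_tensor_braid .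
  qed
  have swap13: "O5 = O2" "O4 = O3" if "O6 = O1"
  proof -
    show "O5 = O2" using cong[OF that[unfolded defs], of Swap12] unfolding defs swap_tensor_involution .
    show "O4 = O3"
      using cong[OF that[unfolded defs, folded swap_tensor_braid], of Swap23]
      unfolding defs swap_tensor_involution .
  qed
  have word: "O2 = O1" if "[Swap12] \<in> set ws"
    using assms[OF that] by (simp add: defs)
  have word': "O3 = O1" if "[Swap23] \<in> set ws"
    using assms[OF that] by (simp add: defs)
  have word'': "O6 = O1" if "[Swap12, Swap23, Swap12] \<in> set ws"
    using assms[OF that] by (simp add: defs)
  have card3: "card {a, b, c} \<le> 3" for a b c :: "tensor set"
    using card_length[of "[a, b, c]"] by simp
  consider "ws = [[Swap12], [Swap23]]" | "ws = [[Swap12]]" | "ws = [[Swap23]]"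
    | "ws = [[Swap12, Swap23, Swap12]]" | "symmetry_bound ws = 6"
    unfolding symmetry_bound_def by argo
  then show ?thesis
  proof cases
    case 1
    then have "O2 = O1" "O3 = O1" using word word' by simp_all
    then have "H_orbits_in X = {O1}" unfolding eq using swap12 swap23 by simp
    then show ?thesis by (simp add: 1 symmetry_bound_def)
  next
    case 2
    then have "O2 = O1" using word by simp
    then have "H_orbits_in X = {O1, O3, O4}" unfolding eq using swap12 by (simp add: insert_commute)
    then show ?thesis using card3[of O1 O3 O4] by (simp add: 2 symmetry_bound_def)
  next
    case 3
    then have "O3 = O1" using word' by simp
    then have "H_orbits_in X = {O1, O2, O5}" unfolding eq using swap23 by (simp add: insert_commute)
    then show ?thesis using card3[of O1 O2 O5] by (simp add: 3 symmetry_bound_def)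
  next
    case 4
    then have "O6 = O1" using word'' by simp
    then have "H_orbits_in X = {O1, O2, O3}" unfolding eq using swap13 by (simp add: insert_commute)
    then show ?thesis using card3[of O1 O2 O3] by (simp add: 4 symmetry_bound_def)
  next
    case 5
    have "card (H_orbits_in X) \<le> length S3_words"
      unfolding H_orbits_in_def by (metis card_image_le card_length finite_set le_trans)
    with 5 show ?thesis by (simp add: S3_words_def)
  qed
qed

section \<open>Lower bounds for the orders of stabilisers\<close>

definition triple_rows :: "matrix3 \<times> matrix3 \<times> matrix3 \<Rightarrow> (bit ^ 3) list" where
  "triple_rows = (\<lambda>(A, B, C). [A $ 1, A $ 2, A $ 3, B $ 1, B $ 2, B $ 3, C $ 1, C $ 2, C $ 3])"

lemma matrix_mult_row_id:
  fixes A B :: "'a :: semiring_1 ^ 'n ^ 'n"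
  assumes "A $ i = mat 1 $ i"
  shows "(A ** B) $ i = B $ i"
proof -
  have "(A ** B) $ i = (mat 1 ** B) $ i"
    using assms by (simp add: matrix_matrix_mult_def vec_eq_iff)
  then show ?thesis by simp
qed

lemma triple_rows_mult:
  assumes "triple_rows s ! j = triple_rows \<one>\<^bsub>H_group\<^esub> ! j" "j < 9"
  shows "triple_rows (s \<otimes>\<^bsub>H_group\<^esub> u) ! j = triple_rows u ! j"
proof -
  have "j \<in> {0, 1, 2, 3, 4, 5, 6, 7, 8}" using assms(2) by auto
  then show ?thesis
    using assms(1) by (cases s; cases u) (auto simp: triple_rows_def H_group_simps matrix_mult_row_id)
qed

text \<open>Row i of A is e_i A, so having the first k rows of the identity means fixing k unit
  vectors under right multiplication. For growing k this is a stabiliser chain as in the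
  Schreier-Sims method, with the nine unit vectors as base and the trivial group at k = 9.\<close>

definition partial_stabilizer :: "tensor \<Rightarrow> nat \<Rightarrow> (matrix3 \<times> matrix3 \<times> matrix3) set" where
  "partial_stabilizer X k = {h \<in> stabilizer H_group H_act X.
     take k (triple_rows h) = take k (triple_rows \<one>\<^bsub>H_group\<^esub>)}"

lemma finite_partial_stabilizer: "finite (partial_stabilizer X k)"
  by (rule finite_subset[of _ UNIV]) simp_all

lemma length_triple_rows: "length (triple_rows h) = 9"
  by (simp add: triple_rows_def split: prod.splits)

lemma take_triple_rows_eq_iff:
  assumes "k \<le> 9"
  shows "take k (triple_rows g) = take k (triple_rows h) \<longleftrightarrow>
    (\<forall>j<k. triple_rows g ! j = triple_rows h ! j)"
  using assms by (auto simp: list_eq_iff_nth_eq length_triple_rows)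

lemma one_in_partial_stabilizer: "\<one>\<^bsub>H_group\<^esub> \<in> partial_stabilizer X k"
  by (simp add: partial_stabilizer_def H.stabilizer_one_closed)

text \<open>
  If \<open>s\<close> fixes row \<open>k\<close>, then \<open>s u\<close> and \<open>u\<close> have the same row \<open>k\<close>. So \<open>s u\<close> determines \<open>u\<close>, then \<open>s\<close>.
\<close>

lemma card_partial_stabilizer_step:
  assumes "k < 9" "U \<subseteq> partial_stabilizer X k" "inj_on (\<lambda>u. triple_rows u ! k) U"
  shows "card U * card (partial_stabilizer X (Suc k)) \<le> card (partial_stabilizer X k)"
proof -
  interpret group H_group by (rule group_H_group)
  let ?f = "\<lambda>(u, s). s \<otimes>\<^bsub>H_group\<^esub> u"
  have carrier: "partial_stabilizer X j \<subseteq> carrier H_group" for j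
    by (auto simp: partial_stabilizer_def stabilizer_def)
  have rows: "triple_rows (s \<otimes>\<^bsub>H_group\<^esub> u) ! j = triple_rows u ! j"
    if "s \<in> partial_stabilizer X (Suc k)" "j < Suc k" for s u j
    using that assms(1)
    by (intro triple_rows_mult) (auto simp: partial_stabilizer_def take_triple_rows_eq_iff)
  have "inj_on ?f (U \<times> partial_stabilizer X (Suc k))"
  proof (rule inj_onI)
    fix x y assume xy: "x \<in> U \<times> partial_stabilizer X (Suc k)" "y \<in> U \<times> partial_stabilizer X (Suc k)"
      "?f x = ?f y"
    obtain u s u' s' where x: "x = (u, s)" and y: "y = (u', s')" by (cases x, cases y)
    with xy have *: "u \<in> U" "s \<in> partial_stabilizer X (Suc k)"
      "u' \<in> U" "s' \<in> partial_stabilizer X (Suc k)"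
      "s \<otimes>\<^bsub>H_group\<^esub> u = s' \<otimes>\<^bsub>H_group\<^esub> u'"
      by simp_all
    then have "triple_rows u ! k = triple_rows u' ! k"
      by (metis lessI rows)
    with * assms(3) have "u = u'" by (auto dest: inj_onD)
    moreover have "s = s'"
    proof -
      have "s \<in> carrier H_group" "s' \<in> carrier H_group" "u' \<in> carrier H_group"
        using *(2-4) carrier assms(2) by blast+
      with *(5) show ?thesis unfolding \<open>u = u'\<close> by simp
    qed
    ultimately show "x = y" by (simp add: x y)
  qed
  moreover have "?f ` (U \<times> partial_stabilizer X (Suc k)) \<subseteq> partial_stabilizer X k"
  proof (rule image_subsetI)
    fix x assume x: "x \<in> U \<times> partial_stabilizer X (Suc k)"
    obtain u s where us': "x = (u, s)" by (cases x)
    with x have us: "u \<in> U" "s \<in> partial_stabilizer X (Suc k)" by simp_all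
    then have "s \<otimes>\<^bsub>H_group\<^esub> u \<in> stabilizer H_group H_act X"
      using assms(2) by (intro H.stabilizer_m_closed) (auto simp: partial_stabilizer_def)
    moreover have "triple_rows (s \<otimes>\<^bsub>H_group\<^esub> u) ! j = triple_rows \<one>\<^bsub>H_group\<^esub> ! j" if "j < k" for j
    proof -
      have "u \<in> partial_stabilizer X k" using us(1) assms(2) by blast
      then have "triple_rows u ! j = triple_rows \<one>\<^bsub>H_group\<^esub> ! j"
        using that assms(1) by (simp add: partial_stabilizer_def take_triple_rows_eq_iff)
      then show ?thesis using rows[OF us(2), of j u] that by simp
    qed
    ultimately have "s \<otimes>\<^bsub>H_group\<^esub> u \<in> partial_stabilizer X k"
      using assms(1) by (simp add: partial_stabilizer_def take_triple_rows_eq_iff)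
    then show "?f x \<in> partial_stabilizer X k" by (simp add: us')
  qed
  ultimately have "card (U \<times> partial_stabilizer X (Suc k)) \<le> card (partial_stabilizer X k)"
    by (intro card_inj_on_le[OF _ _ finite_partial_stabilizer])
  then show ?thesis by (simp add: card_cartesian_product)
qed

type_synonym mats = "mat \<times> mat \<times> mat"

fun mats_rows :: "mats \<Rightarrow> row list" where
  "mats_rows (A, B, C) = mat_rows A @ mat_rows B @ mat_rows C"

fun mats_matrices :: "mats \<Rightarrow> matrix3 \<times> matrix3 \<times> matrix3" where
  "mats_matrices (A, B, C) = (mat_matrix A, mat_matrix B, mat_matrix C)"

lemma triple_rows_mats: "triple_rows (mats_matrices u) = map row_vec (mats_rows u)"
proof -
  obtain a b c d e f g h i where "u = (Mat a b c, Mat d e f, Mat g h i)"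
    by (metis mat.exhaust prod_cases3)
  then show ?thesis by (simp add: triple_rows_def)
qed

lemma row_vec_inject: "u \<noteq> Unknown \<Longrightarrow> v \<noteq> Unknown \<Longrightarrow> row_vec u = row_vec v \<longleftrightarrow> u = v"
  by (cases u; cases v) (simp_all add: vec3_eq_iff)

lemma inj_on_row_vec: "Unknown \<notin> S \<Longrightarrow> inj_on row_vec S"
  by (rule inj_onI) (metis row_vec_inject)

definition unit_rows :: "row list" where
  "unit_rows = [R4, R2, R1, R4, R2, R1, R4, R2, R1]"

lemma length_unit_rows: "length unit_rows = 9"
  by (simp add: unit_rows_def)

lemma triple_rows_one: "triple_rows \<one>\<^bsub>H_group\<^esub> = map row_vec unit_rows"
proof -
  have "(1::3) \<noteq> 2" "(1::3) \<noteq> 3" "(2::3) \<noteq> 3" by simp_all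
  then show ?thesis
    by (simp add: triple_rows_def H_group_simps unit_rows_def vec3_eq_iff mat_def)
qed

text \<open>The identity is an implicit coset representative at each level: its row takes part in
  the test for distinctness, and \<open>chain_size\<close> counts it by \<open>Suc\<close>. The
  empty word in the moves keeps them in H. A chain may stop early, the missing factors counting as
  1.\<close>

fun chain_ok :: "row list \<Rightarrow> nat \<Rightarrow> mats list list \<Rightarrow> bool" where
  "chain_ok p k [] \<longleftrightarrow> k \<le> 9"
| "chain_ok p k (us # uss) \<longleftrightarrow>
     list_all (\<lambda>u. move_valid ([], u) \<and> move_rows ([], u) p = p \<and>
       take k (mats_rows u) = take k unit_rows) us \<and>
     distinct (unit_rows ! k # map (\<lambda>u. mats_rows u ! k) us) \<and> chain_ok p (Suc k) uss"

primrec chain_size :: "mats list list \<Rightarrow> nat" where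
  "chain_size [] = 1"
| "chain_size (us # uss) = Suc (length us) * chain_size uss"

lemma chain_ok_le_9: "chain_ok p k uss \<Longrightarrow> k \<le> 9"
  by (induction uss arbitrary: k) (auto dest: Suc_leD)

text \<open>A list without \<open>Unknown\<close> describes a single tensor, so an unchanged list
  means a fixed tensor.\<close>

lemma move_tensor_eqI:
  assumes "fits p X" "Unknown \<notin> set p" "move_valid m" "move_rows m p = p"
  shows "move_tensor m X = X"
  using fits_move[OF assms(1,3)] fits_known[OF _ assms(2)] assms by metis

lemma mats_rows_known: "move_valid (ss, u) \<Longrightarrow> Unknown \<notin> set (mats_rows u)"
proof -
  obtain a b c d e f g h i where "u = (Mat a b c, Mat d e f, Mat g h i)"
    by (metis mat.exhaust prod_cases3)
  then show "move_valid (ss, u) \<Longrightarrow> Unknown \<notin> set (mats_rows u)"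
    by (auto dest!: mat_regular_known simp del: mat_regular.simps)
qed

lemma length_mats_rows: "length (mats_rows u) = 9"
proof -
  obtain a b c d e f g h i where "u = (Mat a b c, Mat d e f, Mat g h i)"
    by (metis mat.exhaust prod_cases3)
  then show ?thesis by simp
qed

text \<open>Elements with different rows k lie in different right cosets of the next group of the
  chain, so the numbers of representatives multiply to a lower bound, complete transversals or
  not.\<close>

lemma chain_size_le_card:
  assumes "chain_ok p k uss" "fits p X" "Unknown \<notin> set p"
  shows "chain_size uss \<le> card (partial_stabilizer X k)"
  using assms(1)
proof (induction uss arbitrary: k)
  case Nil
  have "partial_stabilizer X k \<noteq> {}" using one_in_partial_stabilizer by blast
  then show ?case by (simp add: finite_partial_stabilizer Suc_le_eq card_gt_0_iff)
next
  case (Cons us uss)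
  have k: "k < 9" using chain_ok_le_9[of p "Suc k" uss] Cons.prems by simp
  let ?r = "\<lambda>u. triple_rows u ! k"
  define hs where "hs = \<one>\<^bsub>H_group\<^esub> # map mats_matrices us"
  have known: "Unknown \<notin> set (mats_rows u)" if "u \<in> set us" for u
    using Cons.prems that mats_rows_known[of "[]" u] by (auto simp: list_all_iff)
  have "h \<in> partial_stabilizer X k" if "h \<in> set hs" for h
  proof (cases "h = \<one>\<^bsub>H_group\<^esub>")
    case True
    then show ?thesis by (simp add: one_in_partial_stabilizer)
  next
    case False
    with that obtain u where u: "u \<in> set us" "h = mats_matrices u" by (auto simp: hs_def)
    obtain A B C where ABC: "u = (A, B, C)" by (metis prod_cases3)
    have ok: "move_valid ([], u)" "move_rows ([], u) p = p"
      "take k (mats_rows u) = take k unit_rows"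
      using Cons.prems u(1) by (simp_all add: list_all_iff)
    have "H_act h X = X"
      using move_tensor_eqI[OF assms(2,3) ok(1,2)] by (simp add: u(2) ABC)
    moreover have "h \<in> carrier H_group"
      using ok(1) by (simp add: u(2) ABC H_group_simps mat_regular_invertible)
    moreover have "take k (triple_rows h) = take k (triple_rows \<one>\<^bsub>H_group\<^esub>)"
      using ok(3) by (simp add: u(2) triple_rows_mats triple_rows_one take_map)
    ultimately show ?thesis by (simp add: partial_stabilizer_def stabilizer_def)
  qed
  then have sub: "set hs \<subseteq> partial_stabilizer X k" by blast
  have r: "map ?r hs = map row_vec (unit_rows ! k # map (\<lambda>u. mats_rows u ! k) us)"
    using k by (simp add: hs_def triple_rows_mats triple_rows_one length_mats_rows length_unit_rows)
  have "distinct (map row_vec (unit_rows ! k # map (\<lambda>u. mats_rows u ! k) us))"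
  proof -
    have "Unknown \<notin> set (unit_rows ! k # map (\<lambda>u. mats_rows u ! k) us)"
    proof -
      have "unit_rows ! k \<in> set unit_rows" using k by (simp add: length_unit_rows)
      then have "unit_rows ! k \<noteq> Unknown" by (auto simp: unit_rows_def)
      moreover have "mats_rows u ! k \<noteq> Unknown" if "u \<in> set us" for u
        using known[OF that] k length_mats_rows nth_mem by metis
      ultimately show ?thesis
        unfolding list.set(2) set_map insert_iff image_iff by metis
    qed
    then have "inj_on row_vec (set (unit_rows ! k # map (\<lambda>u. mats_rows u ! k) us))"
      by (rule inj_on_row_vec)
    then show ?thesis using Cons.prems by (simp only: distinct_map chain_ok.simps)
  qed
  then have d: "distinct (map ?r hs)" by (simp only: r)
  then have "inj_on ?r (set hs)" "distinct hs"
    by (simp_all only: distinct_map)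
  then have "card (set hs) = Suc (length us)"
    by (simp only: distinct_card) (simp add: hs_def)
  with card_partial_stabilizer_step[OF k sub \<open>inj_on ?r (set hs)\<close>]
  have "Suc (length us) * card (partial_stabilizer X (Suc k)) \<le> card (partial_stabilizer X k)"
    by simp
  moreover have "chain_size uss \<le> card (partial_stabilizer X (Suc k))"
    using Cons.IH Cons.prems by simp
  ultimately show ?case
    unfolding chain_size.simps by (rule order_trans[OF mult_le_mono2, rotated])
qed

section \<open>Certificates\<close>

text \<open>The moves come from a greedy set cover of the prefixes to be dropped.\<close>

definition descent_moves :: "move list" where
  "descent_moves = [
    ([], Mat R4 R1 R2, Mat R4 R2 R1, Mat R4 R2 R1),
    ([Swap12], Mat R4 R2 R1, Mat R4 R2 R1, Mat R2 R4 R1),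
    ([Swap23], Mat R4 R2 R3, Mat R4 R2 R1, Mat R4 R2 R1),
    ([], Mat R4 R2 R7, Mat R4 R2 R5, Mat R4 R2 R5),
    ([], Mat R4 R2 R5, Mat R4 R2 R1, Mat R4 R2 R1),
    ([], Mat R4 R2 R3, Mat R4 R6 R7, Mat R4 R6 R3),
    ([], Mat R4 R2 R3, Mat R4 R2 R1, Mat R4 R2 R1),
    ([], Mat R4 R2 R1, Mat R4 R2 R5, Mat R4 R2 R1),
    ([], Mat R4 R2 R3, Mat R4 R6 R1, Mat R4 R2 R1),
    ([], Mat R4 R2 R1, Mat R2 R6 R1, Mat R2 R6 R1),
    ([], Mat R4 R6 R1, Mat R4 R2 R3, Mat R2 R6 R1),
    ([], Mat R4 R2 R1, Mat R2 R1 R6, Mat R1 R4 R3),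
    ([Swap23], Mat R4 R2 R7, Mat R4 R5 R2, Mat R4 R1 R6),
    ([], Mat R4 R2 R1, Mat R4 R2 R1, Mat R4 R6 R1),
    ([], Mat R4 R6 R3, Mat R4 R6 R5, Mat R4 R2 R7),
    ([], Mat R4 R6 R1, Mat R4 R6 R1, Mat R4 R6 R1),
    ([], Mat R4 R2 R3, Mat R4 R1 R3, Mat R4 R1 R3),
    ([], Mat R4 R2 R5, Mat R7 R5 R4, Mat R5 R6 R2),
    ([], Mat R4 R1 R2, Mat R2 R4 R1, Mat R4 R2 R1),
    ([], Mat R4 R6 R1, Mat R4 R2 R7, Mat R4 R2 R3),
    ([], Mat R4 R6 R1, Mat R4 R2 R5, Mat R4 R2 R5),
    ([], Mat R2 R4 R1, Mat R4 R2 R1, Mat R4 R1 R2),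
    ([Swap12, Swap23, Swap12], Mat R2 R1 R4, Mat R2 R1 R4, Mat R2 R1 R4),
    ([], Mat R4 R2 R5, Mat R4 R2 R3, Mat R4 R2 R3),
    ([], Mat R2 R5 R3, Mat R1 R3 R4, Mat R2 R1 R6),
    ([], Mat R4 R2 R3, Mat R4 R6 R1, Mat R4 R6 R1),
    ([Swap23], Mat R1 R4 R2, Mat R2 R1 R4, Mat R2 R1 R4),
    ([], Mat R4 R2 R3, Mat R4 R2 R3, Mat R4 R6 R1),
    ([], Mat R6 R2 R1, Mat R6 R2 R1, Mat R6 R2 R1),
    ([], Mat R4 R2 R5, Mat R4 R2 R5, Mat R4 R2 R5),
    ([Swap12], Mat R4 R1 R2, Mat R2 R4 R1, Mat R2 R4 R1),
    ([], Mat R4 R2 R1, Mat R4 R2 R1, Mat R4 R1 R2),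
    ([], Mat R4 R6 R1, Mat R4 R2 R5, Mat R4 R2 R1),
    ([], Mat R4 R2 R3, Mat R4 R2 R1, Mat R4 R2 R5),
    ([Swap12], Mat R4 R2 R1, Mat R4 R2 R1, Mat R1 R4 R2),
    ([], Mat R4 R1 R2, Mat R4 R1 R6, Mat R4 R1 R2),
    ([], Mat R4 R6 R3, Mat R4 R6 R1, Mat R4 R2 R7),
    ([], Mat R3 R5 R1, Mat R5 R6 R4, Mat R5 R3 R2),
    ([], Mat R4 R2 R1, Mat R6 R3 R7, Mat R7 R3 R6),
    ([], Mat R4 R2 R1, Mat R4 R1 R2, Mat R2 R4 R1),
    ([], Mat R4 R2 R1, Mat R2 R4 R1, Mat R4 R2 R1),
    ([], Mat R4 R1 R2, Mat R2 R1 R4, Mat R2 R4 R1),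
    ([], Mat R4 R2 R1, Mat R4 R6 R1, Mat R4 R2 R5),
    ([], Mat R4 R6 R1, Mat R4 R2 R3, Mat R4 R2 R1),
    ([], Mat R4 R3 R2, Mat R4 R3 R2, Mat R4 R3 R2),
    ([], Mat R4 R2 R3, Mat R4 R6 R1, Mat R4 R2 R5),
    ([], Mat R4 R6 R1, Mat R4 R6 R3, Mat R4 R6 R5),
    ([Swap23], Mat R4 R2 R1, Mat R4 R2 R1, Mat R4 R2 R1),
    ([Swap23, Swap12], Mat R2 R4 R1, Mat R4 R1 R2, Mat R4 R1 R2),
    ([Swap12, Swap23, Swap12], Mat R2 R4 R1, Mat R4 R1 R2, Mat R4 R1 R3),
    ([], Mat R2 R4 R1, Mat R2 R1 R4, Mat R2 R4 R1),
    ([], Mat R2 R4 R1, Mat R2 R4 R1, Mat R2 R4 R1),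
    ([], Mat R4 R2 R1, Mat R4 R3 R2, Mat R4 R3 R2),
    ([], Mat R4 R2 R3, Mat R4 R2 R3, Mat R4 R2 R3),
    ([], Mat R4 R2 R7, Mat R4 R2 R3, Mat R4 R2 R3),
    ([], Mat R4 R6 R3, Mat R4 R2 R7, Mat R4 R2 R3),
    ([Swap12], Mat R4 R2 R1, Mat R4 R2 R1, Mat R1 R2 R4),
    ([Swap12, Swap23, Swap12], Mat R4 R2 R3, Mat R4 R1 R2, Mat R4 R2 R7)]"

type_synonym entry = "row list \<times> (row \<times> row \<times> row) list \<times> move list \<times> mats list list"

text \<open>
  An entry consists of a form, a decomposition of it into simple tensors, moves that fix it and
  whose permutations generate the image of its stabiliser in \<open>S\<^sub>3\<close>, and a stabiliser chain. Counting
  from 0, list number \<open>k\<close> of the chain consists of elements of the stabiliser in \<open>H\<close>; their first \<open>k\<close>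
  rows are those of the identity, and their rows \<open>k\<close> differ from each other and from the identity.
\<close>

definition catalogue :: "entry list" where
  "catalogue = [
    ([R0, R0, R0, R0, R0, R0, R0, R0, R0],
     [],
     [([Swap12], Mat R4 R2 R1, Mat R4 R2 R1, Mat R4 R2 R1),
      ([Swap23], Mat R4 R2 R1, Mat R4 R2 R1, Mat R4 R2 R1)],
     [[(Mat R1 R2 R4, Mat R4 R2 R1, Mat R4 R2 R1),
       (Mat R2 R1 R4, Mat R4 R2 R1, Mat R4 R2 R1),
       (Mat R3 R1 R4, Mat R4 R2 R1, Mat R4 R2 R1),
       (Mat R5 R1 R2, Mat R4 R2 R1, Mat R4 R2 R1),
       (Mat R6 R1 R2, Mat R4 R2 R1, Mat R4 R2 R1),
       (Mat R7 R1 R2, Mat R4 R2 R1, Mat R4 R2 R1)],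
      [(Mat R4 R1 R2, Mat R4 R2 R1, Mat R4 R2 R1),
       (Mat R4 R3 R1, Mat R4 R2 R1, Mat R4 R2 R1),
       (Mat R4 R5 R2, Mat R4 R2 R1, Mat R4 R2 R1),
       (Mat R4 R6 R1, Mat R4 R2 R1, Mat R4 R2 R1),
       (Mat R4 R7 R1, Mat R4 R2 R1, Mat R4 R2 R1)],
      [(Mat R4 R2 R3, Mat R4 R2 R1, Mat R4 R2 R1),
       (Mat R4 R2 R5, Mat R4 R2 R1, Mat R4 R2 R1),
       (Mat R4 R2 R7, Mat R4 R2 R1, Mat R4 R2 R1)],
      [(Mat R4 R2 R1, Mat R1 R2 R4, Mat R4 R2 R1),
       (Mat R4 R2 R1, Mat R2 R1 R4, Mat R4 R2 R1),
       (Mat R4 R2 R1, Mat R3 R1 R4, Mat R4 R2 R1),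
       (Mat R4 R2 R1, Mat R5 R1 R2, Mat R4 R2 R1),
       (Mat R4 R2 R1, Mat R6 R1 R2, Mat R4 R2 R1),
       (Mat R4 R2 R1, Mat R7 R1 R2, Mat R4 R2 R1)],
      [(Mat R4 R2 R1, Mat R4 R1 R2, Mat R4 R2 R1),
       (Mat R4 R2 R1, Mat R4 R3 R1, Mat R4 R2 R1),
       (Mat R4 R2 R1, Mat R4 R5 R2, Mat R4 R2 R1),
       (Mat R4 R2 R1, Mat R4 R6 R1, Mat R4 R2 R1),
       (Mat R4 R2 R1, Mat R4 R7 R1, Mat R4 R2 R1)],
      [(Mat R4 R2 R1, Mat R4 R2 R3, Mat R4 R2 R1),
       (Mat R4 R2 R1, Mat R4 R2 R5, Mat R4 R2 R1),
       (Mat R4 R2 R1, Mat R4 R2 R7, Mat R4 R2 R1)],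
      [(Mat R4 R2 R1, Mat R4 R2 R1, Mat R1 R2 R4),
       (Mat R4 R2 R1, Mat R4 R2 R1, Mat R2 R1 R4),
       (Mat R4 R2 R1, Mat R4 R2 R1, Mat R3 R1 R4),
       (Mat R4 R2 R1, Mat R4 R2 R1, Mat R5 R1 R2),
       (Mat R4 R2 R1, Mat R4 R2 R1, Mat R6 R1 R2),
       (Mat R4 R2 R1, Mat R4 R2 R1, Mat R7 R1 R2)],
      [(Mat R4 R2 R1, Mat R4 R2 R1, Mat R4 R1 R2),
       (Mat R4 R2 R1, Mat R4 R2 R1, Mat R4 R3 R1),
       (Mat R4 R2 R1, Mat R4 R2 R1, Mat R4 R5 R2),
       (Mat R4 R2 R1, Mat R4 R2 R1, Mat R4 R6 R1),
       (Mat R4 R2 R1, Mat R4 R2 R1, Mat R4 R7 R1)],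
      [(Mat R4 R2 R1, Mat R4 R2 R1, Mat R4 R2 R3),
       (Mat R4 R2 R1, Mat R4 R2 R1, Mat R4 R2 R5),
       (Mat R4 R2 R1, Mat R4 R2 R1, Mat R4 R2 R7)]]),
    ([R0, R0, R0, R0, R0, R0, R0, R0, R1],
     [(R1, R1, R1)],
     [([Swap12], Mat R2 R4 R1, Mat R2 R4 R1, Mat R2 R4 R1),
      ([Swap23], Mat R2 R4 R1, Mat R4 R2 R1, Mat R2 R4 R1)],
     [[(Mat R2 R4 R1, Mat R2 R4 R1, Mat R2 R4 R1),
       (Mat R6 R2 R1, Mat R2 R4 R1, Mat R2 R4 R1)],
      [(Mat R4 R6 R1, Mat R2 R4 R1, Mat R2 R4 R1)],
      [(Mat R4 R2 R3, Mat R2 R4 R1, Mat R2 R4 R1),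
       (Mat R4 R2 R5, Mat R2 R4 R1, Mat R2 R4 R1),
       (Mat R4 R2 R7, Mat R2 R4 R1, Mat R2 R4 R1)],
      [(Mat R4 R2 R1, Mat R2 R4 R1, Mat R2 R4 R1),
       (Mat R4 R2 R1, Mat R6 R2 R1, Mat R2 R4 R1)],
      [(Mat R4 R2 R1, Mat R4 R6 R1, Mat R2 R4 R1)],
      [(Mat R4 R2 R1, Mat R4 R2 R3, Mat R2 R4 R1),
       (Mat R4 R2 R1, Mat R4 R2 R5, Mat R2 R4 R1),
       (Mat R4 R2 R1, Mat R4 R2 R7, Mat R2 R4 R1)],
      [(Mat R4 R2 R1, Mat R4 R2 R1, Mat R2 R4 R1),
       (Mat R4 R2 R1, Mat R4 R2 R1, Mat R6 R2 R1)],
      [(Mat R4 R2 R1, Mat R4 R2 R1, Mat R4 R6 R1)],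
      [(Mat R4 R2 R1, Mat R4 R2 R1, Mat R4 R2 R3),
       (Mat R4 R2 R1, Mat R4 R2 R1, Mat R4 R2 R5),
       (Mat R4 R2 R1, Mat R4 R2 R1, Mat R4 R2 R7)]]),
    ([R0, R0, R0, R0, R0, R0, R0, R1, R2],
     [(R1, R1, R2), (R1, R2, R1)],
     [([Swap23], Mat R4 R2 R1, Mat R4 R1 R2, Mat R4 R1 R2)],
     [[(Mat R2 R4 R1, Mat R4 R1 R2, Mat R4 R1 R2),
       (Mat R6 R2 R1, Mat R4 R1 R2, Mat R4 R1 R2)],
      [(Mat R4 R6 R1, Mat R4 R1 R2, Mat R4 R1 R2)],
      [(Mat R4 R2 R3, Mat R4 R1 R2, Mat R4 R1 R2),
       (Mat R4 R2 R5, Mat R4 R1 R2, Mat R4 R1 R2),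
       (Mat R4 R2 R7, Mat R4 R1 R2, Mat R4 R1 R2)],
      [],
      [(Mat R4 R2 R1, Mat R4 R1 R2, Mat R4 R1 R2),
       (Mat R4 R2 R1, Mat R4 R3 R1, Mat R4 R3 R1),
       (Mat R4 R2 R1, Mat R4 R5 R2, Mat R4 R1 R2),
       (Mat R4 R2 R1, Mat R4 R6 R1, Mat R4 R2 R1),
       (Mat R4 R2 R1, Mat R4 R7 R1, Mat R4 R3 R1)],
      [(Mat R4 R2 R1, Mat R4 R2 R3, Mat R4 R2 R3),
       (Mat R4 R2 R1, Mat R4 R2 R5, Mat R4 R2 R1),
       (Mat R4 R2 R1, Mat R4 R2 R7, Mat R4 R2 R3)],
      [],
      [(Mat R4 R2 R1, Mat R4 R2 R1, Mat R4 R6 R1)],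
      [(Mat R4 R2 R1, Mat R4 R2 R1, Mat R4 R2 R5)]]),
    ([R0, R0, R0, R0, R0, R1, R0, R2, R0],
     [(R1, R2, R2), (R2, R1, R1)],
     [([Swap12], Mat R4 R1 R2, Mat R4 R1 R2, Mat R4 R2 R1),
      ([Swap23], Mat R4 R1 R2, Mat R4 R1 R2, Mat R4 R1 R2)],
     [[],
      [(Mat R4 R1 R2, Mat R4 R1 R2, Mat R4 R1 R2),
       (Mat R4 R5 R2, Mat R4 R1 R2, Mat R4 R1 R2),
       (Mat R4 R6 R1, Mat R4 R2 R1, Mat R4 R2 R1)],
      [(Mat R4 R2 R5, Mat R4 R2 R1, Mat R4 R2 R1)],
      [],
      [(Mat R4 R2 R1, Mat R4 R6 R1, Mat R4 R2 R1)],
      [(Mat R4 R2 R1, Mat R4 R2 R5, Mat R4 R2 R1)],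
      [],
      [(Mat R4 R2 R1, Mat R4 R2 R1, Mat R4 R6 R1)],
      [(Mat R4 R2 R1, Mat R4 R2 R1, Mat R4 R2 R5)]]),
    ([R0, R0, R0, R0, R0, R0, R1, R2, R4],
     [(R1, R1, R4), (R1, R2, R2), (R1, R4, R1)],
     [([Swap23], Mat R2 R4 R1, Mat R2 R4 R1, Mat R4 R1 R2)],
     [[(Mat R2 R4 R1, Mat R1 R2 R4, Mat R1 R2 R4),
       (Mat R6 R2 R1, Mat R1 R2 R4, Mat R1 R2 R4)],
      [(Mat R4 R6 R1, Mat R1 R2 R4, Mat R1 R2 R4)],
      [(Mat R4 R2 R3, Mat R1 R2 R4, Mat R1 R2 R4),
       (Mat R4 R2 R5, Mat R1 R2 R4, Mat R1 R2 R4),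
       (Mat R4 R2 R7, Mat R1 R2 R4, Mat R1 R2 R4)],
      [(Mat R4 R2 R1, Mat R1 R2 R4, Mat R1 R2 R4),
       (Mat R4 R2 R1, Mat R2 R1 R4, Mat R1 R4 R2),
       (Mat R4 R2 R1, Mat R3 R1 R4, Mat R1 R6 R2),
       (Mat R4 R2 R1, Mat R5 R1 R2, Mat R2 R5 R1),
       (Mat R4 R2 R1, Mat R6 R1 R2, Mat R3 R4 R1),
       (Mat R4 R2 R1, Mat R7 R1 R2, Mat R3 R5 R1)],
      [(Mat R4 R2 R1, Mat R4 R1 R2, Mat R2 R4 R1),
       (Mat R4 R2 R1, Mat R4 R3 R1, Mat R6 R2 R1),
       (Mat R4 R2 R1, Mat R4 R5 R2, Mat R2 R4 R5),
       (Mat R4 R2 R1, Mat R4 R6 R1, Mat R4 R2 R3),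
       (Mat R4 R2 R1, Mat R4 R7 R1, Mat R6 R2 R3)],
      [(Mat R4 R2 R1, Mat R4 R2 R3, Mat R4 R6 R1),
       (Mat R4 R2 R1, Mat R4 R2 R5, Mat R4 R2 R5),
       (Mat R4 R2 R1, Mat R4 R2 R7, Mat R4 R6 R5)]]),
    ([R0, R0, R0, R0, R1, R2, R0, R2, R3],
     [(R1, R1, R1), (R2, R2, R3), (R3, R3, R2)],
     [([Swap12], Mat R4 R2 R1, Mat R4 R2 R1, Mat R4 R2 R1),
      ([Swap23], Mat R4 R2 R1, Mat R4 R1 R2, Mat R4 R1 R2)],
     [[],
      [(Mat R4 R1 R2, Mat R4 R1 R2, Mat R4 R3 R1),
       (Mat R4 R3 R1, Mat R4 R1 R2, Mat R4 R2 R3),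
       (Mat R4 R5 R2, Mat R4 R1 R2, Mat R4 R3 R1),
       (Mat R4 R6 R1, Mat R4 R2 R1, Mat R4 R2 R1),
       (Mat R4 R7 R1, Mat R4 R1 R2, Mat R4 R2 R3)],
      [(Mat R4 R2 R3, Mat R4 R1 R2, Mat R4 R1 R2),
       (Mat R4 R2 R5, Mat R4 R2 R1, Mat R4 R2 R1),
       (Mat R4 R2 R7, Mat R4 R1 R2, Mat R4 R1 R2)],
      [],
      [(Mat R4 R2 R1, Mat R4 R1 R3, Mat R4 R1 R3),
       (Mat R4 R2 R1, Mat R4 R3 R2, Mat R4 R3 R2),
       (Mat R4 R2 R1, Mat R4 R5 R3, Mat R4 R1 R3),
       (Mat R4 R2 R1, Mat R4 R6 R1, Mat R4 R2 R1),
       (Mat R4 R2 R1, Mat R4 R7 R2, Mat R4 R3 R2)],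
      [(Mat R4 R2 R1, Mat R4 R2 R5, Mat R4 R2 R1)],
      [],
      [(Mat R4 R2 R1, Mat R4 R2 R1, Mat R4 R6 R1)],
      [(Mat R4 R2 R1, Mat R4 R2 R1, Mat R4 R2 R5)]]),
    ([R0, R0, R0, R0, R0, R1, R0, R1, R2],
     [(R1, R1, R2), (R1, R2, R1), (R2, R1, R1)],
     [([Swap12], Mat R4 R2 R1, Mat R4 R2 R1, Mat R4 R2 R1),
      ([Swap23], Mat R4 R2 R1, Mat R4 R2 R1, Mat R4 R2 R1)],
     [[],
      [(Mat R4 R6 R1, Mat R4 R2 R1, Mat R4 R2 R1)],
      [(Mat R4 R2 R3, Mat R4 R2 R1, Mat R4 R2 R3),
       (Mat R4 R2 R5, Mat R4 R2 R1, Mat R4 R2 R1),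
       (Mat R4 R2 R7, Mat R4 R2 R1, Mat R4 R2 R3)],
      [],
      [(Mat R4 R2 R1, Mat R4 R6 R1, Mat R4 R2 R1)],
      [(Mat R4 R2 R1, Mat R4 R2 R3, Mat R4 R2 R3),
       (Mat R4 R2 R1, Mat R4 R2 R5, Mat R4 R2 R1),
       (Mat R4 R2 R1, Mat R4 R2 R7, Mat R4 R2 R3)],
      [],
      [(Mat R4 R2 R1, Mat R4 R2 R1, Mat R4 R6 R1)],
      [(Mat R4 R2 R1, Mat R4 R2 R1, Mat R4 R2 R5)]]),
    ([R0, R0, R0, R0, R1, R2, R0, R2, R4],
     [(R1, R1, R6), (R2, R2, R3), (R3, R3, R2)],
     [([Swap12], Mat R4 R1 R2, Mat R4 R1 R2, Mat R1 R2 R4)],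
     [[],
      [(Mat R4 R1 R2, Mat R4 R1 R2, Mat R1 R2 R4),
       (Mat R4 R3 R1, Mat R4 R3 R1, Mat R7 R2 R1),
       (Mat R4 R5 R2, Mat R4 R1 R2, Mat R1 R2 R4),
       (Mat R4 R6 R1, Mat R4 R2 R1, Mat R4 R2 R1),
       (Mat R4 R7 R1, Mat R4 R3 R1, Mat R7 R2 R1)],
      [(Mat R4 R2 R3, Mat R4 R2 R3, Mat R4 R2 R7),
       (Mat R4 R2 R5, Mat R4 R2 R1, Mat R4 R2 R1),
       (Mat R4 R2 R7, Mat R4 R2 R3, Mat R4 R2 R7)],
      [],
      [(Mat R4 R2 R1, Mat R4 R6 R1, Mat R4 R2 R1)],
      [(Mat R4 R2 R1, Mat R4 R2 R5, Mat R4 R2 R1)]]),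
    ([R0, R0, R0, R0, R0, R1, R0, R2, R4],
     [(R1, R1, R4), (R1, R2, R2), (R2, R1, R1)],
     [([Swap12], Mat R4 R2 R1, Mat R4 R2 R1, Mat R4 R1 R2)],
     [[],
      [(Mat R4 R6 R1, Mat R4 R2 R1, Mat R4 R2 R1)],
      [(Mat R4 R2 R3, Mat R4 R2 R1, Mat R4 R2 R5),
       (Mat R4 R2 R5, Mat R4 R2 R1, Mat R4 R2 R1),
       (Mat R4 R2 R7, Mat R4 R2 R1, Mat R4 R2 R5)],
      [],
      [(Mat R4 R2 R1, Mat R4 R6 R1, Mat R4 R2 R1)],
      [(Mat R4 R2 R1, Mat R4 R2 R3, Mat R4 R6 R1),
       (Mat R4 R2 R1, Mat R4 R2 R5, Mat R4 R2 R1),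
       (Mat R4 R2 R1, Mat R4 R2 R7, Mat R4 R6 R1)]]),
    ([R0, R0, R0, R0, R0, R1, R2, R4, R0],
     [(R1, R2, R4), (R1, R4, R2), (R2, R1, R1)],
     [([Swap23], Mat R4 R2 R1, Mat R2 R4 R1, Mat R2 R4 R1)],
     [[],
      [(Mat R4 R6 R1, Mat R2 R4 R1, Mat R2 R4 R1)],
      [(Mat R4 R2 R5, Mat R2 R4 R1, Mat R2 R4 R1)],
      [(Mat R4 R2 R1, Mat R2 R4 R1, Mat R2 R4 R1),
       (Mat R4 R2 R1, Mat R6 R2 R1, Mat R6 R2 R1)],
      [(Mat R4 R2 R1, Mat R4 R6 R1, Mat R4 R6 R1)]]),
    ([R0, R0, R0, R0, R1, R2, R4, R0, R2],
     [(R1, R4, R4), (R2, R2, R1), (R3, R1, R2)],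
     [([Swap23], Mat R4 R1 R2, Mat R1 R4 R2, Mat R2 R1 R4)],
     [[],
      [(Mat R4 R1 R2, Mat R2 R4 R1, Mat R1 R2 R4),
       (Mat R4 R3 R1, Mat R1 R2 R4, Mat R2 R4 R1),
       (Mat R4 R5 R2, Mat R2 R4 R1, Mat R1 R2 R4),
       (Mat R4 R6 R1, Mat R4 R2 R1, Mat R4 R2 R1),
       (Mat R4 R7 R1, Mat R1 R2 R4, Mat R2 R4 R1)],
      [(Mat R4 R2 R3, Mat R4 R1 R2, Mat R4 R1 R2),
       (Mat R4 R2 R5, Mat R4 R2 R1, Mat R4 R2 R1),
       (Mat R4 R2 R7, Mat R4 R1 R2, Mat R4 R1 R2)]]),
    ([R0, R0, R1, R0, R2, R0, R4, R0, R0],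
     [(R1, R4, R4), (R2, R2, R2), (R4, R1, R1)],
     [([Swap12], Mat R4 R2 R1, Mat R4 R2 R1, Mat R1 R2 R4),
      ([Swap23], Mat R1 R2 R4, Mat R1 R2 R4, Mat R1 R2 R4)],
     [[(Mat R1 R2 R4, Mat R1 R2 R4, Mat R1 R2 R4),
       (Mat R2 R1 R4, Mat R1 R4 R2, Mat R1 R4 R2)],
      [(Mat R4 R1 R2, Mat R2 R4 R1, Mat R2 R4 R1)]]),
    ([R0, R0, R0, R0, R1, R2, R1, R0, R4],
     [(R1, R1, R4), (R1, R4, R1), (R2, R1, R2), (R2, R2, R1)],
     [([Swap23], Mat R4 R1 R2, Mat R2 R4 R1, Mat R2 R4 R1)],
     [[],
      [(Mat R4 R1 R2, Mat R2 R4 R1, Mat R2 R4 R1),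
       (Mat R4 R3 R1, Mat R6 R2 R1, Mat R6 R2 R1),
       (Mat R4 R5 R2, Mat R2 R4 R1, Mat R2 R4 R1),
       (Mat R4 R6 R1, Mat R4 R2 R1, Mat R4 R2 R1),
       (Mat R4 R7 R1, Mat R6 R2 R1, Mat R6 R2 R1)],
      [(Mat R4 R2 R3, Mat R4 R6 R1, Mat R4 R6 R1),
       (Mat R4 R2 R5, Mat R4 R2 R1, Mat R4 R2 R1),
       (Mat R4 R2 R7, Mat R4 R6 R1, Mat R4 R6 R1)],
      [],
      [],
      [(Mat R4 R2 R1, Mat R4 R2 R3, Mat R4 R2 R3),
       (Mat R4 R2 R1, Mat R4 R2 R5, Mat R4 R2 R5),
       (Mat R4 R2 R1, Mat R4 R2 R7, Mat R4 R2 R7)]]),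
    ([R0, R1, R2, R1, R0, R4, R2, R6, R2],
     [(R4, R6, R7), (R5, R7, R6), (R6, R4, R5), (R7, R5, R4)],
     [([Swap12], Mat R4 R2 R1, Mat R4 R2 R1, Mat R4 R6 R1),
      ([Swap23], Mat R4 R2 R5, Mat R4 R2 R1, Mat R4 R2 R1)],
     [[],
      [(Mat R4 R1 R2, Mat R4 R5 R6, Mat R4 R1 R2),
       (Mat R4 R3 R1, Mat R4 R3 R1, Mat R4 R7 R1),
       (Mat R4 R5 R2, Mat R4 R1 R6, Mat R4 R5 R2),
       (Mat R4 R6 R1, Mat R4 R6 R1, Mat R4 R6 R1),
       (Mat R4 R7 R1, Mat R4 R7 R1, Mat R4 R3 R1)],
      [(Mat R4 R2 R3, Mat R4 R2 R7, Mat R4 R2 R7),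
       (Mat R4 R2 R5, Mat R4 R2 R5, Mat R4 R2 R5),
       (Mat R4 R2 R7, Mat R4 R2 R3, Mat R4 R2 R3)]]),
    ([R0, R0, R0, R0, R0, R1, R1, R2, R4],
     [(R1, R1, R4), (R1, R2, R2), (R1, R4, R1), (R2, R1, R1)],
     [([Swap23], Mat R4 R2 R1, Mat R4 R2 R1, Mat R4 R2 R1)],
     [[],
      [(Mat R4 R6 R1, Mat R4 R2 R1, Mat R4 R2 R1)],
      [(Mat R4 R2 R3, Mat R4 R2 R1, Mat R4 R2 R5),
       (Mat R4 R2 R5, Mat R4 R2 R1, Mat R4 R2 R1),
       (Mat R4 R2 R7, Mat R4 R2 R1, Mat R4 R2 R5)],
      [],
      [(Mat R4 R2 R1, Mat R4 R6 R1, Mat R4 R2 R3)],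
      [(Mat R4 R2 R1, Mat R4 R2 R3, Mat R4 R6 R1),
       (Mat R4 R2 R1, Mat R4 R2 R5, Mat R4 R2 R5),
       (Mat R4 R2 R1, Mat R4 R2 R7, Mat R4 R6 R5)]]),
    ([R0, R0, R1, R2, R4, R0, R4, R6, R0],
     [(R1, R2, R2), (R2, R4, R6), (R3, R6, R4), (R4, R1, R1)],
     [([Swap12], Mat R1 R4 R2, Mat R2 R1 R4, Mat R4 R2 R1),
      ([Swap23], Mat R4 R2 R1, Mat R2 R4 R1, Mat R2 R4 R1)],
     [[],
      [(Mat R4 R1 R2, Mat R2 R4 R1, Mat R6 R2 R1),
       (Mat R4 R3 R1, Mat R2 R4 R1, Mat R4 R6 R1)],
      [(Mat R4 R2 R3, Mat R2 R4 R1, Mat R2 R4 R1)],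
      [(Mat R4 R2 R1, Mat R2 R6 R1, Mat R2 R6 R1),
       (Mat R4 R2 R1, Mat R6 R4 R1, Mat R6 R4 R1)]]),
    ([R0, R0, R0, R0, R1, R2, R1, R2, R4],
     [(R1, R1, R4), (R1, R6, R1), (R2, R3, R2), (R3, R2, R3)],
     [([Swap23], Mat R4 R2 R1, Mat R4 R2 R1, Mat R4 R2 R1)],
     [[],
      [(Mat R4 R6 R1, Mat R4 R2 R1, Mat R4 R2 R1)],
      [(Mat R4 R2 R3, Mat R4 R6 R1, Mat R4 R6 R1),
       (Mat R4 R2 R5, Mat R4 R2 R1, Mat R4 R2 R1),
       (Mat R4 R2 R7, Mat R4 R6 R1, Mat R4 R6 R1)],
      [],
      [(Mat R4 R2 R1, Mat R4 R6 R3, Mat R4 R6 R7)],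
      [(Mat R4 R2 R1, Mat R4 R2 R5, Mat R4 R2 R5)]]),
    ([R0, R0, R0, R0, R1, R2, R4, R2, R3],
     [(R1, R1, R1), (R1, R4, R4), (R2, R2, R3), (R3, R3, R2)],
     [([Swap23], Mat R4 R2 R1, Mat R4 R1 R2, Mat R4 R1 R2)],
     [[],
      [(Mat R4 R6 R1, Mat R4 R2 R1, Mat R4 R2 R1)],
      [(Mat R4 R2 R3, Mat R4 R1 R2, Mat R4 R1 R2),
       (Mat R4 R2 R5, Mat R4 R2 R1, Mat R4 R2 R1),
       (Mat R4 R2 R7, Mat R4 R1 R2, Mat R4 R1 R2)],
      [],
      [(Mat R4 R2 R1, Mat R4 R1 R3, Mat R4 R1 R3),
       (Mat R4 R2 R1, Mat R4 R3 R2, Mat R4 R3 R2)]]),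
    ([R0, R0, R1, R0, R1, R2, R4, R0, R0],
     [(R1, R4, R4), (R2, R1, R2), (R2, R2, R1), (R4, R1, R1)],
     [([Swap12], Mat R2 R1 R4, Mat R1 R4 R2, Mat R4 R2 R1),
      ([Swap23], Mat R4 R2 R1, Mat R4 R2 R1, Mat R4 R2 R1)],
     [[],
      [(Mat R4 R6 R1, Mat R4 R2 R1, Mat R4 R2 R3)],
      [],
      [],
      [],
      [(Mat R4 R2 R1, Mat R4 R2 R3, Mat R4 R2 R3)]]),
    ([R0, R0, R0, R0, R1, R2, R1, R4, R0],
     [(R1, R2, R4), (R1, R4, R1), (R2, R1, R2), (R2, R2, R1)],
     [([Swap23], Mat R4 R2 R1, Mat R4 R1 R2, Mat R4 R1 R2)],
     [[],
      [(Mat R4 R6 R1, Mat R4 R2 R1, Mat R4 R2 R1)],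
      [(Mat R4 R2 R5, Mat R4 R2 R1, Mat R4 R2 R1)],
      [],
      [(Mat R4 R2 R1, Mat R4 R6 R1, Mat R4 R2 R5)]]),
    ([R0, R0, R1, R0, R0, R2, R1, R4, R0],
     [(R1, R2, R4), (R1, R4, R1), (R2, R1, R2), (R4, R1, R1)],
     [([Swap12], Mat R4 R2 R1, Mat R4 R2 R1, Mat R2 R4 R1)],
     [[],
      [(Mat R4 R6 R1, Mat R4 R2 R1, Mat R4 R2 R3)],
      [(Mat R4 R2 R5, Mat R4 R2 R5, Mat R4 R2 R1)],
      [],
      [(Mat R4 R2 R1, Mat R4 R6 R1, Mat R4 R2 R5)]]),
    ([R0, R0, R1, R0, R2, R0, R3, R4, R4],
     [(R1, R3, R4), (R1, R4, R3), (R2, R2, R2), (R4, R1, R1)],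
     [([Swap23], Mat R2 R4 R1, Mat R4 R1 R2, Mat R4 R1 R2)],
     [[(Mat R2 R4 R1, Mat R4 R1 R2, Mat R4 R1 R2)],
      [],
      [(Mat R4 R2 R7, Mat R4 R2 R5, Mat R4 R6 R1)],
      [],
      [(Mat R4 R2 R1, Mat R4 R6 R5, Mat R4 R6 R5)]]),
    ([R0, R0, R1, R2, R4, R0, R4, R6, R2],
     [(R1, R3, R2), (R2, R4, R6), (R3, R6, R4), (R4, R1, R1)],
     [([Swap12, Swap23, Swap12], Mat R1 R4 R2, Mat R4 R6 R1, Mat R2 R1 R4)],
     [[],
      [(Mat R4 R1 R2, Mat R2 R4 R7, Mat R6 R2 R1),
       (Mat R4 R3 R1, Mat R6 R2 R3, Mat R2 R4 R1)],
      [(Mat R4 R2 R3, Mat R4 R6 R1, Mat R4 R6 R1)]]),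
    ([R0, R0, R1, R2, R4, R0, R4, R7, R2],
     [(R1, R3, R3), (R2, R4, R6), (R3, R6, R4), (R5, R1, R1)],
     [([Swap23], Mat R4 R2 R3, Mat R4 R2 R1, Mat R4 R2 R1)],
     [[],
      [(Mat R4 R5 R6, Mat R2 R4 R7, Mat R6 R2 R3),
       (Mat R4 R7 R1, Mat R6 R2 R3, Mat R2 R4 R7)],
      [(Mat R4 R2 R3, Mat R4 R6 R1, Mat R4 R6 R1)]]),
    ([R0, R0, R1, R0, R1, R2, R4, R0, R2],
     [(R1, R4, R4), (R2, R2, R1), (R3, R1, R2), (R4, R1, R1)],
     [([Swap23], Mat R4 R2 R3, Mat R4 R2 R1, Mat R4 R2 R1)],
     [[],
      [(Mat R4 R6 R1, Mat R4 R2 R3, Mat R4 R2 R1)],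
      [(Mat R4 R2 R5, Mat R4 R2 R3, Mat R4 R2 R3)]]),
    ([R0, R0, R1, R0, R2, R0, R4, R0, R2],
     [(R1, R1, R2), (R1, R4, R4), (R2, R2, R2), (R4, R1, R1)],
     [([Swap12], Mat R4 R2 R1, Mat R4 R2 R1, Mat R1 R2 R4),
      ([Swap23], Mat R2 R4 R1, Mat R4 R1 R2, Mat R4 R1 R2)],
     []),
    ([R0, R0, R1, R0, R2, R4, R4, R1, R0],
     [(R1, R7, R4), (R2, R2, R7), (R3, R3, R5), (R7, R1, R1)],
     [([Swap12], Mat R4 R2 R1, Mat R4 R2 R1, Mat R1 R2 R4),
      ([Swap23], Mat R4 R1 R2, Mat R2 R4 R1, Mat R2 R4 R1)],
     []),
    ([R0, R0, R1, R0, R1, R2, R4, R2, R0],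
     [(R1, R4, R4), (R2, R3, R3), (R3, R2, R2), (R6, R1, R1)],
     [([Swap23], Mat R4 R2 R1, Mat R4 R2 R1, Mat R4 R2 R1)],
     [[],
      [],
      [(Mat R4 R2 R7, Mat R4 R2 R3, Mat R4 R2 R3)]]),
    ([R0, R0, R1, R0, R2, R0, R4, R1, R2],
     [(R1, R3, R3), (R1, R4, R4), (R3, R2, R2), (R5, R1, R1)],
     [([Swap23], Mat R2 R4 R1, Mat R4 R1 R2, Mat R4 R1 R2)],
     [[(Mat R2 R4 R1, Mat R4 R1 R2, Mat R4 R1 R2)]]),
    ([R0, R0, R1, R0, R2, R4, R3, R4, R0],
     [(R1, R6, R3), (R2, R3, R5), (R3, R2, R7), (R6, R1, R1)],
     [([Swap12], Mat R4 R2 R1, Mat R4 R2 R1, Mat R4 R3 R1)],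
     [[],
      [],
      [(Mat R4 R2 R7, Mat R4 R2 R7, Mat R4 R6 R1)]]),
    ([R0, R1, R2, R1, R0, R4, R2, R4, R0],
     [(R1, R2, R3), (R4, R7, R6), (R5, R6, R7), (R6, R5, R4), (R7, R4, R5)],
     [([Swap12], Mat R1 R2 R4, Mat R1 R2 R4, Mat R1 R2 R4),
      ([Swap23], Mat R1 R2 R4, Mat R1 R2 R4, Mat R1 R2 R4)],
     [[(Mat R1 R2 R4, Mat R1 R2 R4, Mat R1 R2 R4),
       (Mat R2 R1 R4, Mat R2 R1 R4, Mat R2 R1 R4),
       (Mat R3 R1 R4, Mat R3 R1 R4, Mat R3 R1 R4),
       (Mat R5 R1 R2, Mat R5 R1 R2, Mat R5 R1 R2),
       (Mat R6 R1 R2, Mat R6 R1 R2, Mat R6 R1 R2),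
       (Mat R7 R1 R2, Mat R7 R1 R2, Mat R7 R1 R2)],
      [(Mat R4 R1 R2, Mat R4 R1 R2, Mat R4 R1 R2),
       (Mat R4 R3 R1, Mat R4 R3 R1, Mat R4 R3 R1),
       (Mat R4 R5 R2, Mat R4 R5 R2, Mat R4 R5 R2),
       (Mat R4 R6 R1, Mat R4 R6 R1, Mat R4 R6 R1),
       (Mat R4 R7 R1, Mat R4 R7 R1, Mat R4 R7 R1)],
      [(Mat R4 R2 R3, Mat R4 R2 R3, Mat R4 R2 R3),
       (Mat R4 R2 R5, Mat R4 R2 R5, Mat R4 R2 R5),
       (Mat R4 R2 R7, Mat R4 R2 R7, Mat R4 R2 R7)]]),
    ([R0, R0, R1, R0, R0, R2, R1, R2, R4],
     [(R1, R1, R4), (R1, R2, R2), (R1, R4, R1), (R2, R1, R2), (R4, R1, R1)],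
     [([Swap12], Mat R2 R4 R1, Mat R2 R4 R1, Mat R4 R1 R2)],
     [[(Mat R2 R4 R1, Mat R2 R4 R1, Mat R4 R1 R2),
       (Mat R6 R2 R1, Mat R6 R2 R1, Mat R4 R3 R1)],
      [(Mat R4 R6 R1, Mat R4 R6 R1, Mat R4 R2 R3)],
      [(Mat R4 R2 R3, Mat R4 R2 R1, Mat R4 R6 R1),
       (Mat R4 R2 R5, Mat R4 R2 R1, Mat R4 R2 R5),
       (Mat R4 R2 R7, Mat R4 R2 R1, Mat R4 R6 R5)],
      [],
      [],
      [(Mat R4 R2 R1, Mat R4 R2 R3, Mat R4 R6 R1),
       (Mat R4 R2 R1, Mat R4 R2 R5, Mat R4 R2 R5),
       (Mat R4 R2 R1, Mat R4 R2 R7, Mat R4 R6 R5)]]),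
    ([R0, R0, R1, R0, R1, R2, R1, R2, R4],
     [(R1, R1, R4), (R1, R4, R1), (R2, R3, R3), (R3, R2, R2), (R6, R1, R1)],
     [([Swap12], Mat R4 R2 R1, Mat R4 R2 R1, Mat R4 R2 R1),
      ([Swap23], Mat R4 R2 R1, Mat R4 R2 R1, Mat R4 R2 R1)],
     [[],
      [(Mat R4 R6 R1, Mat R4 R2 R3, Mat R4 R6 R1)],
      [(Mat R4 R2 R3, Mat R4 R6 R1, Mat R4 R6 R1),
       (Mat R4 R2 R5, Mat R4 R2 R1, Mat R4 R2 R5),
       (Mat R4 R2 R7, Mat R4 R2 R3, Mat R4 R2 R3)],
      [],
      [(Mat R4 R2 R1, Mat R4 R6 R3, Mat R4 R6 R7)],
      [(Mat R4 R2 R1, Mat R4 R2 R5, Mat R4 R2 R5)]]),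
    ([R0, R0, R0, R1, R2, R4, R2, R4, R3],
     [(R1, R1, R1), (R1, R2, R6), (R2, R1, R5), (R2, R5, R3), (R3, R7, R2)],
     [([Swap23], Mat R4 R2 R1, Mat R1 R4 R2, Mat R2 R1 R4)],
     [[],
      [(Mat R4 R1 R3, Mat R4 R1 R3, Mat R4 R5 R3),
       (Mat R4 R3 R2, Mat R1 R5 R6, Mat R3 R5 R2),
       (Mat R4 R5 R3, Mat R4 R1 R3, Mat R4 R5 R3),
       (Mat R4 R6 R1, Mat R4 R2 R1, Mat R4 R2 R1),
       (Mat R4 R7 R2, Mat R1 R5 R6, Mat R3 R5 R2)],
      [(Mat R4 R2 R5, Mat R4 R2 R1, Mat R4 R2 R1)],
      [(Mat R4 R2 R1, Mat R1 R6 R3, Mat R3 R1 R7),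
       (Mat R4 R2 R1, Mat R2 R1 R6, Mat R1 R4 R3),
       (Mat R4 R2 R1, Mat R3 R7 R5, Mat R6 R7 R5),
       (Mat R4 R2 R1, Mat R5 R4 R2, Mat R2 R5 R4),
       (Mat R4 R2 R1, Mat R6 R3 R7, Mat R7 R3 R6),
       (Mat R4 R2 R1, Mat R7 R5 R4, Mat R5 R6 R2)]]),
    ([R0, R1, R2, R1, R0, R4, R2, R6, R3],
     [(R1, R1, R1), (R4, R6, R7), (R5, R7, R6), (R6, R4, R5), (R7, R5, R4)],
     [([Swap12], Mat R4 R2 R1, Mat R4 R2 R1, Mat R4 R6 R1),
      ([Swap23], Mat R4 R2 R5, Mat R4 R2 R1, Mat R4 R2 R1)],
     [[],
      [(Mat R4 R6 R1, Mat R4 R6 R1, Mat R4 R6 R1)],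
      [(Mat R4 R2 R3, Mat R4 R2 R7, Mat R4 R2 R7),
       (Mat R4 R2 R5, Mat R4 R2 R5, Mat R4 R2 R5),
       (Mat R4 R2 R7, Mat R4 R2 R3, Mat R4 R2 R3)]]),
    ([R0, R1, R2, R1, R0, R4, R2, R4, R2],
     [(R1, R2, R2), (R4, R6, R7), (R5, R7, R6), (R6, R4, R5), (R7, R5, R4)],
     [([Swap12], Mat R4 R2 R1, Mat R4 R2 R1, Mat R4 R2 R1),
      ([Swap23], Mat R4 R2 R5, Mat R4 R2 R1, Mat R4 R2 R1)],
     [[],
      [(Mat R4 R6 R1, Mat R4 R6 R1, Mat R4 R6 R1)],
      [(Mat R4 R2 R5, Mat R4 R2 R5, Mat R4 R2 R5)]]),
    ([R0, R1, R2, R1, R0, R4, R4, R6, R0],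
     [(R1, R2, R2), (R2, R7, R5), (R3, R6, R4), (R4, R1, R3), (R6, R3, R1)],
     [([Swap12], Mat R2 R4 R1, Mat R2 R4 R1, Mat R6 R2 R1),
      ([Swap23], Mat R2 R4 R1, Mat R2 R4 R1, Mat R2 R4 R1)],
     [[(Mat R2 R6 R1, Mat R2 R6 R1, Mat R2 R6 R1),
       (Mat R6 R4 R1, Mat R6 R4 R1, Mat R6 R4 R1)]]),
    ([R0, R1, R2, R1, R0, R4, R4, R6, R1],
     [(R1, R2, R3), (R2, R7, R5), (R3, R6, R4), (R4, R1, R3), (R7, R3, R1)],
     [([Swap12], Mat R2 R4 R1, Mat R2 R4 R1, Mat R6 R2 R1),
      ([Swap23], Mat R2 R4 R1, Mat R2 R4 R1, Mat R2 R4 R1)],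
     [[(Mat R2 R6 R1, Mat R2 R6 R1, Mat R2 R6 R1),
       (Mat R6 R4 R1, Mat R6 R4 R1, Mat R6 R4 R1)]]),
    ([R0, R0, R1, R0, R1, R2, R1, R4, R0],
     [(R1, R2, R4), (R1, R4, R1), (R2, R1, R2), (R2, R2, R1), (R4, R1, R1)],
     [([Swap12], Mat R4 R2 R1, Mat R4 R2 R1, Mat R2 R4 R1)],
     [[],
      [(Mat R4 R6 R1, Mat R4 R2 R1, Mat R4 R2 R3)],
      [(Mat R4 R2 R5, Mat R4 R2 R5, Mat R4 R2 R1)],
      [],
      [(Mat R4 R2 R1, Mat R4 R6 R1, Mat R4 R2 R5)]]),
    ([R0, R0, R1, R0, R2, R4, R1, R4, R6],
     [(R1, R1, R2), (R1, R4, R1), (R2, R2, R6), (R3, R3, R4), (R4, R1, R1)],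
     [([Swap12], Mat R4 R2 R1, Mat R4 R2 R1, Mat R4 R2 R1)],
     [[],
      [(Mat R4 R6 R5, Mat R4 R6 R1, Mat R4 R2 R5)],
      [(Mat R4 R2 R3, Mat R4 R2 R3, Mat R4 R6 R1),
       (Mat R4 R2 R5, Mat R4 R2 R5, Mat R4 R2 R1),
       (Mat R4 R2 R7, Mat R4 R2 R7, Mat R4 R6 R1)]]),
    ([R0, R1, R2, R1, R0, R4, R2, R6, R4],
     [(R1, R1, R6), (R4, R6, R7), (R5, R7, R6), (R6, R4, R5), (R7, R5, R4)],
     [([Swap12], Mat R4 R6 R1, Mat R4 R6 R1, Mat R4 R2 R1),
      ([Swap23], Mat R4 R2 R3, Mat R4 R2 R1, Mat R4 R2 R1)],
     [[],
      [],
      [(Mat R4 R2 R3, Mat R4 R2 R7, Mat R4 R2 R7)]]),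
    ([R0, R1, R2, R1, R2, R4, R4, R4, R1],
     [(R1, R1, R5), (R2, R6, R5), (R3, R7, R4), (R4, R3, R2), (R6, R2, R3)],
     [([Swap12], Mat R6 R1 R4, Mat R1 R5 R2, Mat R4 R2 R3),
      ([Swap23], Mat R4 R6 R1, Mat R4 R6 R1, Mat R4 R6 R1)],
     [[],
      [(Mat R4 R6 R1, Mat R4 R2 R7, Mat R4 R2 R3)]]),
    ([R0, R1, R2, R1, R2, R4, R4, R4, R5],
     [(R1, R1, R1), (R2, R6, R5), (R3, R7, R4), (R4, R3, R2), (R6, R2, R3)],
     [([Swap12], Mat R6 R3 R4, Mat R1 R5 R7, Mat R4 R2 R1),
      ([Swap23], Mat R4 R6 R1, Mat R4 R6 R5, Mat R4 R6 R5)],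
     [[],
      [(Mat R4 R6 R1, Mat R4 R2 R7, Mat R4 R2 R3)]]),
    ([R0, R0, R1, R0, R1, R2, R2, R4, R0],
     [(R1, R2, R4), (R1, R4, R2), (R2, R1, R2), (R2, R2, R1), (R4, R1, R1)],
     [([Swap23], Mat R4 R2 R1, Mat R4 R2 R1, Mat R4 R2 R1)],
     [[],
      [],
      [(Mat R4 R2 R3, Mat R4 R2 R5, Mat R4 R2 R5)],
      [],
      [(Mat R4 R2 R1, Mat R4 R6 R1, Mat R4 R6 R1)]]),
    ([R0, R0, R1, R2, R4, R0, R4, R7, R4],
     [(R1, R1, R4), (R1, R2, R3), (R2, R4, R6), (R3, R6, R4), (R4, R1, R1)],
     [([Swap23], Mat R4 R2 R1, Mat R2 R4 R1, Mat R2 R4 R1)],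
     [[],
      [(Mat R4 R1 R7, Mat R2 R6 R5, Mat R6 R4 R3),
       (Mat R4 R7 R2, Mat R6 R4 R7, Mat R2 R6 R7)]]),
    ([R0, R1, R2, R1, R2, R4, R2, R4, R4],
     [(R1, R4, R6), (R2, R6, R5), (R3, R7, R4), (R4, R3, R2), (R6, R2, R3)],
     [([Swap12], Mat R4 R2 R1, Mat R4 R2 R1, Mat R4 R2 R1),
      ([Swap23], Mat R4 R2 R1, Mat R4 R6 R7, Mat R4 R6 R3)],
     []),
    ([R0, R1, R2, R1, R2, R4, R4, R0, R2],
     [(R1, R4, R5), (R2, R1, R4), (R3, R6, R1), (R5, R3, R2), (R7, R2, R3)],
     [([Swap23], Mat R1 R2 R4, Mat R1 R4 R2, Mat R2 R1 R4)],
     [[(Mat R1 R2 R5, Mat R2 R1 R4, Mat R1 R4 R2),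
       (Mat R5 R2 R4, Mat R1 R4 R2, Mat R2 R1 R4)]]),
    ([R0, R1, R2, R1, R2, R4, R4, R0, R3],
     [(R1, R3, R5), (R2, R6, R5), (R3, R7, R4), (R5, R3, R2), (R7, R2, R3)],
     [([Swap12], Mat R7 R6 R2, Mat R3 R1 R6, Mat R3 R5 R1),
      ([Swap23], Mat R4 R2 R5, Mat R4 R2 R1, Mat R4 R2 R1)],
     []),
    ([R0, R1, R2, R1, R2, R4, R4, R4, R2],
     [(R1, R1, R6), (R2, R6, R5), (R3, R7, R4), (R4, R3, R2), (R6, R2, R3)],
     [([Swap23], Mat R5 R2 R1, Mat R2 R3 R4, Mat R1 R4 R6)],
     [[(Mat R1 R6 R5, Mat R6 R7 R4, Mat R1 R4 R2),
       (Mat R5 R7 R4, Mat R1 R5 R6, Mat R2 R1 R4)]]),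
    ([R0, R1, R2, R1, R2, R4, R4, R4, R6],
     [(R1, R1, R2), (R2, R6, R5), (R3, R7, R4), (R4, R3, R2), (R6, R2, R3)],
     [([Swap12], Mat R5 R2 R1, Mat R5 R2 R1, Mat R5 R2 R1),
      ([Swap23], Mat R4 R6 R5, Mat R4 R6 R5, Mat R4 R6 R5)],
     []),
    ([R0, R0, R1, R1, R2, R4, R4, R1, R2],
     [(R1, R3, R3), (R2, R5, R5), (R3, R2, R2), (R3, R4, R4), (R7, R1, R1)],
     [([Swap23], Mat R4 R1 R2, Mat R2 R4 R1, Mat R2 R4 R1)],
     [[],
      [(Mat R4 R1 R2, Mat R2 R4 R1, Mat R2 R4 R1)]]),
    ([R0, R0, R1, R0, R2, R4, R4, R1, R2],
     [(R1, R1, R2), (R1, R7, R4), (R2, R2, R7), (R3, R3, R5), (R7, R1, R1)],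
     [([Swap12], Mat R4 R2 R1, Mat R4 R2 R1, Mat R1 R2 R4)],
     []),
    ([R0, R0, R1, R1, R2, R4, R2, R4, R0],
     [(R1, R2, R6), (R2, R1, R4), (R2, R4, R3), (R3, R6, R2), (R4, R1, R1)],
     [([Swap23], Mat R4 R2 R1, Mat R4 R2 R1, Mat R4 R2 R1)],
     []),
    ([R1, R2, R4, R2, R4, R3, R4, R3, R6],
     [(R1, R1, R1), (R2, R2, R5), (R3, R3, R3), (R4, R4, R7), (R5, R5, R4), (R6, R6, R2)],
     [([Swap12], Mat R4 R2 R1, Mat R4 R2 R1, Mat R4 R2 R1),
      ([Swap23], Mat R4 R2 R1, Mat R1 R4 R2, Mat R2 R1 R4)],
     [[(Mat R1 R6 R3, Mat R5 R4 R2, Mat R1 R4 R3),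
       (Mat R2 R1 R6, Mat R4 R2 R1, Mat R1 R4 R3),
       (Mat R3 R5 R2, Mat R3 R5 R2, Mat R4 R5 R3),
       (Mat R5 R4 R2, Mat R2 R1 R6, Mat R4 R2 R1),
       (Mat R6 R4 R3, Mat R1 R5 R6, Mat R3 R5 R2),
       (Mat R7 R4 R1, Mat R1 R3 R5, Mat R2 R6 R1)],
      [(Mat R4 R1 R3, Mat R4 R1 R3, Mat R2 R6 R1),
       (Mat R4 R3 R2, Mat R4 R3 R2, Mat R6 R4 R1)],
      [],
      [(Mat R4 R2 R1, Mat R1 R6 R3, Mat R3 R1 R7),
       (Mat R4 R2 R1, Mat R2 R1 R6, Mat R1 R4 R3),
       (Mat R4 R2 R1, Mat R3 R7 R5, Mat R6 R7 R5),
       (Mat R4 R2 R1, Mat R5 R4 R2, Mat R2 R5 R4),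
       (Mat R4 R2 R1, Mat R6 R3 R7, Mat R7 R3 R6),
       (Mat R4 R2 R1, Mat R7 R5 R4, Mat R5 R6 R2)]]),
    ([R0, R1, R2, R1, R0, R4, R2, R4, R1],
     [(R1, R1, R1), (R1, R2, R3), (R4, R7, R6), (R5, R6, R7), (R6, R5, R4), (R7, R4, R5)],
     [([Swap12], Mat R2 R4 R1, Mat R2 R4 R1, Mat R2 R4 R1),
      ([Swap23], Mat R2 R4 R1, Mat R2 R4 R1, Mat R2 R4 R1)],
     [[(Mat R2 R4 R1, Mat R2 R4 R1, Mat R2 R4 R1),
       (Mat R6 R2 R1, Mat R6 R2 R1, Mat R6 R2 R1)],
      [(Mat R4 R6 R1, Mat R4 R6 R1, Mat R4 R6 R1)],
      [(Mat R4 R2 R3, Mat R4 R2 R3, Mat R4 R2 R3),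
       (Mat R4 R2 R5, Mat R4 R2 R5, Mat R4 R2 R5),
       (Mat R4 R2 R7, Mat R4 R2 R7, Mat R4 R2 R7)]]),
    ([R0, R1, R2, R1, R2, R4, R2, R4, R3],
     [(R1, R1, R1), (R1, R4, R7), (R2, R7, R4), (R3, R6, R5), (R5, R3, R2), (R7, R2, R3)],
     [([Swap12], Mat R4 R2 R1, Mat R4 R2 R1, Mat R4 R2 R1),
      ([Swap23], Mat R4 R2 R5, Mat R4 R2 R1, Mat R4 R2 R1)],
     [[],
      [(Mat R4 R1 R3, Mat R4 R1 R3, Mat R4 R5 R3),
       (Mat R4 R3 R2, Mat R4 R3 R2, Mat R4 R7 R6),
       (Mat R4 R5 R3, Mat R4 R5 R3, Mat R4 R1 R3),
       (Mat R4 R6 R1, Mat R4 R6 R1, Mat R4 R6 R1),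
       (Mat R4 R7 R2, Mat R4 R7 R2, Mat R4 R3 R6)],
      [(Mat R4 R2 R5, Mat R4 R2 R5, Mat R4 R2 R5)]])]"

text \<open>
  For a form \<open>F\<close>: first moves that fix \<open>F\<close> and reduce the simple tensors \<open>T\<close>; then moves that take
  \<open>F + T\<close> to a form for the remaining \<open>T\<close>.
\<close>

definition neighbour_moves :: "(row list \<times> move list \<times> move list) list" where
  "neighbour_moves = [
    ([R0, R0, R0, R0, R0, R0, R0, R0, R0],
     [([], Mat R1 R5 R2, Mat R4 R2 R1, Mat R4 R2 R1),
      ([], Mat R4 R2 R1, Mat R1 R5 R2, Mat R4 R2 R1),
      ([], Mat R4 R2 R1, Mat R4 R2 R1, Mat R1 R5 R2),
      ([], Mat R3 R1 R4, Mat R4 R2 R1, Mat R4 R2 R1),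
      ([], Mat R4 R2 R1, Mat R4 R2 R1, Mat R3 R1 R4),
      ([], Mat R4 R2 R1, Mat R3 R1 R4, Mat R4 R2 R1)],
     [([], Mat R2 R4 R1, Mat R4 R2 R1, Mat R4 R2 R1)]),
    ([R0, R0, R0, R0, R0, R0, R0, R0, R1],
     [([], Mat R4 R2 R5, Mat R4 R6 R3, Mat R2 R6 R3),
      ([Swap12, Swap23], Mat R4 R2 R5, Mat R4 R6 R5, Mat R4 R2 R3),
      ([Swap23], Mat R4 R2 R3, Mat R4 R2 R1, Mat R4 R2 R1),
      ([Swap12], Mat R2 R4 R3, Mat R4 R2 R1, Mat R4 R2 R3),
      ([], Mat R2 R4 R1, Mat R4 R2 R3, Mat R4 R2 R1)],
     [([], Mat R1 R2 R4, Mat R4 R2 R1, Mat R4 R2 R1),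
      ([], Mat R2 R4 R1, Mat R4 R2 R1, Mat R4 R3 R1),
      ([], Mat R2 R4 R1, Mat R4 R1 R6, Mat R4 R2 R1),
      ([], Mat R4 R1 R2, Mat R4 R2 R1, Mat R4 R2 R1)]),
    ([R0, R0, R0, R0, R0, R0, R0, R1, R2],
     [([], Mat R4 R6 R3, Mat R4 R1 R3, Mat R4 R1 R3),
      ([], Mat R4 R6 R3, Mat R4 R6 R3, Mat R4 R2 R7),
      ([Swap23], Mat R2 R6 R1, Mat R4 R1 R2, Mat R4 R5 R2),
      ([], Mat R4 R6 R3, Mat R4 R2 R7, Mat R4 R2 R3),
      ([], Mat R4 R2 R3, Mat R4 R2 R1, Mat R4 R6 R1),
      ([Swap23], Mat R4 R2 R1, Mat R4 R1 R2, Mat R4 R1 R2)],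
     [([], Mat R2 R4 R1, Mat R4 R2 R7, Mat R4 R2 R1),
      ([], Mat R2 R4 R1, Mat R1 R4 R2, Mat R4 R2 R1),
      ([], Mat R2 R4 R1, Mat R4 R2 R1, Mat R6 R2 R1),
      ([], Mat R2 R4 R1, Mat R2 R1 R4, Mat R4 R2 R1),
      ([], Mat R4 R2 R1, Mat R4 R2 R1, Mat R4 R2 R1),
      ([], Mat R4 R3 R2, Mat R4 R1 R6, Mat R4 R2 R1),
      ([], Mat R4 R2 R1, Mat R4 R2 R1, Mat R2 R1 R4),
      ([], Mat R4 R2 R1, Mat R2 R1 R4, Mat R2 R1 R4)]),
    ([R0, R0, R0, R0, R0, R1, R0, R2, R0],
     [([Swap23, Swap12], Mat R4 R2 R1, Mat R4 R1 R6, Mat R4 R2 R1),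
      ([Swap23], Mat R4 R2 R1, Mat R4 R2 R1, Mat R4 R2 R5),
      ([], Mat R4 R1 R2, Mat R4 R1 R2, Mat R4 R5 R2),
      ([], Mat R4 R2 R1, Mat R4 R6 R1, Mat R4 R2 R1),
      ([], Mat R4 R2 R1, Mat R4 R2 R1, Mat R4 R2 R5),
      ([], Mat R4 R2 R1, Mat R4 R2 R1, Mat R4 R6 R1),
      ([], Mat R4 R1 R6, Mat R4 R1 R2, Mat R4 R1 R2),
      ([], Mat R4 R5 R2, Mat R4 R1 R2, Mat R4 R1 R2)],
     [([], Mat R4 R2 R3, Mat R4 R2 R1, Mat R4 R2 R1),
      ([], Mat R4 R2 R3, Mat R4 R2 R7, Mat R4 R2 R1),
      ([], Mat R4 R2 R1, Mat R4 R2 R1, Mat R4 R2 R1),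
      ([], Mat R1 R4 R2, Mat R4 R2 R1, Mat R4 R2 R1),
      ([Swap12], Mat R2 R4 R1, Mat R4 R2 R1, Mat R4 R2 R1),
      ([], Mat R4 R2 R1, Mat R4 R2 R1, Mat R6 R2 R1),
      ([], Mat R4 R2 R1, Mat R6 R4 R1, Mat R6 R2 R1),
      ([], Mat R4 R2 R1, Mat R4 R3 R1, Mat R4 R2 R1),
      ([], Mat R4 R1 R2, Mat R4 R2 R1, Mat R1 R7 R2),
      ([], Mat R4 R3 R1, Mat R4 R1 R2, Mat R4 R2 R1),
      ([], Mat R2 R1 R4, Mat R4 R2 R1, Mat R4 R2 R1)]),
    ([R0, R0, R0, R0, R0, R0, R1, R2, R4],
     [([], Mat R4 R6 R7, Mat R4 R1 R3, Mat R2 R6 R1),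
      ([], Mat R4 R6 R3, Mat R2 R6 R5, Mat R4 R5 R7),
      ([], Mat R4 R6 R3, Mat R4 R2 R3, Mat R4 R6 R1),
      ([], Mat R2 R6 R1, Mat R2 R4 R1, Mat R4 R1 R2),
      ([Swap23], Mat R4 R2 R3, Mat R2 R1 R4, Mat R1 R4 R2)],
     [([], Mat R2 R4 R1, Mat R4 R2 R5, Mat R4 R2 R1),
      ([], Mat R2 R4 R1, Mat R1 R4 R2, Mat R4 R2 R1),
      ([], Mat R4 R2 R1, Mat R4 R2 R1, Mat R4 R2 R1),
      ([], Mat R4 R2 R3, Mat R4 R2 R1, Mat R2 R1 R4)]),
    ([R0, R0, R0, R0, R1, R2, R0, R2, R3],
     [([], Mat R4 R6 R3, Mat R4 R7 R5, Mat R4 R7 R5),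
      ([Swap23, Swap12], Mat R4 R2 R3, Mat R4 R2 R1, Mat R4 R6 R1),
      ([], Mat R4 R1 R2, Mat R4 R7 R5, Mat R4 R2 R3),
      ([Swap23], Mat R4 R2 R5, Mat R4 R1 R2, Mat R4 R1 R2),
      ([], Mat R4 R2 R3, Mat R4 R1 R2, Mat R4 R1 R2),
      ([], Mat R4 R2 R3, Mat R4 R6 R3, Mat R4 R2 R3),
      ([Swap23], Mat R4 R2 R1, Mat R4 R1 R2, Mat R4 R5 R2),
      ([], Mat R4 R2 R1, Mat R4 R2 R1, Mat R4 R2 R5),
      ([Swap12], Mat R4 R2 R1, Mat R4 R2 R1, Mat R4 R6 R1)],
     [([], Mat R4 R1 R3, Mat R4 R3 R1, Mat R4 R5 R3),
      ([], Mat R4 R3 R2, Mat R4 R3 R1, Mat R4 R3 R1),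
      ([], Mat R4 R2 R1, Mat R4 R2 R1, Mat R4 R6 R5),
      ([], Mat R4 R2 R1, Mat R4 R2 R1, Mat R4 R2 R1),
      ([], Mat R4 R2 R1, Mat R2 R1 R4, Mat R2 R1 R4)]),
    ([R0, R0, R0, R0, R0, R1, R0, R1, R2],
     [([Swap23, Swap12], Mat R4 R2 R5, Mat R4 R2 R1, Mat R4 R2 R1),
      ([Swap23], Mat R4 R6 R3, Mat R4 R2 R1, Mat R4 R2 R3),
      ([], Mat R4 R2 R3, Mat R4 R6 R3, Mat R4 R2 R1),
      ([], Mat R4 R2 R3, Mat R4 R2 R5, Mat R4 R2 R3),
      ([], Mat R4 R2 R1, Mat R4 R2 R1, Mat R4 R6 R1),
      ([], Mat R4 R2 R1, Mat R4 R2 R1, Mat R4 R2 R5),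
      ([], Mat R4 R2 R5, Mat R4 R2 R1, Mat R4 R2 R1)],
     [([], Mat R4 R2 R3, Mat R4 R2 R1, Mat R4 R2 R1),
      ([Swap12, Swap23], Mat R2 R4 R1, Mat R4 R2 R1, Mat R4 R2 R1),
      ([], Mat R4 R2 R1, Mat R4 R2 R1, Mat R6 R2 R1),
      ([], Mat R4 R2 R3, Mat R4 R2 R7, Mat R4 R2 R7),
      ([], Mat R4 R2 R3, Mat R4 R2 R1, Mat R2 R4 R7),
      ([], Mat R4 R2 R3, Mat R2 R6 R5, Mat R2 R6 R5),
      ([], Mat R4 R3 R1, Mat R4 R3 R1, Mat R4 R3 R1),
      ([], Mat R4 R1 R3, Mat R4 R3 R1, Mat R4 R2 R1),
      ([], Mat R4 R2 R1, Mat R4 R2 R1, Mat R2 R1 R4),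
      ([], Mat R4 R2 R1, Mat R2 R1 R4, Mat R2 R4 R1),
      ([], Mat R2 R1 R4, Mat R4 R2 R1, Mat R4 R2 R1)]),
    ([R0, R0, R0, R0, R1, R2, R0, R2, R4],
     [([], Mat R4 R7 R5, Mat R4 R7 R5, Mat R7 R2 R1),
      ([Swap12], Mat R4 R2 R1, Mat R4 R2 R5, Mat R4 R2 R1),
      ([], Mat R4 R6 R3, Mat R4 R2 R3, Mat R4 R2 R7),
      ([], Mat R4 R1 R6, Mat R4 R1 R2, Mat R1 R2 R4),
      ([], Mat R4 R2 R1, Mat R4 R2 R5, Mat R4 R2 R1),
      ([], Mat R4 R2 R1, Mat R4 R6 R1, Mat R4 R2 R1),
      ([Swap12], Mat R4 R1 R2, Mat R4 R1 R2, Mat R1 R2 R4)],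
     [([], Mat R4 R2 R1, Mat R4 R2 R1, Mat R4 R2 R5),
      ([], Mat R4 R2 R1, Mat R4 R2 R1, Mat R4 R6 R1),
      ([], Mat R4 R1 R2, Mat R4 R5 R3, Mat R4 R5 R3),
      ([], Mat R4 R1 R3, Mat R4 R3 R1, Mat R4 R5 R3),
      ([], Mat R4 R2 R1, Mat R4 R2 R1, Mat R4 R2 R1),
      ([], Mat R4 R2 R3, Mat R4 R2 R1, Mat R4 R6 R1),
      ([], Mat R4 R1 R2, Mat R4 R2 R1, Mat R2 R1 R4),
      ([], Mat R4 R1 R2, Mat R4 R2 R1, Mat R6 R1 R4),
      ([], Mat R4 R1 R3, Mat R4 R1 R6, Mat R1 R6 R5),
      ([], Mat R4 R2 R3, Mat R4 R3 R1, Mat R4 R7 R1),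
      ([], Mat R4 R2 R1, Mat R4 R1 R6, Mat R4 R1 R2),
      ([], Mat R4 R1 R2, Mat R5 R7 R4, Mat R1 R4 R3),
      ([], Mat R4 R1 R3, Mat R7 R5 R4, Mat R1 R4 R7),
      ([], Mat R4 R2 R1, Mat R4 R2 R5, Mat R4 R6 R5),
      ([Swap12, Swap23], Mat R4 R2 R1, Mat R4 R2 R1, Mat R4 R2 R1),
      ([Swap12, Swap23], Mat R4 R1 R2, Mat R4 R2 R1, Mat R4 R2 R1),
      ([Swap23], Mat R4 R2 R3, Mat R6 R5 R4, Mat R2 R1 R4)]),
    ([R0, R0, R0, R0, R0, R1, R0, R2, R4],
     [([Swap12], Mat R4 R6 R3, Mat R4 R2 R1, Mat R4 R1 R6),
      ([], Mat R4 R2 R3, Mat R4 R2 R5, Mat R4 R2 R5),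
      ([], Mat R4 R2 R1, Mat R4 R6 R1, Mat R4 R2 R1),
      ([], Mat R4 R6 R3, Mat R4 R2 R3, Mat R4 R6 R5),
      ([], Mat R4 R2 R1, Mat R4 R2 R5, Mat R4 R2 R1),
      ([], Mat R4 R2 R5, Mat R4 R2 R1, Mat R4 R2 R1),
      ([Swap12], Mat R4 R2 R1, Mat R4 R6 R1, Mat R4 R1 R2)],
     [([], Mat R4 R2 R3, Mat R4 R2 R1, Mat R4 R2 R1),
      ([], Mat R4 R2 R3, Mat R4 R2 R7, Mat R4 R2 R1),
      ([], Mat R4 R2 R1, Mat R4 R2 R1, Mat R4 R2 R1),
      ([], Mat R4 R2 R3, Mat R4 R2 R1, Mat R4 R2 R7),
      ([Swap12], Mat R2 R4 R1, Mat R4 R2 R1, Mat R2 R6 R1),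
      ([], Mat R4 R2 R3, Mat R4 R2 R1, Mat R2 R6 R5),
      ([], Mat R4 R2 R1, Mat R4 R2 R1, Mat R6 R2 R1),
      ([], Mat R4 R2 R1, Mat R6 R2 R1, Mat R4 R2 R1),
      ([], Mat R4 R2 R1, Mat R2 R4 R5, Mat R4 R2 R1),
      ([], Mat R4 R2 R1, Mat R4 R3 R1, Mat R6 R2 R1),
      ([], Mat R4 R2 R3, Mat R4 R2 R1, Mat R4 R7 R2),
      ([], Mat R4 R1 R2, Mat R4 R2 R1, Mat R1 R4 R2),
      ([], Mat R4 R1 R2, Mat R4 R2 R1, Mat R1 R6 R2),
      ([], Mat R4 R1 R2, Mat R4 R5 R3, Mat R7 R6 R2),
      ([], Mat R4 R2 R1, Mat R2 R5 R4, Mat R4 R2 R1),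
      ([], Mat R4 R2 R1, Mat R2 R5 R4, Mat R4 R1 R3),
      ([], Mat R4 R1 R2, Mat R4 R5 R2, Mat R1 R2 R5),
      ([], Mat R4 R1 R3, Mat R5 R4 R2, Mat R1 R2 R5),
      ([Swap23], Mat R2 R4 R1, Mat R4 R2 R1, Mat R2 R4 R1),
      ([Swap12, Swap23], Mat R4 R3 R2, Mat R4 R2 R1, Mat R4 R2 R1),
      ([], Mat R2 R4 R1, Mat R2 R4 R1, Mat R2 R4 R1)]),
    ([R0, R0, R0, R0, R0, R1, R2, R4, R0],
     [([], Mat R4 R2 R5, Mat R2 R6 R1, Mat R2 R6 R1),
      ([], Mat R4 R6 R1, Mat R4 R6 R1, Mat R4 R6 R1),
      ([Swap23], Mat R4 R2 R5, Mat R2 R4 R1, Mat R2 R4 R1),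
      ([], Mat R4 R2 R5, Mat R4 R2 R1, Mat R4 R2 R1),
      ([Swap23], Mat R4 R2 R1, Mat R4 R2 R1, Mat R4 R2 R1),
      ([], Mat R4 R6 R1, Mat R4 R2 R1, Mat R4 R2 R1)],
     [([], Mat R4 R2 R3, Mat R4 R2 R1, Mat R4 R2 R1),
      ([], Mat R4 R2 R1, Mat R4 R2 R5, Mat R4 R2 R1),
      ([], Mat R4 R2 R3, Mat R4 R2 R5, Mat R4 R2 R1),
      ([], Mat R4 R2 R1, Mat R4 R6 R1, Mat R4 R2 R1),
      ([], Mat R4 R2 R1, Mat R4 R6 R5, Mat R4 R2 R1),
      ([], Mat R4 R2 R3, Mat R4 R2 R5, Mat R4 R6 R5),
      ([], Mat R4 R2 R1, Mat R2 R6 R1, Mat R4 R2 R1),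
      ([], Mat R4 R2 R1, Mat R2 R4 R3, Mat R4 R2 R1),
      ([], Mat R2 R4 R1, Mat R1 R4 R2, Mat R1 R4 R2),
      ([], Mat R2 R4 R1, Mat R1 R4 R2, Mat R4 R2 R1),
      ([], Mat R4 R2 R1, Mat R4 R2 R1, Mat R4 R3 R1),
      ([], Mat R4 R2 R1, Mat R4 R2 R5, Mat R4 R3 R1),
      ([Swap23], Mat R4 R2 R1, Mat R1 R4 R2, Mat R4 R2 R1),
      ([], Mat R4 R2 R3, Mat R4 R2 R1, Mat R1 R4 R2),
      ([], Mat R4 R2 R1, Mat R4 R2 R1, Mat R4 R1 R2),
      ([], Mat R4 R2 R1, Mat R4 R2 R1, Mat R4 R1 R6),
      ([], Mat R4 R2 R1, Mat R4 R2 R1, Mat R4 R1 R3),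
      ([], Mat R4 R2 R1, Mat R4 R2 R5, Mat R4 R1 R7),
      ([], Mat R4 R1 R2, Mat R1 R4 R3, Mat R1 R4 R2),
      ([], Mat R4 R2 R1, Mat R4 R5 R7, Mat R4 R1 R6),
      ([], Mat R4 R3 R1, Mat R2 R1 R4, Mat R4 R2 R1),
      ([], Mat R4 R1 R2, Mat R2 R1 R4, Mat R1 R4 R2),
      ([], Mat R4 R2 R3, Mat R4 R2 R1, Mat R2 R1 R5),
      ([], Mat R4 R1 R2, Mat R2 R1 R4, Mat R1 R2 R5),
      ([], Mat R4 R1 R2, Mat R1 R3 R4, Mat R1 R2 R4),
      ([], Mat R4 R2 R1, Mat R4 R2 R3, Mat R2 R5 R4),
      ([], Mat R6 R2 R1, Mat R4 R2 R1, Mat R4 R2 R1),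
      ([], Mat R4 R6 R1, Mat R4 R2 R1, Mat R4 R1 R3),
      ([], Mat R6 R4 R1, Mat R4 R2 R1, Mat R4 R1 R3),
      ([], Mat R4 R1 R2, Mat R1 R4 R2, Mat R1 R4 R2),
      ([Swap12], Mat R4 R2 R3, Mat R2 R4 R1, Mat R1 R4 R2),
      ([], Mat R2 R4 R7, Mat R4 R6 R3, Mat R4 R2 R7),
      ([], Mat R2 R5 R4, Mat R2 R4 R1, Mat R4 R2 R1),
      ([], Mat R2 R4 R5, Mat R4 R2 R3, Mat R2 R4 R1),
      ([], Mat R4 R2 R7, Mat R4 R3 R2, Mat R2 R5 R4)]),
    ([R0, R0, R0, R0, R1, R2, R4, R0, R2],
     [([], Mat R4 R7 R2, Mat R1 R4 R2, Mat R2 R1 R4),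
      ([Swap23], Mat R4 R2 R5, Mat R4 R1 R2, Mat R4 R1 R2),
      ([], Mat R4 R1 R6, Mat R2 R4 R1, Mat R1 R2 R4),
      ([], Mat R4 R6 R3, Mat R4 R1 R2, Mat R4 R1 R2),
      ([], Mat R4 R2 R5, Mat R4 R2 R1, Mat R4 R2 R1),
      ([], Mat R4 R6 R1, Mat R4 R2 R1, Mat R4 R2 R1),
      ([Swap23], Mat R4 R2 R3, Mat R4 R2 R1, Mat R4 R2 R1),
      ([Swap23], Mat R4 R1 R3, Mat R1 R2 R4, Mat R2 R4 R1)],
     [([], Mat R4 R1 R3, Mat R2 R3 R4, Mat R3 R4 R2),
      ([], Mat R4 R1 R2, Mat R2 R1 R4, Mat R2 R1 R4),
      ([], Mat R4 R1 R2, Mat R2 R1 R4, Mat R2 R4 R1),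
      ([], Mat R4 R2 R1, Mat R4 R2 R5, Mat R4 R2 R1),
      ([], Mat R4 R1 R3, Mat R2 R7 R4, Mat R3 R4 R2),
      ([], Mat R4 R1 R2, Mat R2 R5 R4, Mat R2 R1 R4),
      ([], Mat R4 R1 R2, Mat R2 R5 R4, Mat R2 R4 R1),
      ([], Mat R4 R2 R3, Mat R4 R2 R1, Mat R4 R2 R1),
      ([], Mat R4 R2 R1, Mat R4 R6 R5, Mat R4 R2 R1),
      ([], Mat R4 R3 R2, Mat R6 R5 R4, Mat R2 R4 R1),
      ([], Mat R4 R2 R3, Mat R4 R6 R5, Mat R4 R2 R1),
      ([], Mat R4 R3 R1, Mat R4 R1 R6, Mat R4 R2 R1),
      ([], Mat R4 R1 R2, Mat R4 R2 R1, Mat R6 R1 R4),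
      ([], Mat R4 R2 R1, Mat R4 R3 R1, Mat R4 R7 R1),
      ([], Mat R4 R2 R3, Mat R4 R2 R7, Mat R4 R2 R3),
      ([], Mat R4 R2 R1, Mat R4 R3 R1, Mat R4 R7 R5),
      ([], Mat R4 R2 R1, Mat R4 R2 R1, Mat R4 R2 R1),
      ([], Mat R6 R5 R4, Mat R1 R4 R2, Mat R2 R4 R1),
      ([], Mat R4 R6 R5, Mat R4 R2 R3, Mat R4 R3 R2),
      ([Swap12], Mat R4 R2 R1, Mat R4 R2 R1, Mat R2 R1 R4),
      ([Swap12], Mat R4 R2 R7, Mat R4 R6 R5, Mat R2 R3 R6),
      ([], Mat R4 R6 R3, Mat R4 R3 R1, Mat R4 R3 R2),
      ([], Mat R4 R6 R7, Mat R4 R7 R6, Mat R7 R2 R3),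
      ([], Mat R4 R6 R3, Mat R4 R7 R1, Mat R3 R5 R7),
      ([], Mat R4 R1 R7, Mat R5 R6 R2, Mat R6 R3 R1)]),
    ([R0, R0, R1, R0, R2, R0, R4, R0, R0],
     [([Swap23], Mat R1 R4 R2, Mat R2 R1 R4, Mat R2 R1 R4),
      ([Swap23], Mat R4 R2 R1, Mat R4 R2 R1, Mat R4 R2 R1),
      ([Swap12], Mat R4 R2 R1, Mat R4 R2 R1, Mat R1 R2 R4),
      ([], Mat R2 R4 R1, Mat R4 R1 R2, Mat R4 R1 R2),
      ([Swap23], Mat R4 R1 R2, Mat R2 R4 R1, Mat R2 R4 R1),
      ([Swap12], Mat R4 R1 R2, Mat R2 R4 R1, Mat R2 R1 R4),
      ([Swap12, Swap23], Mat R4 R1 R2, Mat R2 R4 R1, Mat R2 R1 R4)],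
     [([], Mat R4 R2 R5, Mat R4 R2 R1, Mat R4 R2 R1),
      ([], Mat R4 R2 R1, Mat R4 R2 R1, Mat R4 R2 R1),
      ([], Mat R2 R5 R4, Mat R5 R4 R2, Mat R1 R4 R2),
      ([], Mat R4 R2 R5, Mat R4 R2 R5, Mat R4 R2 R1),
      ([], Mat R4 R2 R7, Mat R4 R2 R1, Mat R4 R2 R1),
      ([], Mat R4 R2 R1, Mat R4 R6 R5, Mat R4 R2 R1),
      ([], Mat R2 R4 R5, Mat R4 R5 R6, Mat R4 R1 R2),
      ([], Mat R4 R2 R7, Mat R4 R6 R5, Mat R4 R2 R1),
      ([], Mat R1 R4 R2, Mat R4 R2 R1, Mat R4 R2 R1),
      ([Swap12], Mat R4 R2 R1, Mat R1 R4 R2, Mat R1 R4 R2),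
      ([Swap12], Mat R4 R3 R2, Mat R1 R4 R2, Mat R4 R2 R1),
      ([], Mat R4 R5 R2, Mat R2 R4 R1, Mat R2 R4 R1),
      ([Swap23, Swap12], Mat R4 R1 R6, Mat R4 R2 R1, Mat R2 R4 R1),
      ([Swap12], Mat R4 R5 R6, Mat R2 R4 R1, Mat R2 R4 R1),
      ([], Mat R4 R2 R7, Mat R4 R2 R5, Mat R4 R2 R5),
      ([], Mat R4 R6 R3, Mat R4 R2 R1, Mat R4 R2 R1),
      ([], Mat R4 R6 R5, Mat R4 R6 R5, Mat R6 R2 R3),
      ([], Mat R4 R6 R3, Mat R4 R6 R1, Mat R2 R6 R7),
      ([], Mat R4 R2 R1, Mat R6 R2 R1, Mat R4 R2 R1),
      ([], Mat R4 R1 R3, Mat R4 R6 R3, Mat R4 R2 R1),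
      ([], Mat R4 R3 R5, Mat R6 R4 R1, Mat R6 R2 R1),
      ([], Mat R7 R4 R5, Mat R7 R6 R5, Mat R7 R6 R2)]),
    ([R1, R2, R4, R2, R4, R3, R4, R3, R6],
     [([Swap23, Swap12], Mat R4 R1 R3, Mat R4 R5 R7, Mat R2 R6 R5),
      ([], Mat R4 R2 R1, Mat R3 R7 R5, Mat R6 R7 R5),
      ([], Mat R4 R2 R1, Mat R7 R5 R4, Mat R5 R6 R2),
      ([Swap12], Mat R6 R4 R3, Mat R6 R4 R3, Mat R7 R2 R4),
      ([], Mat R4 R2 R1, Mat R5 R4 R2, Mat R2 R5 R4),
      ([Swap23], Mat R2 R6 R7, Mat R1 R2 R6, Mat R2 R6 R5)],
     [([], Mat R1 R4 R7, Mat R7 R6 R2, Mat R3 R5 R4),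
      ([], Mat R3 R4 R5, Mat R3 R4 R5, Mat R6 R7 R2),
      ([], Mat R5 R4 R2, Mat R5 R4 R2, Mat R2 R5 R4)]),
    ([R0, R1, R2, R1, R0, R4, R2, R4, R1],
     [([Swap23, Swap12], Mat R4 R6 R3, Mat R4 R6 R3, Mat R4 R6 R3),
      ([], Mat R4 R2 R7, Mat R4 R2 R7, Mat R4 R2 R7),
      ([Swap23], Mat R4 R6 R3, Mat R4 R6 R3, Mat R4 R6 R3),
      ([Swap12], Mat R2 R6 R1, Mat R2 R6 R1, Mat R2 R6 R1),
      ([], Mat R4 R6 R1, Mat R4 R6 R1, Mat R4 R6 R1),
      ([Swap23], Mat R2 R4 R3, Mat R2 R4 R3, Mat R2 R4 R3),
      ([Swap12], Mat R4 R2 R1, Mat R4 R2 R1, Mat R4 R2 R1),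
      ([], Mat R4 R2 R3, Mat R4 R2 R3, Mat R4 R2 R3)],
     [([], Mat R4 R2 R1, Mat R4 R2 R1, Mat R4 R2 R1),
      ([], Mat R4 R2 R7, Mat R4 R2 R7, Mat R4 R2 R7),
      ([], Mat R4 R3 R6, Mat R4 R7 R2, Mat R4 R7 R6),
      ([Swap23, Swap12], Mat R2 R4 R1, Mat R4 R2 R1, Mat R2 R1 R4),
      ([], Mat R4 R7 R5, Mat R4 R3 R5, Mat R4 R3 R1),
      ([], Mat R4 R1 R2, Mat R4 R1 R2, Mat R4 R1 R2),
      ([Swap12, Swap23], Mat R4 R5 R7, Mat R5 R4 R3, Mat R4 R7 R1),
      ([], Mat R4 R1 R7, Mat R4 R5 R7, Mat R4 R5 R3),
      ([], Mat R4 R7 R2, Mat R4 R7 R2, Mat R4 R7 R2)]),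
    ([R0, R1, R2, R1, R2, R4, R2, R4, R3],
     [([], Mat R4 R5 R3, Mat R4 R5 R3, Mat R4 R1 R3),
      ([], Mat R4 R2 R5, Mat R4 R2 R5, Mat R4 R2 R5),
      ([Swap23, Swap12], Mat R4 R2 R5, Mat R4 R2 R1, Mat R4 R2 R1),
      ([Swap23], Mat R4 R2 R5, Mat R4 R2 R1, Mat R4 R2 R1),
      ([], Mat R4 R7 R6, Mat R4 R7 R6, Mat R4 R3 R2),
      ([], Mat R4 R6 R1, Mat R4 R6 R1, Mat R4 R6 R1),
      ([Swap12], Mat R4 R7 R6, Mat R4 R7 R6, Mat R4 R3 R2),
      ([Swap12], Mat R4 R1 R3, Mat R4 R1 R3, Mat R4 R5 R3)],
     [([], Mat R4 R3 R5, Mat R4 R3 R5, Mat R4 R7 R5),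
      ([], Mat R4 R7 R5, Mat R4 R3 R5, Mat R4 R3 R1),
      ([], Mat R1 R4 R2, Mat R1 R4 R2, Mat R1 R4 R2),
      ([], Mat R4 R6 R5, Mat R4 R6 R5, Mat R4 R6 R5),
      ([Swap12, Swap23], Mat R4 R5 R2, Mat R1 R4 R2, Mat R4 R2 R5),
      ([], Mat R3 R6 R4, Mat R5 R4 R6, Mat R6 R5 R4),
      ([], Mat R5 R3 R7, Mat R3 R2 R4, Mat R7 R5 R6),
      ([], Mat R1 R6 R5, Mat R2 R1 R4, Mat R7 R4 R6),
      ([], Mat R4 R6 R1, Mat R4 R6 R1, Mat R4 R6 R1),
      ([], Mat R7 R3 R6, Mat R6 R1 R2, Mat R5 R7 R6),
      ([], Mat R3 R1 R7, Mat R5 R6 R2, Mat R6 R2 R1),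
      ([], Mat R2 R5 R6, Mat R1 R4 R2, Mat R2 R1 R4)])]"

section \<open>Executable checks of the certificates\<close>

definition known_rows :: "row list" where
  "known_rows = [R0, R1, R2, R3, R4, R5, R6, R7]"

text \<open>\<open>n\<close> counts the rows that are still open and drives the recursion. The
  segment is padded with \<open>Unknown\<close> because the action is specified for nine rows only.
  Testing for an improvement before branching prunes the whole subtree.\<close>

primrec covers :: "row list list \<Rightarrow> move list \<Rightarrow> nat \<Rightarrow> row list \<Rightarrow> bool" where
  "covers qs ms 0 p \<longleftrightarrow>
     list_ex (\<lambda>q. q = p) qs \<or> list_ex (\<lambda>m. improves m p) ms"
| "covers qs ms (Suc n) p \<longleftrightarrow>
     list_ex (\<lambda>m. improves m (p @ replicate (Suc n) Unknown)) ms \<or>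
     list_all (\<lambda>u. covers qs ms n (p @ [u])) known_rows"

definition rows_add :: "row list \<Rightarrow> row list \<Rightarrow> row list" where
  "rows_add p q = map2 row_add p q"

text \<open>With a single row that may be nonzero, \<open>comb\<close> multiplies it by one
  coordinate: the list \<open>s\<close> consists of b_1 c, b_2 c, b_3 c, and the same device
  multiplies it by the coordinates of a.\<close>

fun outer_rows :: "row \<times> row \<times> row \<Rightarrow> row list" where
  "outer_rows (a, b, c) =
     (let s = [comb b c R0 R0, comb b R0 c R0, comb b R0 R0 c] in
      map (\<lambda>r. comb a r R0 R0) s @ map (\<lambda>r. comb a R0 r R0) s @ map (\<lambda>r. comb a R0 R0 r) s)"

definition nonzero_rows :: "row list" where
  "nonzero_rows = [R1, R2, R3, R4, R5, R6, R7]"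

definition zero_rows :: "row list" where
  "zero_rows = [R0, R0, R0, R0, R0, R0, R0, R0, R0]"

primrec rows_sum :: "row list list \<Rightarrow> row list" where
  "rows_sum [] = zero_rows"
| "rows_sum (p # ps) = rows_add p (rows_sum ps)"

fun entry_ok :: "entry \<Rightarrow> bool" where
  "entry_ok (p, ds, syms, uss) \<longleftrightarrow>
     length p = 9 \<and> list_all (\<lambda>u. u \<noteq> Unknown) p \<and>
     list_all (\<lambda>(a, b, c). a \<in> set nonzero_rows \<and> b \<in> set nonzero_rows \<and> c \<in> set nonzero_rows) ds \<and>
     rows_sum (map outer_rows ds) = p \<and>
     list_all (\<lambda>m. move_valid m \<and> move_rows m p = p) syms \<and>
     chain_ok p 0 uss"

text \<open>The moves in \<open>gens\<close> fix the form, so they replace a simple tensor by a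
  smaller one without changing the orbit of the sum. Only simple tensors that none of them decreases
  need a move that takes the sum to a form.\<close>

definition neighbours_ok :: "row list \<Rightarrow> move list \<Rightarrow> move list \<Rightarrow> row list list \<Rightarrow> bool" where
  "neighbours_ok p gens ms qs \<longleftrightarrow>
     list_all (\<lambda>m. move_valid m \<and> move_rows m p = p) gens \<and> list_all move_valid ms \<and>
     list_all (\<lambda>a. list_all (\<lambda>b. list_all (\<lambda>c.
       list_ex (\<lambda>m. improves m (outer_rows (a, b, c))) gens \<or>
       list_ex (\<lambda>m. list_ex (\<lambda>q. q = move_rows m (rows_add p (outer_rows (a, b, c)))) qs) ms)
       nonzero_rows) nonzero_rows) nonzero_rows"

text \<open>The forms that the claimed ranks allow after adding a simple tensor to a form of rank r.
  The number of recorded terms stands in for the rank, which is only an upper bound so far.\<close>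

definition neighbour_forms :: "nat \<Rightarrow> row list list" where
  "neighbour_forms r = map fst
     (filter (\<lambda>(p, ds, _). if r = 6 then 5 \<le> length ds else length ds \<le> Suc r) catalogue)"

lemma entries_ok: "list_all entry_ok catalogue"
  by code_simp

lemma covers_all: "list_all move_valid descent_moves \<and> covers (map fst catalogue) descent_moves 9 []"
  by code_simp

lemma neighbours_all: "list_all (\<lambda>(p, ds, _). length ds = 4 \<or> length ds = 5 \<or>
    list_ex (\<lambda>(q, gens, ms). q = p \<and> neighbours_ok p gens ms (neighbour_forms (length ds)))
      neighbour_moves) catalogue"
  by code_simp

text \<open>168 = 7 * 6 * 4, the choices for each row outside the span of the preceding
  ones.\<close>

lemma length_regular_matrices:
  "length (filter mat_regular (concat (map (\<lambda>a.
     concat (map (\<lambda>b. map (Mat a b) known_rows) known_rows)) known_rows))) = 168"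
  by code_simp

section \<open>Orbit sizes\<close>

lemma covers_sound:
  assumes "covers qs ms n p" "list_all move_valid ms" "fits (p @ replicate n Unknown) X" "Unknown \<notin> set p"
  shows "X \<in> tensor_of ` set qs \<or> (\<exists>m\<in>set ms. tensor_less (move_tensor m X) X)"
  using assms(1,3,4)
proof (induction n arbitrary: p)
  case 0
  from "0.prems"(1) consider "p \<in> set qs" | m where "m \<in> set ms" "improves m p"
    by (auto simp: list_ex_iff)
  then show ?case
  proof cases
    case 1
    then show ?thesis using fits_known[of p X] "0.prems" by auto
  next
    case 2
    then show ?thesis using improves_tensor_less[of m p X] "0.prems" assms(2)
      by (auto simp: list_all_iff)
  qed
next
  case (Suc n)
  let ?p = "p @ replicate (Suc n) Unknown"
  from Suc.prems(1) consider m where "m \<in> set ms" "improves m ?p"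
    | "list_all (\<lambda>u. covers qs ms n (p @ [u])) known_rows"
    by (auto simp: list_ex_iff)
  then show ?case
  proof cases
    case 1
    then show ?thesis using improves_tensor_less[of m ?p X] Suc.prems assms(2)
      by (auto simp: list_all_iff)
  next
    case 2
    \<comment> \<open>Here \<open>x\<close> is the first open row of X. It is spelled by some known
      \<open>u\<close>, and the check for the segment extended by \<open>u\<close> applies to
      X.\<close>
    from Suc.prems(2) obtain xs x ys where xs: "tensor_rows X = xs @ x # ys"
      "list_all2 matches p xs" "list_all2 matches (replicate n Unknown) ys"
      by (auto simp: fits_def list_all2_append1 list_all2_Cons1)
    obtain u where u: "u \<noteq> Unknown" "row_vec u = x" using row_vec_surj by blast
    then have "u \<in> set known_rows" by (cases u) (simp_all add: known_rows_def)
    with 2 have "covers qs ms n (p @ [u])" by (auto simp: list_all_iff)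
    moreover have "fits ((p @ [u]) @ replicate n Unknown) X"
      unfolding fits_def xs(1) append_assoc
      by (intro list_all2_appendI xs(2)) (simp add: xs(3) matches_def u(2))
    moreover have "Unknown \<notin> set (p @ [u])" using u(1) Suc.prems(3) by simp
    ultimately show ?thesis by (rule Suc.IH)
  qed
qed

definition form :: "entry \<Rightarrow> tensor" where
  "form e = tensor_of (fst e)"

fun entry_rank :: "entry \<Rightarrow> nat" where
  "entry_rank (p, ds, syms, uss) = length ds"

fun entry_number :: "entry \<Rightarrow> nat" where
  "entry_number (p, ds, syms, uss) = symmetry_bound (map fst syms)"

fun entry_size :: "entry \<Rightarrow> nat" where
  "entry_size (p, ds, syms, uss) = 168 ^ 3 div chain_size uss"

text \<open>An improving move stays in the G-orbit, so the descent must end at a form. That the form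
  is also at most X will make the forms canonical.\<close>

lemma exists_form:
  "\<exists>e\<in>set catalogue. form e \<in> G_orbit X \<and> (form e = X \<or> tensor_less (form e) X)"
proof (induction X rule: tensor_less_induct)
  case (1 X)
  have "fits ([] @ replicate 9 Unknown) X"
    by (simp add: fits_def tensor_rows_def matches_def eval_nat_numeral)
  with covers_sound[of "map fst catalogue" descent_moves 9 "[]" X] covers_all
  consider e where "e \<in> set catalogue" "X = form e"
    | m where "m \<in> set descent_moves" "tensor_less (move_tensor m X) X"
    by (auto simp: form_def)
  then show ?case
  proof cases
    case 1
    then show ?thesis using G_orbit_refl by blast
  next
    case 2
    let ?Y = "move_tensor m X"
    have "?Y \<in> G_orbit X"
      using 2(1) covers_all by (intro move_tensor_G_orbit) (auto simp: list_all_iff)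
    then have "G_orbit ?Y = G_orbit X" by (rule G_orbit_eqI)
    moreover obtain e where e: "e \<in> set catalogue" "form e \<in> G_orbit ?Y"
      "form e = ?Y \<or> tensor_less (form e) ?Y"
      using "1.IH"[of ?Y] 2(2) by blast
    moreover have "tensor_less (form e) X"
      using e(3) 2(2) tensor_less_trans[of "form e" ?Y X] by auto
    ultimately show ?thesis by blast
  qed
qed

section \<open>Upper bounds for the sizes of orbits\<close>

lemma row_add_Unknown_iff: "row_add u v = Unknown \<longleftrightarrow> u = Unknown \<or> v = Unknown"
  by (cases u; cases v) simp_all

text \<open>Every invertible matrix occurs in the enumeration of regular ones. An upper bound for
  the order of H is the useful direction, since orbit sizes are bounded from above.\<close>

lemma card_invertible_le: "card {A :: matrix3. invertible A} \<le> 168"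
proof -
  let ?ms = "filter mat_regular (concat (map (\<lambda>a.
     concat (map (\<lambda>b. map (Mat a b) known_rows) known_rows)) known_rows))"
  have "A \<in> mat_matrix ` set ?ms" if inv: "invertible A" for A :: matrix3
  proof -
    obtain a where a: "a \<noteq> Unknown" "row_vec a = A $ 1" using row_vec_surj by blast
    obtain b where b: "b \<noteq> Unknown" "row_vec b = A $ 2" using row_vec_surj by blast
    obtain c where c: "c \<noteq> Unknown" "row_vec c = A $ 3" using row_vec_surj by blast
    note abc = a b c
    have A: "A = mat_matrix (Mat a b c)"
      by (simp add: abc vec3_eq_iff)
    obtain B where B: "A ** B = mat 1" using inv by (auto simp: invertible_def)
    have "comb u a b c \<noteq> R0 \<and> comb u a b c \<noteq> Unknown" if "u \<in> set [R1, R2, R3, R4, R5, R6, R7]" for u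
    proof -
      have u: "u \<noteq> Unknown" "u \<noteq> R0" using that by auto
      have m: "matches (comb u a b c) (transpose A *v row_vec u)"
        unfolding A mat_matrix.simps transpose_vector3
        by (rule matches_comb) (simp_all add: matches_row_vec)
      have "transpose A *v row_vec u \<noteq> 0"
      proof
        assume "transpose A *v row_vec u = 0"
        then have "transpose B *v (transpose A *v row_vec u) = 0" by simp
        then have "transpose (A ** B) *v row_vec u = 0"
          by (simp only: matrix_transpose_mul matrix_vector_mul_assoc)
        then have "row_vec u = row_vec R0" by (simp add: B transpose_mat vec3_eq_iff)
        then show False using row_vec_inject[of u R0] u by simp
      qed
      with m have "comb u a b c \<noteq> R0" by auto
      moreover have "comb u a b c \<noteq> Unknown"
        using abc(1,3,5) u(1) by (cases u) (simp_all add: row_add_Unknown_iff)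
      ultimately show ?thesis by blast
    qed
    then have "mat_regular (Mat a b c)"
      unfolding mat_regular.simps list_all_iff by blast
    moreover have known: "v \<in> set known_rows" if "v \<noteq> Unknown" for v
      using that by (cases v) (simp_all add: known_rows_def)
    ultimately have "Mat a b c \<in> set ?ms"
      using known[OF a(1)] known[OF b(1)] known[OF c(1)]
      by (simp add: image_iff del: mat_regular.simps)
    then show ?thesis unfolding A by (rule imageI)
  qed
  then have "{A :: matrix3. invertible A} \<subseteq> mat_matrix ` set ?ms" by blast
  then have "card {A :: matrix3. invertible A} \<le> card (mat_matrix ` set ?ms)"
    by (rule card_mono[OF finite_imageI[OF finite_set]])
  also have "\<dots> \<le> length ?ms"
    by (rule le_trans[OF card_image_le[OF finite_set] card_length])
  also have "\<dots> = 168" by (rule length_regular_matrices)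
  finally show ?thesis .
qed

lemma order_H_group_le: "order H_group \<le> 168 ^ 3"
proof -
  have "carrier H_group = {A. invertible A} \<times> {A. invertible A} \<times> {A. invertible A}"
    by (simp add: H_group_def GL3_def)
  then have "order H_group = card {A :: matrix3. invertible A} ^ 3"
    by (simp add: order_def card_cartesian_product power3_eq_cube)
  also have "\<dots> \<le> 168 ^ 3"
    by (rule power_mono[OF card_invertible_le]) simp
  finally show ?thesis .
qed

lemma catalogue_entry:
  assumes "(p, ds, syms, uss) \<in> set catalogue"
  shows "fits p (form (p, ds, syms, uss))" "Unknown \<notin> set p"
    "\<And>a b c. (a, b, c) \<in> set ds \<Longrightarrow> {a, b, c} \<subseteq> set nonzero_rows"
    "rows_sum (map outer_rows ds) = p"
    "\<And>m. m \<in> set syms \<Longrightarrow> move_valid m \<and> move_rows m p = p"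
    "chain_ok p 0 uss"
proof -
  have "entry_ok (p, ds, syms, uss)"
    using entries_ok assms unfolding list_all_iff by blast
  then show "fits p (form (p, ds, syms, uss))" "Unknown \<notin> set p"
    "\<And>a b c. (a, b, c) \<in> set ds \<Longrightarrow> {a, b, c} \<subseteq> set nonzero_rows"
    "rows_sum (map outer_rows ds) = p"
    "\<And>m. m \<in> set syms \<Longrightarrow> move_valid m \<and> move_rows m p = p"
    "chain_ok p 0 uss"
    by (auto simp: list_all_iff form_def fits_tensor_of)
qed

text \<open>Orbit-stabiliser theorem, with the chain bounding the stabiliser from below. Rounding
  down in \<open>entry_size\<close> is harmless because the size is an integer.\<close>

lemma card_H_orbit_form_le:
  assumes "e \<in> set catalogue"
  shows "card (H_orbit (form e)) \<le> entry_size e"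
proof -
  obtain p ds syms uss where e: "e = (p, ds, syms, uss)" by (metis prod_cases4)
  note ok = catalogue_entry[OF assms[unfolded e]]
  have stab: "stabilizer H_group H_act (form e) = partial_stabilizer (form e) 0"
    by (simp add: partial_stabilizer_def)
  have "card (H_orbit (form e)) * chain_size uss \<le>
      card (H_orbit (form e)) * card (stabilizer H_group H_act (form e))"
    unfolding stab
    using chain_size_le_card[OF ok(6) ok(1)[folded e] ok(2)] by simp
  also have "\<dots> = order H_group"
    by (rule H.orbit_stabilizer_theorem) simp
  also have "\<dots> \<le> 168 ^ 3" by (rule order_H_group_le)
  finally have "card (H_orbit (form e)) * chain_size uss \<le> 168 ^ 3" .
  moreover have "chain_size uss > 0" by (induction uss) auto
  ultimately show ?thesis by (simp add: e less_eq_div_iff_mult_less_eq)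
qed

lemma card_H_orbits_in_form_le:
  assumes "e \<in> set catalogue"
  shows "card (H_orbits_in (form e)) \<le> entry_number e"
proof -
  obtain p ds syms uss where e: "e = (p, ds, syms, uss)" by (metis prod_cases4)
  note ok = catalogue_entry[OF assms[unfolded e]]
  have "H_orbit (foldr swap_tensor ss (form e)) = H_orbit (form e)" if ss: "ss \<in> set (map fst syms)" for ss
  proof -
    obtain u where u: "(ss, u) \<in> set syms" using ss by auto
    have "move_tensor (ss, u) (form e) = form e"
      using move_tensor_eqI[OF ok(1,2)] ok(5)[OF u] e by simp
    then have "form e \<in> H_orbit (foldr swap_tensor ss (form e))"
      using move_tensor_H_orbit[of ss u "form e"] ok(5)[OF u] by simp
    then show ?thesis by (rule H_orbit_eqI[symmetric])
  qed
  then show ?thesis unfolding e entry_number.simps by (rule card_H_orbits_in_le)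
qed

lemma card_in_H_orbits_in: "U \<in> H_orbits_in X \<Longrightarrow> card U = card (H_orbit X)"
  unfolding H_orbits_in_def by (auto simp: card_H_orbit_swaps)

lemma Union_H_orbits_in: "\<Union>(H_orbits_in X) = G_orbit X"
  unfolding H_orbits_in_def G_orbit_words by simp

text \<open>Swaps map H-orbits bijectively to H-orbits, so all H-orbits in one G-orbit have the same
  size.\<close>

lemma card_G_orbit_le: "card (G_orbit X) \<le> card (H_orbits_in X) * card (H_orbit X)"
proof -
  have "card (G_orbit X) \<le> (\<Sum>U\<in>H_orbits_in X. card U)"
    unfolding Union_H_orbits_in[symmetric] by (rule card_Union_le_sum_card)
  then show ?thesis by (simp add: card_in_H_orbits_in)
qed

text \<open>The size of the type is at most the sum of the \<open>card (A i)\<close>, which is at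
  most the sum of the \<open>n i\<close>, which is at most the size of the type; so equality holds
  throughout. A common element of two of the sets would then be counted twice, and the union would
  be too small.\<close>

lemma tight_cover:
  fixes A :: "'i \<Rightarrow> 'b :: finite set" and n :: "'i \<Rightarrow> nat"
  assumes "finite I" "(\<Union>i\<in>I. A i) = UNIV" "\<And>i. i \<in> I \<Longrightarrow> card (A i) \<le> n i"
    and "(\<Sum>i\<in>I. n i) \<le> CARD('b)"
  shows "\<And>i. i \<in> I \<Longrightarrow> card (A i) = n i"
    and "\<And>i j. i \<in> I \<Longrightarrow> j \<in> I \<Longrightarrow> i \<noteq> j \<Longrightarrow> A i \<inter> A j = {}"
proof -
  have le: "CARD('b) \<le> (\<Sum>i\<in>I. card (A i))"
    using card_UN_le[OF assms(1), of A] by (simp add: assms(2))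
  have "(\<Sum>i\<in>I. card (A i)) \<le> (\<Sum>i\<in>I. n i)"
    by (rule sum_mono) (rule assms(3))
  with le assms(4) have eq: "(\<Sum>i\<in>I. card (A i)) = (\<Sum>i\<in>I. n i)" "(\<Sum>i\<in>I. card (A i)) = CARD('b)"
    by linarith+
  show "card (A i) = n i" if "i \<in> I" for i
    using sum_mono_inv[OF eq(1) assms(3) that assms(1)] .
  show "A i \<inter> A j = {}" if ij: "i \<in> I" "j \<in> I" "i \<noteq> j" for i j
  proof -
    define B where "B = (\<Union>k\<in>I - {i}. A k)"
    have "A i \<union> B = UNIV" using assms(2) ij(1) unfolding B_def by blast
    \<comment> \<open>Inclusion-exclusion for \<open>A i\<close> and the union \<open>B\<close> of
      all other sets.\<close>
    then have "CARD('b) + card (A i \<inter> B) = card (A i) + card B"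
      using card_Un_Int[of "A i" B] by simp
    also have "\<dots> \<le> card (A i) + (\<Sum>k\<in>I - {i}. card (A k))"
      unfolding B_def using card_UN_le[of "I - {i}" A] assms(1) by simp
    also have "\<dots> = CARD('b)"
      using eq(2) assms(1) ij(1) by (simp add: sum.remove)
    finally have "A i \<inter> B = {}" by simp
    then show ?thesis using ij unfolding B_def by blast
  qed
qed

text \<open>
  Form, rank, number of \<open>H\<close>-orbits, and the factors of the order of the stabiliser in \<open>H\<close>.
\<close>

definition summary :: "(row list \<times> nat \<times> nat \<times> nat list) list" where
  "summary = [
    ([R0, R0, R0, R0, R0, R0, R0, R0, R0], 0, 1, [7, 6, 4, 7, 6, 4, 7, 6, 4]),
    ([R0, R0, R0, R0, R0, R0, R0, R0, R1], 1, 1, [3, 2, 4, 3, 2, 4, 3, 2, 4]),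
    ([R0, R0, R0, R0, R0, R0, R0, R1, R2], 2, 3, [3, 2, 4, 1, 6, 4, 1, 2, 2]),
    ([R0, R0, R0, R0, R0, R1, R0, R2, R0], 2, 1, [1, 4, 2, 1, 2, 2, 1, 2, 2]),
    ([R0, R0, R0, R0, R0, R0, R1, R2, R4], 3, 3, [3, 2, 4, 7, 6, 4]),
    ([R0, R0, R0, R0, R1, R2, R0, R2, R3], 3, 1, [1, 6, 4, 1, 6, 2, 1, 2, 2]),
    ([R0, R0, R0, R0, R0, R1, R0, R1, R2], 3, 1, [1, 2, 4, 1, 2, 4, 1, 2, 2]),
    ([R0, R0, R0, R0, R1, R2, R0, R2, R4], 3, 3, [1, 6, 4, 1, 2, 2]),
    ([R0, R0, R0, R0, R0, R1, R0, R2, R4], 3, 3, [1, 2, 4, 1, 2, 4]),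
    ([R0, R0, R0, R0, R0, R1, R2, R4, R0], 3, 3, [1, 2, 2, 3, 2]),
    ([R0, R0, R0, R0, R1, R2, R4, R0, R2], 3, 3, [1, 6, 4]),
    ([R0, R0, R1, R0, R2, R0, R4, R0, R0], 3, 1, [3, 2]),
    ([R0, R0, R0, R0, R1, R2, R1, R0, R4], 4, 3, [1, 6, 4, 1, 1, 4]),
    ([R0, R1, R2, R1, R0, R4, R2, R6, R2], 4, 1, [1, 6, 4]),
    ([R0, R0, R0, R0, R0, R1, R1, R2, R4], 4, 3, [1, 2, 4, 1, 2, 4]),
    ([R0, R0, R1, R2, R4, R0, R4, R6, R0], 4, 1, [1, 3, 2, 3]),
    ([R0, R0, R0, R0, R1, R2, R1, R2, R4], 4, 3, [1, 2, 4, 1, 2, 2]),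
    ([R0, R0, R0, R0, R1, R2, R4, R2, R3], 4, 3, [1, 2, 4, 1, 3]),
    ([R0, R0, R1, R0, R1, R2, R4, R0, R0], 4, 1, [1, 2, 1, 1, 1, 2]),
    ([R0, R0, R0, R0, R1, R2, R1, R4, R0], 4, 3, [1, 2, 2, 1, 2]),
    ([R0, R0, R1, R0, R0, R2, R1, R4, R0], 4, 3, [1, 2, 2, 1, 2]),
    ([R0, R0, R1, R0, R2, R0, R3, R4, R4], 4, 3, [2, 1, 2, 1, 2]),
    ([R0, R0, R1, R2, R4, R0, R4, R6, R2], 4, 3, [1, 3, 2]),
    ([R0, R0, R1, R2, R4, R0, R4, R7, R2], 4, 3, [1, 3, 2]),
    ([R0, R0, R1, R0, R1, R2, R4, R0, R2], 4, 3, [1, 2, 2]),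
    ([R0, R0, R1, R0, R2, R0, R4, R0, R2], 4, 1, []),
    ([R0, R0, R1, R0, R2, R4, R4, R1, R0], 4, 1, []),
    ([R0, R0, R1, R0, R1, R2, R4, R2, R0], 4, 3, [1, 1, 2]),
    ([R0, R0, R1, R0, R2, R0, R4, R1, R2], 4, 3, [2]),
    ([R0, R0, R1, R0, R2, R4, R3, R4, R0], 4, 3, [1, 1, 2]),
    ([R0, R1, R2, R1, R0, R4, R2, R4, R0], 5, 1, [7, 6, 4]),
    ([R0, R0, R1, R0, R0, R2, R1, R2, R4], 5, 3, [3, 2, 4, 1, 1, 4]),
    ([R0, R0, R1, R0, R1, R2, R1, R2, R4], 5, 1, [1, 2, 4, 1, 2, 2]),
    ([R0, R0, R0, R1, R2, R4, R2, R4, R3], 5, 3, [1, 6, 2, 7]),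
    ([R0, R1, R2, R1, R0, R4, R2, R6, R3], 5, 1, [1, 2, 4]),
    ([R0, R1, R2, R1, R0, R4, R2, R4, R2], 5, 1, [1, 2, 2]),
    ([R0, R1, R2, R1, R0, R4, R4, R6, R0], 5, 1, [3]),
    ([R0, R1, R2, R1, R0, R4, R4, R6, R1], 5, 1, [3]),
    ([R0, R0, R1, R0, R1, R2, R1, R4, R0], 5, 3, [1, 2, 2, 1, 2]),
    ([R0, R0, R1, R0, R2, R4, R1, R4, R6], 5, 3, [1, 2, 4]),
    ([R0, R1, R2, R1, R0, R4, R2, R6, R4], 5, 1, [1, 1, 2]),
    ([R0, R1, R2, R1, R2, R4, R4, R4, R1], 5, 1, [1, 2]),
    ([R0, R1, R2, R1, R2, R4, R4, R4, R5], 5, 1, [1, 2]),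
    ([R0, R0, R1, R0, R1, R2, R2, R4, R0], 5, 3, [1, 1, 2, 1, 2]),
    ([R0, R0, R1, R2, R4, R0, R4, R7, R4], 5, 3, [1, 3]),
    ([R0, R1, R2, R1, R2, R4, R2, R4, R4], 5, 1, []),
    ([R0, R1, R2, R1, R2, R4, R4, R0, R2], 5, 3, [3]),
    ([R0, R1, R2, R1, R2, R4, R4, R0, R3], 5, 1, []),
    ([R0, R1, R2, R1, R2, R4, R4, R4, R2], 5, 3, [3]),
    ([R0, R1, R2, R1, R2, R4, R4, R4, R6], 5, 1, []),
    ([R0, R0, R1, R1, R2, R4, R4, R1, R2], 5, 3, [1, 2]),
    ([R0, R0, R1, R0, R2, R4, R4, R1, R2], 5, 3, []),
    ([R0, R0, R1, R1, R2, R4, R2, R4, R0], 5, 3, []),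
    ([R1, R2, R4, R2, R4, R3, R4, R3, R6], 6, 1, [7, 3, 1, 7]),
    ([R0, R1, R2, R1, R0, R4, R2, R4, R1], 6, 1, [3, 2, 4]),
    ([R0, R1, R2, R1, R2, R4, R2, R4, R3], 6, 1, [1, 6, 2])]"

text \<open>The certificates are evaluated away once; all later arithmetic runs on this digest of
  small numbers.\<close>

lemma summary_catalogue:
  "map (\<lambda>(p, ds, syms, uss). (p, length ds, symmetry_bound (map fst syms), map (\<lambda>us. Suc (length us)) uss))
     catalogue = summary"
  by code_simp

fun summary_data :: "row list \<times> nat \<times> nat \<times> nat list \<Rightarrow> nat \<times> nat \<times> nat" where
  "summary_data (p, r, k, ls) = (r, k, 168 ^ 3 div prod_list ls)"

lemma chain_size_conv: "chain_size uss = prod_list (map (\<lambda>us. Suc (length us)) uss)"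
  by (induction uss) simp_all

definition entry_data :: "entry \<Rightarrow> nat \<times> nat \<times> nat" where
  "entry_data e = (entry_rank e, entry_number e, entry_size e)"

lemma map_entry_data: "map entry_data catalogue = map summary_data summary"
proof -
  have "entry_data (p, ds, syms, uss) =
      summary_data (p, length ds, symmetry_bound (map fst syms), map (\<lambda>us. Suc (length us)) uss)" for p ds syms uss
    by (simp only: entry_data_def entry_rank.simps entry_number.simps entry_size.simps
      summary_data.simps chain_size_conv)
  then show ?thesis
    unfolding summary_catalogue[symmetric] map_map by (intro map_cong) auto
qed

lemma entry_data_catalogue:
  "map entry_data catalogue =
    [(0, 1, 1), (1, 1, 343), (2, 3, 2058), (2, 1, 37044), (3, 3, 1176), (3, 1, 4116), (3, 1,
     18522), (3, 3, 49392), (3, 3, 74088), (3, 3, 197568), (3, 3, 197568), (3, 1, 790272),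
     (4, 3, 49392), (4, 1, 197568), (4, 3, 74088), (4, 1, 263424), (4, 3, 148176), (4, 3,
     197568), (4, 1, 1185408), (4, 3, 592704), (4, 3, 592704), (4, 3, 592704), (4, 3,
     790272), (4, 3, 790272), (4, 3, 1185408), (4, 1, 4741632), (4, 1, 4741632), (4, 3,
     2370816), (4, 3, 2370816), (4, 3, 2370816), (5, 1, 28224), (5, 3, 49392), (5, 1,
     148176), (5, 3, 56448), (5, 1, 592704), (5, 1, 1185408), (5, 1, 1580544), (5, 1,
     1580544), (5, 3, 592704), (5, 3, 592704), (5, 1, 2370816), (5, 1, 2370816), (5, 1,
     2370816), (5, 3, 1185408), (5, 3, 1580544), (5, 1, 4741632), (5, 3, 1580544), (5, 1,
     4741632), (5, 3, 1580544), (5, 1, 4741632), (5, 3, 2370816), (5, 3, 4741632), (5, 3,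
     4741632), (6, 1, 32256), (6, 1, 197568), (6, 1, 395136)]"
  unfolding map_entry_data summary_def by simp

fun row_bits :: "row \<Rightarrow> bit list" where
  "row_bits R0 = [0, 0, 0]"
| "row_bits R1 = [0, 0, 1]"
| "row_bits R2 = [0, 1, 0]"
| "row_bits R3 = [0, 1, 1]"
| "row_bits R4 = [1, 0, 0]"
| "row_bits R5 = [1, 0, 1]"
| "row_bits R6 = [1, 1, 0]"
| "row_bits R7 = [1, 1, 1]"
| "row_bits Unknown = [0, 0, 0]"

lemma flattening_tensor_of:
  assumes "length p = 9"
  shows "flattening (tensor_of p) = concat (map row_bits p)"
proof -
  have "vec_bits (row_vec u) = row_bits u" for u
    by (cases u) (simp_all add: vec_bits_def)
  then show ?thesis
    using assms by (cases p rule: tensor_of.cases) (simp_all add: flattening_tensor_rows tensor_rows_def)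
qed

text \<open>\<open>tl\<close> drops the zero tensor, which heads the catalogue and is absent from
  the list of nonzero orbits.\<close>

lemma catalogue_flattening:
  "map (\<lambda>e. (entry_rank e, entry_number e * entry_size e, flattening (form e))) (tl catalogue) = canonical_list"
proof -
  let ?f = "\<lambda>(p, r, k, ls). (r, k * (168 ^ 3 div prod_list ls), concat (map row_bits p))"
  have "(entry_rank e, entry_number e * entry_size e, flattening (form e)) =
      ?f ((\<lambda>(p, ds, syms, uss). (p, length ds, symmetry_bound (map fst syms), map (\<lambda>us. Suc (length us)) uss)) e)"
    if "e \<in> set (tl catalogue)" for e
  proof -
    obtain p ds syms uss where e: "e = (p, ds, syms, uss)" by (metis prod_cases4)
    have "e \<in> set catalogue" using that by (metis list.sel(2) list.set_sel(2))
    then have "fits p (form e)" using catalogue_entry(1) e by blast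
    then have "flattening (form e) = concat (map row_bits p)"
      using flattening_tensor_of fits_length by (simp add: form_def e)
    then show ?thesis
      by (simp only: e entry_rank.simps entry_number.simps entry_size.simps chain_size_conv split_conv)
  qed
  then have "map (\<lambda>e. (entry_rank e, entry_number e * entry_size e, flattening (form e))) (tl catalogue) =
      map ?f (tl summary)"
    unfolding summary_catalogue[symmetric] map_tl[symmetric] map_map by (intro map_cong) auto
  also have "\<dots> = canonical_list"
    by (simp add: summary_def canonical_list_def)
  finally show ?thesis .
qed

lemma distinct_catalogue: "distinct (map fst catalogue)"
  by code_simp

lemma sum_catalogue:
  "(\<Sum>e\<in>{e \<in> set catalogue. P (entry_rank e)}. g (entry_data e)) =
     sum_list (map g (filter (\<lambda>d. P (fst d)) (map entry_data catalogue)))"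
proof -
  have "distinct (filter (\<lambda>e. P (entry_rank e)) catalogue)"
    using distinct_catalogue by (simp add: distinct_map)
  then have "(\<Sum>e\<in>set (filter (\<lambda>e. P (entry_rank e)) catalogue). g (entry_data e)) =
      sum_list (map (\<lambda>e. g (entry_data e)) (filter (\<lambda>e. P (entry_rank e)) catalogue))"
    by (rule sum.distinct_set_conv_list)
  then show ?thesis
    by (simp add: filter_map comp_def entry_data_def)
qed

section \<open>Sharpness of the bounds\<close>

lemma card_tensors: "CARD(tensor) = 2 ^ 27"
proof -
  have "(UNIV :: bit set) = {0, 1}" by auto
  then have "CARD(bit) = 2" by (metis card_2_iff zero_neq_one)
  then show ?thesis by simp
qed

text \<open>Since the orbits of the forms cover everything, a chain that misses part of a stabiliser
  or two forms in one orbit would push this sum above the number of tensors.\<close>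

lemma sum_entry_sizes: "(\<Sum>e\<in>set catalogue. entry_number e * entry_size e) = CARD(tensor)"
  unfolding card_tensors
  using sum_catalogue[where P = "\<lambda>_. True" and g = "\<lambda>(r, k, s). k * s"]
  by (simp add: entry_data_catalogue entry_data_def)

lemma G_orbits_cover: "(\<Union>e\<in>set catalogue. G_orbit (form e)) = UNIV"
proof -
  have "\<exists>e\<in>set catalogue. X \<in> G_orbit (form e)" for X
    using exists_form[of X] G.orbit_sym by blast
  then show ?thesis by blast
qed

lemma card_G_orbit_form_le:
  assumes "e \<in> set catalogue"
  shows "card (G_orbit (form e)) \<le> entry_number e * entry_size e"
  using card_G_orbit_le mult_le_mono[OF card_H_orbits_in_form_le[OF assms] card_H_orbit_form_le[OF assms]]
  by (rule order_trans)

lemmas tight_G_orbits =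
  tight_cover[OF finite_set G_orbits_cover card_G_orbit_form_le eq_refl[OF sum_entry_sizes]]

lemma card_G_orbit_form:
  "e \<in> set catalogue \<Longrightarrow> card (G_orbit (form e)) = entry_number e * entry_size e"
  by (rule tight_G_orbits(1))

lemma G_orbit_form_disjoint:
  "e \<in> set catalogue \<Longrightarrow> e' \<in> set catalogue \<Longrightarrow> e \<noteq> e' \<Longrightarrow>
    G_orbit (form e) \<inter> G_orbit (form e') = {}"
  by (rule tight_G_orbits(2))

lemma form_unique:
  assumes "e \<in> set catalogue" "e' \<in> set catalogue" "X \<in> G_orbit (form e)" "X \<in> G_orbit (form e')"
  shows "e = e'"
  using G_orbit_form_disjoint[OF assms(1,2)] assms(3,4) by blast

text \<open>The size of the G-orbit is now known to be the product of the two bounds, so neither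
  factor can fall short; the positive factor \<open>entry_size e\<close> cancels.\<close>

lemma card_H_orbits_in_form:
  assumes "e \<in> set catalogue"
  shows "card (H_orbits_in (form e)) = entry_number e"
proof (rule antisym[OF card_H_orbits_in_form_le[OF assms]])
  have pos: "0 < card (G_orbit (form e))"
    using G_orbit_refl by (auto simp: card_gt_0_iff)
  have "entry_number e * entry_size e \<le> card (H_orbits_in (form e)) * card (H_orbit (form e))"
    using card_G_orbit_le[of "form e"] by (simp add: card_G_orbit_form[OF assms])
  also have "\<dots> \<le> card (H_orbits_in (form e)) * entry_size e"
    using card_H_orbit_form_le[OF assms] by simp
  finally show "entry_number e \<le> card (H_orbits_in (form e))"
    using pos by (simp add: card_G_orbit_form[OF assms])
qed

text \<open>The descent from the minimum of the orbit ends at a form that is at most the minimum,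
  hence equal to it. As different forms lie in different orbits, this form is that of
  \<open>e\<close>.\<close>

lemma canonical_form_G_orbit:
  assumes "e \<in> set catalogue"
  shows "canonical_form (G_orbit (form e)) = form e"
proof -
  let ?Y = "canonical_form (G_orbit (form e))"
  have ne: "G_orbit (form e) \<noteq> {}" using G_orbit_refl by blast
  have Y: "?Y \<in> G_orbit (form e)" by (rule canonical_form_minimal(1)[OF ne])
  obtain e' where e': "e' \<in> set catalogue" "form e' \<in> G_orbit ?Y" "form e' = ?Y \<or> tensor_less (form e') ?Y"
    using exists_form by blast
  have mem: "form e' \<in> G_orbit (form e)" using e'(2) G_orbit_eqI[OF Y] by simp
  have "e' = e" by (rule form_unique[OF e'(1) assms G_orbit_refl mem])
  moreover have "form e' = ?Y"
    using e'(3) canonical_form_minimal(2)[OF ne mem] tensor_less_asym by blast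
  ultimately show ?thesis by simp
qed

section \<open>Ranks\<close>

lemma mv_mult_left: "mv A (\<lambda>i. k * x i) j = k * mv A x j"
  by (simp add: mv_def sum_distrib_left mult.left_commute)

lemma mv_mult_right: "mv A (\<lambda>i. x i * k) j = mv A x j * k"
  by (simp add: mv_def sum_distrib_right mult.assoc)

lemma mv_add: "mv A (\<lambda>i. x i + y i) j = mv A x j + mv A y j"
  by (simp add: mv_def distrib_left sum.distrib)

lemma H_act_outer_product:
  "H_act (A, B, C) (outer_product a b c) = outer_product (A *v a) (B *v b) (C *v c)"
proof -
  have mv: "mv M (\<lambda>i. x $ i) j = (M *v x) $ j" for M :: matrix3 and x j
    by (simp add: mv_def matrix_vector_mult_def)
  show ?thesis
    by (simp only: vec_eq_iff H_act_nth outer_product_def vec_lambda_beta mv_mult_left mv_mult_right mv simp_thms)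
qed

lemma H_act_add: "H_act h (X + Y) = H_act h X + H_act h Y"
proof -
  obtain A B C where "h = (A, B, C)" by (metis prod_cases3)
  then show ?thesis
    by (simp only: vec_eq_iff H_act_nth vector_add_component mv_add simp_thms)
qed

lemma swap_tensor_add: "swap_tensor s (X + Y) = swap_tensor s X + swap_tensor s Y"
  by (cases s) (simp_all only: swap_tensor.simps vec_eq_iff vec_lambda_beta vector_add_component simp_thms)

lemma swaps_add: "foldr swap_tensor ss (X + Y) = foldr swap_tensor ss X + foldr swap_tensor ss Y"
  by (induction ss) (simp_all only: foldr.simps id_apply o_apply swap_tensor_add)

lemma simple_tensor_swap: "simple_tensor T \<Longrightarrow> simple_tensor (swap_tensor s T)"
proof -
  have "swap_tensor Swap12 (outer_product a b c) = outer_product b a c"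
    "swap_tensor Swap23 (outer_product a b c) = outer_product a c b" for a b c
    by (simp_all add: swap_tensor.simps outer_product_def vec_eq_iff ac_simps)
  then show "simple_tensor T \<Longrightarrow> simple_tensor (swap_tensor s T)"
    unfolding simple_tensor_def by (cases s) metis+
qed

lemma simple_tensor_H_act:
  assumes "invertible A" "invertible B" "invertible C" "simple_tensor T"
  shows "simple_tensor (H_act (A, B, C) T)"
proof -
  have nz: "M *v x \<noteq> 0" if inv: "invertible M" and "x \<noteq> 0" for M :: matrix3 and x
  proof
    assume *: "M *v x = 0"
    obtain N where "N ** M = mat 1" using inv by (auto simp: invertible_def)
    then have "x = N *v (M *v x)" by (simp add: matrix_vector_mul_assoc)
    with * \<open>x \<noteq> 0\<close> show False by simp
  qed
  from assms(4) obtain a b c where "a \<noteq> 0" "b \<noteq> 0" "c \<noteq> 0" "T = outer_product a b c"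
    by (auto simp: simple_tensor_def)
  then show ?thesis
    unfolding simple_tensor_def using H_act_outer_product nz assms(1-3) by metis
qed

text \<open>Packs an element of G into a map with just the properties that matter for ranks, so that
  words and matrices need not be mentioned again.\<close>

lemma G_orbit_additive:
  assumes "Y \<in> G_orbit X"
  shows "\<exists>\<phi>. \<phi> X = Y \<and> (\<forall>U V. \<phi> (U + V) = \<phi> U + \<phi> V) \<and>
    (\<forall>T. simple_tensor T \<longrightarrow> simple_tensor (\<phi> T)) \<and> (\<forall>Z. \<phi> Z \<in> G_orbit Z)"
proof -
  from assms obtain ss h where h: "h \<in> carrier H_group" "Y = H_act h (foldr swap_tensor ss X)"
    unfolding G_orbit_words by (auto simp: orbit_def)
  obtain A B C where ABC: "h = (A, B, C)" by (metis prod_cases3)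
  define \<phi> where "\<phi> Z = H_act h (foldr swap_tensor ss Z)" for Z
  have inv: "invertible A" "invertible B" "invertible C"
    using h(1) by (simp_all add: ABC H_group_simps)
  have "simple_tensor (foldr swap_tensor ss T)" if "simple_tensor T" for T
    by (induction ss) (simp_all add: that simple_tensor_swap)
  then have "simple_tensor (\<phi> T)" if "simple_tensor T" for T
    unfolding \<phi>_def ABC using inv that by (blast intro: simple_tensor_H_act)
  moreover have "\<phi> Z \<in> G_orbit Z" for Z
  proof -
    have "\<phi> Z \<in> H_orbit (foldr swap_tensor ss Z)"
      unfolding \<phi>_def orbit_def using h(1) by blast
    then have "\<phi> Z \<in> G_orbit (foldr swap_tensor ss Z)"
      using H_orbit_subset_G_orbit by blast
    then show ?thesis by (simp only: G_orbit_eqI[OF swaps_in_G_orbit])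
  qed
  moreover have "\<phi> (U + V) = \<phi> U + \<phi> V" for U V
    by (simp only: \<phi>_def swaps_add H_act_add)
  moreover have "\<phi> X = Y" by (simp only: \<phi>_def h(2))
  ultimately show ?thesis by blast
qed

section \<open>Sums of simple tensors and the recorded decompositions\<close>

lemma is_sum_of_simple_0: "is_sum_of_simple 0 X \<longleftrightarrow> X = 0"
  by (auto simp: is_sum_of_simple_def)

lemma is_sum_of_simple_Suc:
  "is_sum_of_simple (Suc n) X \<longleftrightarrow> (\<exists>T Y. simple_tensor T \<and> is_sum_of_simple n Y \<and> X = Y + T)"
proof
  assume "is_sum_of_simple (Suc n) X"
  then obtain Us where Us: "length Us = Suc n" "\<forall>T\<in>set Us. simple_tensor T" "X = sum_list Us"
    unfolding is_sum_of_simple_def by blast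
  from Us(1) obtain T Ts where "Us = T # Ts" "length Ts = n" by (cases Us) simp_all
  with Us have "length Ts = n" "\<forall>T\<in>set (T # Ts). simple_tensor T" "X = sum_list (T # Ts)"
    by simp_all
  then show "\<exists>T Y. simple_tensor T \<and> is_sum_of_simple n Y \<and> X = Y + T"
    by (intro exI[of _ T] exI[of _ "sum_list Ts"]) (auto simp: is_sum_of_simple_def add.commute)
next
  assume "\<exists>T Y. simple_tensor T \<and> is_sum_of_simple n Y \<and> X = Y + T"
  then obtain T Ts where "length Ts = n" "\<forall>T\<in>set Ts. simple_tensor T" "simple_tensor T" "X = sum_list Ts + T"
    unfolding is_sum_of_simple_def by blast
  then show "is_sum_of_simple (Suc n) X"
    unfolding is_sum_of_simple_def by (intro exI[of _ "T # Ts"]) (auto simp: add.commute)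
qed

lemma is_sum_of_simple_G_orbit:
  assumes "is_sum_of_simple n X" "Y \<in> G_orbit X"
  shows "is_sum_of_simple n Y"
  using assms
proof (induction n arbitrary: X Y)
  case 0
  obtain \<phi> where \<phi>: "\<phi> X = Y" "\<And>U V. \<phi> (U + V) = \<phi> U + \<phi> V"
    using G_orbit_additive[OF "0.prems"(2)] by blast
  have "X = 0" using "0.prems"(1) by (simp add: is_sum_of_simple_0)
  \<comment> \<open>Additivity alone forces the image of 0 to be 0.\<close>
  then have "Y + Y = Y" using \<phi>(2)[of 0 0] \<phi>(1) by simp
  then show ?case by (simp add: is_sum_of_simple_0)
next
  case (Suc n)
  obtain \<phi> where \<phi>: "\<phi> X = Y" "\<And>U V. \<phi> (U + V) = \<phi> U + \<phi> V"
    "\<And>T. simple_tensor T \<Longrightarrow> simple_tensor (\<phi> T)" "\<And>Z. \<phi> Z \<in> G_orbit Z"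
    using G_orbit_additive[OF Suc.prems(2)] by blast
  from Suc.prems(1) obtain T Z where T: "simple_tensor T" "is_sum_of_simple n Z" "X = Z + T"
    by (auto simp: is_sum_of_simple_Suc)
  have "Y = \<phi> Z + \<phi> T" using \<phi>(1,2) T(3) by simp
  then show ?case
    unfolding is_sum_of_simple_Suc using \<phi>(3)[OF T(1)] Suc.IH[OF T(2) \<phi>(4)] by blast
qed

lemma matches_pick:
  assumes "matches v y"
  shows "matches (comb u v R0 R0) (row_vec u $ 1 *s y)" "matches (comb u R0 v R0) (row_vec u $ 2 *s y)"
    "matches (comb u R0 R0 v) (row_vec u $ 3 *s y)"
proof -
  have 0: "matches R0 0" by simp
  note m = matches_comb[OF matches_row_vec]
  show "matches (comb u v R0 R0) (row_vec u $ 1 *s y)" using m[OF assms 0 0, of u] by simp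
  show "matches (comb u R0 v R0) (row_vec u $ 2 *s y)" using m[OF 0 assms 0, of u] by simp
  show "matches (comb u R0 R0 v) (row_vec u $ 3 *s y)" using m[OF 0 0 assms, of u] by simp
qed

lemma fits_outer_rows: "fits (outer_rows (a, b, c)) (outer_product (row_vec a) (row_vec b) (row_vec c))"
proof -
  have "outer_product x y z $ i $ j = x $ i *s (y $ j *s z)" for x y z i j
    by (simp add: outer_product_def vec_eq_iff mult.assoc)
  then show ?thesis
    by (simp only: fits_def tensor_rows_def outer_rows.simps Let_def list.map append.simps
      list_all2_Cons list_all2_Nil matches_pick matches_row_vec simp_thms)
qed

lemma fits_rows_add: "fits p X \<Longrightarrow> fits q Y \<Longrightarrow> fits (rows_add p q) (X + Y)"
  unfolding fits_conv rows_add_def by (elim exE conjE) (simp add: matches_row_add)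

lemma fits_zero_rows: "fits zero_rows 0"
  by (simp add: fits_conv zero_rows_def)

lemma nonzero_rows_iff: "x \<noteq> 0 \<longleftrightarrow> (\<exists>u\<in>set nonzero_rows. row_vec u = x)"
proof -
  obtain u where u: "u \<noteq> Unknown" "row_vec u = x" using row_vec_surj by blast
  have "row_vec R0 = 0" by (simp add: vec3_eq_iff)
  then have 0: "row_vec v = 0 \<longleftrightarrow> v = R0" if "v \<noteq> Unknown" for v
    using row_vec_inject[OF that, of R0] by simp
  have 1: "v \<in> set nonzero_rows \<longleftrightarrow> v \<noteq> R0 \<and> v \<noteq> Unknown" for v
    by (cases v) (simp_all add: nonzero_rows_def)
  show ?thesis using u 0 1 by metis
qed

lemma is_sum_of_simple_rows_sum:
  assumes "\<And>a b c. (a, b, c) \<in> set ds \<Longrightarrow> {a, b, c} \<subseteq> set nonzero_rows"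
  shows "\<exists>X. fits (rows_sum (map outer_rows ds)) X \<and> is_sum_of_simple (length ds) X"
  using assms
proof (induction ds)
  case Nil
  then show ?case using fits_zero_rows by (auto simp: is_sum_of_simple_0)
next
  case (Cons d ds)
  obtain a b c where d: "d = (a, b, c)" by (metis prod_cases3)
  obtain X where X: "fits (rows_sum (map outer_rows ds)) X" "is_sum_of_simple (length ds) X"
    using Cons by (meson list.set_intros(2))
  let ?T = "outer_product (row_vec a) (row_vec b) (row_vec c)"
  have "{a, b, c} \<subseteq> set nonzero_rows" using Cons.prems[of a b c] d by simp
  then have "simple_tensor ?T"
    unfolding simple_tensor_def nonzero_rows_iff by blast
  then have "is_sum_of_simple (length (d # ds)) (X + ?T)"
    using X(2) by (auto simp: is_sum_of_simple_Suc)
  moreover have "fits (rows_sum (map outer_rows (d # ds))) (X + ?T)"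
    using fits_rows_add[OF fits_outer_rows X(1)] by (simp add: d add.commute)
  ultimately show ?case by blast
qed

lemma is_sum_of_simple_form:
  assumes "e \<in> set catalogue"
  shows "is_sum_of_simple (entry_rank e) (form e)"
proof -
  obtain p ds syms uss where e: "e = (p, ds, syms, uss)" by (metis prod_cases4)
  note ok = catalogue_entry[OF assms[unfolded e]]
  obtain X where "fits p X" "is_sum_of_simple (length ds) X"
    using is_sum_of_simple_rows_sum[of ds] ok(3,4) by metis
  then show ?thesis
    using fits_known[OF _ ok(2)] ok(1) by (metis e entry_rank.simps)
qed

section \<open>Adding one simple tensor\<close>

lemma move_tensor_add: "move_tensor m (X + Y) = move_tensor m X + move_tensor m Y"
  by (cases m) (simp only: move_tensor.simps swaps_add H_act_add)

lemma move_tensor_simple: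
  assumes "move_valid m" "simple_tensor T"
  shows "simple_tensor (move_tensor m T)"
proof -
  obtain ss A B C where m: "m = (ss, A, B, C)" by (metis prod_cases4)
  have "simple_tensor (foldr swap_tensor ss T)"
    by (induction ss) (simp_all add: assms(2) simple_tensor_swap)
  then show ?thesis
    using assms(1) unfolding m move_tensor.simps
    by (intro simple_tensor_H_act mat_regular_invertible) simp_all
qed

text \<open>Induction on T along the order of tensors: if m fixes X, then X + m T = m (X + T) stays
  in the G-orbit of X + T while T decreases.\<close>

lemma neighbours_sound:
  assumes "neighbours_ok p gens ms qs" "fits p X" "Unknown \<notin> set p"
    and qs: "\<And>q. q \<in> set qs \<Longrightarrow> Unknown \<notin> set q"
    and "simple_tensor T"
  shows "\<exists>q\<in>set qs. tensor_of q \<in> G_orbit (X + T)"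
  using assms(5)
proof (induction T rule: tensor_less_induct)
  case (1 T)
  from "1.prems" obtain a b c where abc: "a \<in> set nonzero_rows" "b \<in> set nonzero_rows" "c \<in> set nonzero_rows"
    "T = outer_product (row_vec a) (row_vec b) (row_vec c)"
    unfolding simple_tensor_def nonzero_rows_iff by blast
  let ?t = "outer_rows (a, b, c)"
  have t: "fits ?t T" unfolding abc(4) by (rule fits_outer_rows)
  have gens: "move_valid m" "move_rows m p = p" if "m \<in> set gens" for m
    using assms(1) that by (simp_all add: neighbours_ok_def list_all_iff)
  have ms: "move_valid m" if "m \<in> set ms" for m
    using assms(1) that by (simp add: neighbours_ok_def list_all_iff)
  from assms(1) abc(1-3) consider m where "m \<in> set gens" "improves m ?t"
    | m q where "m \<in> set ms" "q \<in> set qs" "q = move_rows m (rows_add p ?t)"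
    unfolding neighbours_ok_def list_all_iff list_ex_iff by blast
  then show ?case
  proof cases
    case 1
    note m = gens[OF 1(1)]
    let ?T = "move_tensor m T"
    have X: "move_tensor m X = X" by (rule move_tensor_eqI[OF assms(2,3) m])
    have "tensor_less ?T T" by (rule improves_tensor_less[OF 1(2) t m(1)])
    moreover have "simple_tensor ?T" by (rule move_tensor_simple[OF m(1) "1.prems"])
    ultimately obtain q where q: "q \<in> set qs" "tensor_of q \<in> G_orbit (X + ?T)"
      using "1.IH"[of ?T] by blast
    have "X + ?T \<in> G_orbit (X + T)"
      using move_tensor_G_orbit[OF m(1), of "X + T"] by (simp only: move_tensor_add X)
    then show ?thesis using q G_orbit_eqI by blast
  next
    case 2
    have "fits q (move_tensor m (X + T))"
      unfolding 2(3) by (intro fits_move fits_rows_add assms(2) t ms 2(1))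
    then have "move_tensor m (X + T) = tensor_of q" by (rule fits_known) (rule qs[OF 2(2)])
    then show ?thesis using move_tensor_G_orbit[OF ms[OF 2(1)], of "X + T"] 2(2) by auto
  qed
qed

lemma neighbour_form:
  assumes "e \<in> set catalogue" "entry_rank e \<noteq> 4" "entry_rank e \<noteq> 5" "simple_tensor T"
  shows "\<exists>e'\<in>set catalogue. form e + T \<in> G_orbit (form e') \<and>
    (if entry_rank e = 6 then 5 \<le> entry_rank e' else entry_rank e' \<le> Suc (entry_rank e))"
proof -
  obtain p ds syms uss where e: "e = (p, ds, syms, uss)" by (metis prod_cases4)
  note ok = catalogue_entry[OF assms(1)[unfolded e]]
  from neighbours_all assms(1-3) obtain gens ms where "neighbours_ok p gens ms (neighbour_forms (length ds))"
    by (auto simp: e list_all_iff list_ex_iff)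
  moreover have "Unknown \<notin> set q" if "q \<in> set (neighbour_forms (length ds))" for q
    using that catalogue_entry(2) by (auto simp: neighbour_forms_def split: if_splits)
  ultimately obtain q where q: "q \<in> set (neighbour_forms (length ds))" "tensor_of q \<in> G_orbit (form e + T)"
    using neighbours_sound[OF _ ok(1)[folded e] ok(2) _ assms(4)] by blast
  from q(1) obtain e' where e': "e' \<in> set catalogue" "fst e' = q"
    "if entry_rank e = 6 then 5 \<le> entry_rank e' else entry_rank e' \<le> Suc (entry_rank e)"
    by (auto simp: neighbour_forms_def e)
  have "form e + T \<in> G_orbit (form e')"
    using q(2) e'(2) G.orbit_sym by (simp add: form_def)
  with e' show ?thesis by blast
qed

text \<open>An additive map takes Y to the form and T to another simple tensor; the check at the
  form covers all simple tensors, so it carries over to the whole orbit.\<close>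

lemma neighbour_G_orbit:
  assumes "e \<in> set catalogue" "entry_rank e \<noteq> 4" "entry_rank e \<noteq> 5" "simple_tensor T" "Y \<in> G_orbit (form e)"
  shows "\<exists>e'\<in>set catalogue. Y + T \<in> G_orbit (form e') \<and>
    (if entry_rank e = 6 then 5 \<le> entry_rank e' else entry_rank e' \<le> Suc (entry_rank e))"
proof -
  have "form e \<in> G_orbit Y" using assms(5) G.orbit_sym by blast
  from G_orbit_additive[OF this] obtain \<phi> where \<phi>: "\<phi> Y = form e" "\<And>U V. \<phi> (U + V) = \<phi> U + \<phi> V"
    "\<And>T. simple_tensor T \<Longrightarrow> simple_tensor (\<phi> T)" "\<And>Z. \<phi> Z \<in> G_orbit Z"
    by blast
  have "\<phi> (Y + T) = form e + \<phi> T" by (simp only: \<phi>(1,2))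
  then have "G_orbit (form e + \<phi> T) = G_orbit (Y + T)"
    using G_orbit_eqI[OF \<phi>(4)] by metis
  then have "Y + T \<in> G_orbit (form e + \<phi> T)" using G_orbit_refl by simp
  then show ?thesis
    using neighbour_form[OF assms(1-3) \<phi>(3)[OF assms(4)]] G_orbit_eqI by metis
qed

lemma entry_rank_le: "e \<in> set catalogue \<Longrightarrow> entry_rank e \<le> 6"
proof -
  have "list_all (\<lambda>d. fst d \<le> 6) (map entry_data catalogue)"
    unfolding entry_data_catalogue by simp
  then show "e \<in> set catalogue \<Longrightarrow> entry_rank e \<le> 6"
    by (simp add: list_all_iff entry_data_def)
qed

lemma zero_form: "\<exists>e\<in>set catalogue. form e = 0 \<and> entry_rank e = 0"
proof -
  have "hd catalogue \<in> set catalogue" "fst (hd catalogue) = zero_rows" "entry_rank (hd catalogue) = 0"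
    by (simp_all add: catalogue_def zero_rows_def)
  moreover have "tensor_of zero_rows = 0"
    using fits_known[OF fits_zero_rows] by (simp add: zero_rows_def)
  ultimately show ?thesis by (metis form_def)
qed

text \<open>Building X up from 0 by n simple tensors, the number of terms recorded for the current
  orbit grows by at most 1 in each step. This is the lower bound for the rank.\<close>

lemma form_rank_le:
  assumes "is_sum_of_simple n X"
  shows "\<exists>e\<in>set catalogue. X \<in> G_orbit (form e) \<and> entry_rank e \<le> n"
  using assms
proof (induction n arbitrary: X)
  case 0
  obtain e where "e \<in> set catalogue" "form e = 0" "entry_rank e = 0"
    using zero_form by blast
  moreover have "0 \<in> G_orbit 0" by (rule G_orbit_refl)
  ultimately show ?case using 0 by (intro bexI[of _ e]) (simp_all add: is_sum_of_simple_0)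
next
  case (Suc n)
  then obtain T Y where T: "simple_tensor T" "is_sum_of_simple n Y" "X = Y + T"
    by (auto simp: is_sum_of_simple_Suc)
  obtain e where e: "e \<in> set catalogue" "Y \<in> G_orbit (form e)" "entry_rank e \<le> n"
    using Suc.IH[OF T(2)] by blast
  obtain e' where e': "e' \<in> set catalogue" "X \<in> G_orbit (form e')"
    using G_orbits_cover by blast
  \<comment> \<open>Adding \<open>T\<close> does not lead from rank 4 to rank 6, as adding \<open>T\<close> again would lead back.\<close>
  have "entry_rank e' \<le> Suc n"
  proof (rule ccontr)
    assume gt: "\<not> entry_rank e' \<le> Suc n"
    have le: "entry_rank e' \<le> 6" "entry_rank e \<le> 6" by (rule entry_rank_le; fact)+
    show False
    proof (cases "entry_rank e \<le> 3")
      case True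
      then obtain e'' where "e'' \<in> set catalogue" "X \<in> G_orbit (form e'')" "entry_rank e'' \<le> Suc (entry_rank e)"
        using neighbour_G_orbit[OF e(1) _ _ T(1) e(2)] T(3) by auto
      then show False
        using form_unique[OF e'(1) _ e'(2)] e(3) gt by fastforce
    next
      case False
      \<comment> \<open>T + T = 0 over F_2.\<close>
      have "X + T = Y"
        by (simp add: T(3) vec_eq_iff)
      \<comment> \<open>\<open>entry_rank e\<close> is at least 4 and at most n, and
        \<open>entry_rank e'\<close> exceeds n + 1 but not 6; this leaves 4 and 6.\<close>
      with False gt le e(3) have "entry_rank e' = 6" "entry_rank e = 4" by linarith+
      then obtain e'' where "e'' \<in> set catalogue" "X + T \<in> G_orbit (form e'')" "5 \<le> entry_rank e''"
        using neighbour_G_orbit[OF e'(1) _ _ T(1) e'(2)] by auto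
      then show False
        using form_unique[OF e(1) _ e(2)] \<open>X + T = Y\<close> \<open>entry_rank e = 4\<close> by fastforce
    qed
  qed
  with e' show ?case by blast
qed

text \<open>The recorded decomposition bounds the rank from above. A shorter sum would put X into
  the orbit of a form with fewer terms, which must be the same form.\<close>

lemma tensor_rank_form:
  assumes "e \<in> set catalogue" "X \<in> G_orbit (form e)"
  shows "tensor_rank X = entry_rank e"
  unfolding tensor_rank_def
proof (rule Least_equality)
  show "is_sum_of_simple (entry_rank e) X"
    by (rule is_sum_of_simple_G_orbit[OF is_sum_of_simple_form[OF assms(1)] assms(2)])
  show "entry_rank e \<le> n" if "is_sum_of_simple n X" for n
    using form_rank_le[OF that] form_unique[OF assms(1) _ assms(2)] by blast
qed

section \<open>The table\<close>

lemma G_orbits_conv: "G_orbits = (\<lambda>e. G_orbit (form e)) ` set catalogue"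
proof -
  have "\<exists>e\<in>set catalogue. G_orbit X = G_orbit (form e)" for X
    using G_orbits_cover G_orbit_eqI by blast
  then show ?thesis by (auto simp: orbits_def)
qed

lemma inj_on_G_orbit_form: "inj_on (\<lambda>e. G_orbit (form e)) (set catalogue)"
  by (rule inj_onI) (metis G_orbit_refl form_unique)

lemma H_orbits_conv: "H_orbits = (\<Union>e\<in>set catalogue. H_orbits_in (form e))"
proof -
  have "\<exists>e\<in>set catalogue. H_orbit X \<subseteq> G_orbit (form e)" for X
  proof -
    obtain e where "e \<in> set catalogue" "X \<in> G_orbit (form e)" using G_orbits_cover by blast
    then show ?thesis using H_orbit_subset_G_orbit[of X] G_orbit_eqI by metis
  qed
  then have "\<exists>e\<in>set catalogue. U \<subseteq> G_orbit (form e)" if "U \<in> H_orbits" for U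
    using that by (auto simp: orbits_def)
  then show ?thesis unfolding H_orbits_in_conv by blast
qed

lemma H_orbits_nonempty: "U \<in> H_orbits \<Longrightarrow> U \<noteq> {}"
  using H_orbit_refl by (auto simp: orbits_def)

lemma tensor_rank_image:
  assumes "e \<in> set catalogue" "U \<noteq> {}" "U \<subseteq> G_orbit (form e)"
  shows "tensor_rank ` U = {entry_rank e}"
  using assms tensor_rank_form[OF assms(1)] by (auto simp: image_iff subset_iff)

lemma card_G_orbits_rank:
  "card {U \<in> G_orbits. tensor_rank ` U = {r}} = card {e \<in> set catalogue. entry_rank e = r}"
proof -
  have "{U \<in> G_orbits. tensor_rank ` U = {r}} = (\<lambda>e. G_orbit (form e)) ` {e \<in> set catalogue. entry_rank e = r}"
    unfolding G_orbits_conv using tensor_rank_image[OF _ _ order_refl] G_orbit_refl by fastforce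
  then show ?thesis
    using inj_on_G_orbit_form by (metis (no_types, lifting) card_image inj_on_subset mem_Collect_eq subsetI)
qed

text \<open>H-orbits are nonempty and those of different forms lie in disjoint G-orbits, so none is
  counted twice.\<close>

lemma card_H_orbits_UN:
  assumes "S \<subseteq> set catalogue"
  shows "card (\<Union>e\<in>S. H_orbits_in (form e)) = (\<Sum>e\<in>S. entry_number e)"
proof -
  have "card (\<Union>e\<in>S. H_orbits_in (form e)) = (\<Sum>e\<in>S. card (H_orbits_in (form e)))"
  proof (rule card_UN_disjoint)
    show "finite S" using assms finite_subset by blast
    show "\<forall>e\<in>S. \<forall>e'\<in>S. e \<noteq> e' \<longrightarrow> H_orbits_in (form e) \<inter> H_orbits_in (form e') = {}"
    proof (intro ballI impI)
      fix e e' assume e: "e \<in> S" "e' \<in> S" "e \<noteq> e'"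
      have "U \<notin> H_orbits_in (form e')" if "U \<in> H_orbits_in (form e)" for U
        using that G_orbit_form_disjoint[of e e'] e assms H_orbits_nonempty[of U]
        unfolding H_orbits_in_conv by blast
      then show "H_orbits_in (form e) \<inter> H_orbits_in (form e') = {}" by blast
    qed
  qed simp
  also have "\<dots> = (\<Sum>e\<in>S. entry_number e)"
    using assms by (intro sum.cong) (auto simp: card_H_orbits_in_form)
  finally show ?thesis .
qed

lemma card_H_orbits_rank:
  "card {U \<in> H_orbits. tensor_rank ` U = {r}} = (\<Sum>e\<in>{e \<in> set catalogue. entry_rank e = r}. entry_number e)"
proof -
  have "{U \<in> H_orbits. tensor_rank ` U = {r}} =
      (\<Union>e\<in>{e \<in> set catalogue. entry_rank e = r}. H_orbits_in (form e))"
  proof -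
    have "tensor_rank ` U = {entry_rank e}" if "e \<in> set catalogue" "U \<in> H_orbits_in (form e)" for e U
      using that tensor_rank_image[OF that(1), of U] H_orbits_nonempty by (auto simp: H_orbits_in_conv)
    then have "tensor_rank ` U = {r} \<longleftrightarrow> entry_rank e = r"
      if "e \<in> set catalogue" "U \<in> H_orbits_in (form e)" for e U
      using that by simp
    then show ?thesis unfolding H_orbits_conv by blast
  qed
  then show ?thesis by (simp add: card_H_orbits_UN)
qed

lemma card_tensors_rank:
  "card {X. tensor_rank X = r} =
     (\<Sum>e\<in>{e \<in> set catalogue. entry_rank e = r}. entry_number e * entry_size e)"
proof -
  have "{X. tensor_rank X = r} = (\<Union>e\<in>{e \<in> set catalogue. entry_rank e = r}. G_orbit (form e))"
  proof (intro subset_antisym subsetI)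
    fix X assume X: "X \<in> {X. tensor_rank X = r}"
    obtain e where e: "e \<in> set catalogue" "X \<in> G_orbit (form e)" using G_orbits_cover by blast
    then have "entry_rank e = r" using X tensor_rank_form[OF e] by simp
    with e show "X \<in> (\<Union>e\<in>{e \<in> set catalogue. entry_rank e = r}. G_orbit (form e))" by blast
  next
    fix X assume "X \<in> (\<Union>e\<in>{e \<in> set catalogue. entry_rank e = r}. G_orbit (form e))"
    then obtain e where e: "e \<in> set catalogue" "X \<in> G_orbit (form e)" "entry_rank e = r" by blast
    then show "X \<in> {X. tensor_rank X = r}" using tensor_rank_form[OF e(1,2)] by simp
  qed
  also have "card \<dots> = (\<Sum>e\<in>{e \<in> set catalogue. entry_rank e = r}. card (G_orbit (form e)))"
    by (rule card_UN_disjoint) (auto dest: G_orbit_form_disjoint)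
  also have "\<dots> = (\<Sum>e\<in>{e \<in> set catalogue. entry_rank e = r}. entry_number e * entry_size e)"
    by (rule sum.cong) (simp_all add: card_G_orbit_form)
  finally show ?thesis .
qed

lemma tensor_rank_eq_0_iff: "tensor_rank X = 0 \<longleftrightarrow> X = 0"
proof
  assume "tensor_rank X = 0"
  moreover have "is_sum_of_simple (tensor_rank X) X"
    unfolding tensor_rank_def using exists_sum_of_simple by (rule LeastI_ex)
  ultimately show "X = 0" by (simp add: is_sum_of_simple_0)
next
  assume "X = 0"
  then show "tensor_rank X = 0"
    unfolding tensor_rank_def by (intro Least_equality) (simp_all add: is_sum_of_simple_0)
qed

text \<open>Since 0 is the only tensor of rank 0, discarding the orbit {0} becomes a condition on
  the ranks of the entries.\<close>

lemma zero_orbit: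
  assumes "U \<noteq> {}"
  shows "U = {0} \<longleftrightarrow> tensor_rank ` U = {0}"
proof -
  have "U = {0} \<longleftrightarrow> (\<forall>X\<in>U. X = 0)" using assms by auto
  also have "\<dots> \<longleftrightarrow> (\<forall>X\<in>U. tensor_rank X = 0)" by (simp only: tensor_rank_eq_0_iff)
  also have "\<dots> \<longleftrightarrow> tensor_rank ` U = {0}" using assms by auto
  finally show ?thesis .
qed

lemma UN_Diff_singleton:
  assumes "\<And>i x. i \<in> I \<Longrightarrow> x \<in> A i \<Longrightarrow> x = z \<longleftrightarrow> \<not> P i"
  shows "(\<Union>i\<in>I. A i) - {z} = (\<Union>i\<in>{i \<in> I. P i}. A i)"
  using assms by auto

lemma image_Diff_singleton:
  assumes "\<And>i. i \<in> I \<Longrightarrow> f i = z \<longleftrightarrow> \<not> P i"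
  shows "f ` I - {z} = f ` {i \<in> I. P i}"
  using assms by auto

theorem mainTheorem2:
  shows
    "(\<forall>X. tensor_rank X \<le> 6)
   \<and> card (H_orbits - {{0}}) = 115
   \<and> card (G_orbits - {{0}}) = 55
   \<and> map (\<lambda>r. card {U \<in> H_orbits. tensor_rank ` U = {r}}) [0, 1, 2, 3, 4, 5, 6]
       = [1, 1, 4, 18, 44, 45, 3]
   \<and> map (\<lambda>r. card {U \<in> G_orbits. tensor_rank ` U = {r}}) [0, 1, 2, 3, 4, 5, 6]
       = [1, 1, 2, 8, 18, 23, 3]
   \<and> map (\<lambda>r. card {X. tensor_rank X = r}) [0, 1, 2, 3, 4, 5, 6]
       = [1, 343, 43218, 2372286, 47506872, 83670048, 624960]
   \<and> bij_betw (\<lambda>U. (tensor_rank (canonical_form U), card U, flattening (canonical_form U)))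
       (G_orbits - {{0}}) (set canonical_list)"
proof -
  let ?nz = "{e \<in> set catalogue. entry_rank e \<noteq> 0}"
  have form0: "form e = 0 \<longleftrightarrow> entry_rank e = 0" if "e \<in> set catalogue" for e
    using tensor_rank_form[OF that G_orbit_refl] tensor_rank_eq_0_iff by metis
  have rank: "tensor_rank X \<le> 6" for X
  proof -
    obtain e where e: "e \<in> set catalogue" "X \<in> G_orbit (form e)" using G_orbits_cover by blast
    show ?thesis using tensor_rank_form[OF e] entry_rank_le[OF e(1)] by simp
  qed
  have H: "H_orbits - {{0}} = (\<Union>e\<in>?nz. H_orbits_in (form e))"
  proof -
    have "U = {0} \<longleftrightarrow> entry_rank e = 0" if "e \<in> set catalogue" "U \<in> H_orbits_in (form e)" for e U
    proof -
      have "U \<noteq> {}" "U \<subseteq> G_orbit (form e)"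
        using that(2) H_orbits_nonempty unfolding H_orbits_in_conv by blast+
      then show ?thesis using zero_orbit[of U] tensor_rank_image[OF that(1), of U] by simp
    qed
    then show ?thesis
      unfolding H_orbits_conv by (intro UN_Diff_singleton) simp
  qed
  have G: "G_orbits - {{0}} = (\<lambda>e. G_orbit (form e)) ` ?nz"
  proof -
    have "G_orbit (form e) = {0} \<longleftrightarrow> entry_rank e = 0" if "e \<in> set catalogue" for e
    proof -
      have "G_orbit (form e) \<noteq> {}" using G_orbit_refl by blast
      then show ?thesis
        using zero_orbit[of "G_orbit (form e)"] tensor_rank_image[OF that, of "G_orbit (form e)"] by simp
    qed
    then show ?thesis
      unfolding G_orbits_conv by (intro image_Diff_singleton) simp
  qed
  have inj: "inj_on (\<lambda>e. G_orbit (form e)) ?nz"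
    by (rule inj_on_subset[OF inj_on_G_orbit_form]) blast
  \<comment> \<open>Every count in the table is a sum of a function of rank, number of H-orbits and
    orbit size; this turns it into a sum over the explicit list in
    \<open>entry_data_catalogue\<close>.\<close>
  have sum: "(\<Sum>e\<in>{e \<in> set catalogue. P (entry_rank e)}. g (entry_rank e) (entry_number e) (entry_size e)) =
      sum_list (map (\<lambda>(r, k, s). g r k s) (filter (\<lambda>d. P (fst d)) (map entry_data catalogue)))"
    for P and g :: "nat \<Rightarrow> nat \<Rightarrow> nat \<Rightarrow> nat"
    unfolding sum_catalogue[symmetric] by (simp add: entry_data_def)
  have "card (H_orbits - {{0}}) = 115"
    unfolding H using sum[where P = "\<lambda>r. r \<noteq> 0" and g = "\<lambda>_ k _. k"]
    by (simp add: card_H_orbits_UN entry_data_catalogue)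
  moreover have "card (G_orbits - {{0}}) = 55"
    unfolding G card_image[OF inj] using sum[where P = "\<lambda>r. r \<noteq> 0" and g = "\<lambda>_ _ _. 1"]
    by (simp add: entry_data_catalogue del: One_nat_def)
  moreover have "map (\<lambda>r. card {U \<in> H_orbits. tensor_rank ` U = {r}}) [0, 1, 2, 3, 4, 5, 6]
      = [1, 1, 4, 18, 44, 45, 3]"
    unfolding card_H_orbits_rank using sum[where P = "\<lambda>r'. r' = r" and g = "\<lambda>_ k _. k" for r]
    by (simp add: entry_data_catalogue)
  moreover have "map (\<lambda>r. card {U \<in> G_orbits. tensor_rank ` U = {r}}) [0, 1, 2, 3, 4, 5, 6]
      = [1, 1, 2, 8, 18, 23, 3]"
    unfolding card_G_orbits_rank using sum[where P = "\<lambda>r'. r' = r" and g = "\<lambda>_ _ _. 1" for r]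
    by (simp add: entry_data_catalogue)
  moreover have "map (\<lambda>r. card {X. tensor_rank X = r}) [0, 1, 2, 3, 4, 5, 6]
      = [1, 343, 43218, 2372286, 47506872, 83670048, 624960]"
    unfolding card_tensors_rank using sum[where P = "\<lambda>r'. r' = r" and g = "\<lambda>_ k s. k * s" for r]
    by (simp add: entry_data_catalogue)
  moreover have "bij_betw (\<lambda>U. (tensor_rank (canonical_form U), card U, flattening (canonical_form U)))
      (G_orbits - {{0}}) (set canonical_list)"
  proof -
    let ?f = "\<lambda>U. (tensor_rank (canonical_form U), card U, flattening (canonical_form U))"
    let ?g = "\<lambda>e. (entry_rank e, entry_number e * entry_size e, flattening (form e))"
    have f: "?f (G_orbit (form e)) = ?g e" if "e \<in> set catalogue" for e
      using that by (simp add: canonical_form_G_orbit card_G_orbit_form tensor_rank_form[OF that G_orbit_refl])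
    have "inj_on ?f (G_orbits - {{0}})"
    proof (rule inj_onI)
      fix U V assume UV: "U \<in> G_orbits - {{0}}" "V \<in> G_orbits - {{0}}" "?f U = ?f V"
      then obtain d e where de: "d \<in> set catalogue" "U = G_orbit (form d)" "e \<in> set catalogue" "V = G_orbit (form e)"
        unfolding G_orbits_conv by blast
      \<comment> \<open>The third component alone suffices: a flattening determines the form, and
        the form determines its orbit.\<close>
      have "form d = form e"
        using UV(3) f[OF de(1)] f[OF de(3)] by (simp add: de(2,4) flattening_inject)
      then show "U = V" by (simp add: de(2,4))
    qed
    moreover have "?f ` (G_orbits - {{0}}) = set canonical_list"
    proof -
      have "?f ` (G_orbits - {{0}}) = ?g ` ?nz"
        unfolding G image_image by (rule image_cong) (simp_all only: f mem_Collect_eq)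
      \<comment> \<open>The head of the catalogue is the only entry of rank 0.\<close>
      also have "?nz = set (tl catalogue)"
      proof -
        have "list_all (\<lambda>d. fst d \<noteq> 0) (tl (map entry_data catalogue))" "fst (hd (map entry_data catalogue)) = 0"
          unfolding entry_data_catalogue by simp_all
        moreover obtain e0 es where c: "catalogue = e0 # es"
          by (metis list.exhaust list.distinct(1) catalogue_def)
        ultimately have "\<forall>e\<in>set es. entry_rank e \<noteq> 0" "entry_rank e0 = 0"
          unfolding c list.map list.sel by (simp_all add: list_all_iff entry_data_def)
        then show ?thesis unfolding c list.sel list.set by blast
      qed
      also have "?g ` set (tl catalogue) = set (map ?g (tl catalogue))" by simp
      also have "\<dots> = set canonical_list" by (simp only: catalogue_flattening)
      finally show ?thesis .
    qed
    ultimately show ?thesis by (simp add: bij_betw_def)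
  qed
  ultimately show ?thesis using rank by blast
qed

end
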